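(* Let $\Gamma$ be a connected cubic girth-regular graph of girth $g$ with $g\le 5$. Then either the signature of $\Gamma$ is $(0,1,1)$ and $\Gamma$ is isomorphic to the truncation $\mathrm{Tr}(\Lambda,\leftrightarrow)$ of a dihedral scheme $\leftrightarrow$ on some $g$-regular graph $\Lambda$ (possibly with parallel edges), or one of the following occurs: (1) $g=3$ and $\Gamma\cong K_4$, with signature $(2,2,2)$; (2) $g=4$ and $\Gamma$ is isomorphic to a prism $Y_n$ or to a Möbius ladder $M_n$ for some $n$, with signature $(4,4,4)$ if $\Gamma\cong K_{3,3}$, signature $(2,2,2)$ if $\Gamma$ is isomorphic to the cube $Q_3$, and signature $(1,1,2)$ otherwise; (3) $g=5$ and $\Gamma$ is isomorphic to the Petersen graph, with signature $(4,4,4)$, or to the dodecahedron graph, with signature $(2,2,2)$.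
   Context: $\Gamma$ is a finite simple graph. For a graph of finite girth $g$, a girth cycle is a cycle of length $g$, and $\epsilon(e)$ is the number of girth cycles containing the edge $e$. The signature of a vertex $v$ with incident edges $e_1,\ldots,e_k$ ordered so that $\epsilon(e_1)\le\cdots\le\epsilon(e_k)$ is $(\epsilon(e_1),\ldots,\epsilon(e_k))$; a graph is girth-regular if all vertices have the same signature (the signature of the graph). Cubic means $3$-regular. A graph with parallel edges and loops is a triple $(V,E,\partial)$ with $\partial:E\to\{X\subseteq V:|X|\le 2\}$ giving the end-vertices of each edge. Each edge consists of two mutually inverse arcs, each having one end-vertex as its tail; $A(\Lambda)$ is the set of arcs and $\mathrm{out}(u)$ the set of arcs with tail $u$; the valence of $u$ is $|\mathrm{out}(u)|$. A dihedral scheme on $\Lambda$ is an irreflexive symmetric relation $\leftrightarrow$ on $A(\Lambda)$ such that the simple graph $(A(\Lambda),\leftrightarrow)$ is $2$-regular and its connected components are exactly the sets $\mathrm{out}(u)$, $u\in V$. The truncation $\mathrm{Tr}(\Lambda,\leftrightarrow)$ is the simple graph with vertex set $A(\Lambda)$ in which arcs $s,t$ are adjacent iff $s\leftrightarrow t$ or $s,t$ are inverse to each other. For $n\ge3$, the Möbius ladder $M_n$ is the Cayley graph $\mathrm{Cay}(\mathbb{Z}_{2n},\{-1,1,n\})$, and the prism $Y_n$ is the Cartesian product $C_n\,\square\,K_2$. *)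

theory Defs
  imports
    "Graph_Theory.Digraph_Isomorphism"
    "Graph_Theory.Kuratowski"
    "HOL-Library.Extended_Nat"
    "HOL-Library.Multiset"
    "HOL-Algebra.Elementary_Groups"
begin

text \<open>
  Finite simple graphs are \<^locale>\<open>pair_graph\<close>s, i.e. finite loop-free symmetric relations;
  an undirected edge is the two-element set of its ends.
\<close>

definition regular :: "nat \<Rightarrow> ('a, 'b) pre_digraph \<Rightarrow> bool" where
  "regular k G \<longleftrightarrow> (\<forall>v \<in> verts G. out_degree G v = k)"

definition uedge :: "'a \<times> 'a \<Rightarrow> 'a set" where
  "uedge a = {fst a, snd a}"

definition uedges :: "'a pair_pre_digraph \<Rightarrow> 'a set set" where
  "uedges G = uedge ` parcs G"


subsection \<open>Girth and signatures\<close>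

text \<open>
  An undirected cycle is identified with its edge set, so that the different starting points and
  directions of a closed walk are not counted separately. The bound on the length excludes the
  directed cycles that traverse one edge back and forth.
\<close>

definition ucycles :: "'a pair_pre_digraph \<Rightarrow> 'a set set set" where
  "ucycles G = {uedge ` set p | p. pre_digraph.cycle (with_proj G) p \<and> 3 \<le> length p}"

definition girth :: "'a pair_pre_digraph \<Rightarrow> enat" where
  "girth G = (INF C \<in> ucycles G. enat (card C))"

definition girth_cycles :: "'a pair_pre_digraph \<Rightarrow> 'a set set set" where
  "girth_cycles G = {C \<in> ucycles G. enat (card C) = girth G}"

definition eps :: "'a pair_pre_digraph \<Rightarrow> 'a set \<Rightarrow> nat" where
  "eps G e = card {C \<in> girth_cycles G. e \<in> C}"

definition vertex_signature :: "'a pair_pre_digraph \<Rightarrow> 'a \<Rightarrow> nat list" where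
  "vertex_signature G v =
     sorted_list_of_multiset (image_mset (eps G) (mset_set {e \<in> uedges G. v \<in> e}))"

definition has_signature :: "'a pair_pre_digraph \<Rightarrow> nat list \<Rightarrow> bool" where
  "has_signature G \<sigma> \<longleftrightarrow> (\<forall>v \<in> pverts G. vertex_signature G v = \<sigma>)"

definition girth_regular :: "'a pair_pre_digraph \<Rightarrow> bool" where
  "girth_regular G \<longleftrightarrow> girth G \<noteq> \<infinity> \<and> (\<exists>\<sigma>. has_signature G \<sigma>)"


subsection \<open>Graphs with parallel edges and loops, dihedral schemes, truncations\<close>

record ('v, 'e) multigraph =
  mverts :: "'v set"
  medges :: "'e set"
  mends :: "'e \<Rightarrow> 'v set"

definition multigraph :: "('v, 'e) multigraph \<Rightarrow> bool" where
  "multigraph L \<longleftrightarrow> finite (mverts L) \<and> finite (medges L) \<and>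
     (\<forall>e \<in> medges L. mends L e \<subseteq> mverts L \<and> card (mends L e) \<in> {1, 2})"

definition loopless :: "('v, 'e) multigraph \<Rightarrow> bool" where
  "loopless L \<longleftrightarrow> (\<forall>e \<in> medges L. card (mends L e) \<noteq> 1)"

text \<open>
  An arc is a triple of an edge, its tail and a flag. The flag is free only on loops, so that a
  loop at \<open>u\<close> also has two arcs, both with tail \<open>u\<close>.
\<close>

definition marcs :: "('v, 'e) multigraph \<Rightarrow> ('e \<times> 'v \<times> bool) set" where
  "marcs L = {(e, u, b). e \<in> medges L \<and> u \<in> mends L e \<and> (b \<longrightarrow> mends L e = {u})}"

definition mout :: "('v, 'e) multigraph \<Rightarrow> 'v \<Rightarrow> ('e \<times> 'v \<times> bool) set" where
  "mout L u = {s \<in> marcs L. fst (snd s) = u}"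

definition mregular :: "nat \<Rightarrow> ('v, 'e) multigraph \<Rightarrow> bool" where
  "mregular k L \<longleftrightarrow> (\<forall>u \<in> mverts L. card (mout L u) = k)"

definition inverse_arcs :: "('v, 'e) multigraph \<Rightarrow> ('e \<times> 'v \<times> bool) rel" where
  "inverse_arcs L = {(s, t) \<in> marcs L \<times> marcs L. fst s = fst t \<and> s \<noteq> t}"

text \<open>
  In a symmetric digraph the strongly connected components are the connected components.
\<close>

definition dihedral_scheme :: "('v, 'e) multigraph \<Rightarrow> ('e \<times> 'v \<times> bool) rel \<Rightarrow> bool" where
  "dihedral_scheme L R \<longleftrightarrow>
     R \<subseteq> marcs L \<times> marcs L \<and> irrefl R \<and> sym R \<and>
     (let A = with_proj \<lparr>pverts = marcs L, parcs = R\<rparr>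
      in regular 2 A \<and> pre_digraph.sccs_verts A = mout L ` mverts L)"

definition truncation ::
  "('v, 'e) multigraph \<Rightarrow> ('e \<times> 'v \<times> bool) rel \<Rightarrow> ('e \<times> 'v \<times> bool) pair_pre_digraph" where
  "truncation L R = \<lparr>pverts = marcs L, parcs = R \<union> inverse_arcs L\<rparr>"


subsection \<open>Particular graphs\<close>

definition cayley_graph :: "('a, 'm) monoid_scheme \<Rightarrow> 'a set \<Rightarrow> 'a pair_pre_digraph" where
  "cayley_graph G S =
     \<lparr>pverts = carrier G, parcs = {(x, x \<otimes>\<^bsub>G\<^esub> s) | x s. x \<in> carrier G \<and> s \<in> S}\<rparr>"

definition moebius_ladder :: "nat \<Rightarrow> int pair_pre_digraph" where
  "moebius_ladder n =
     (let Z = integer_mod_group (2 * n) in cayley_graph Z {inv\<^bsub>Z\<^esub> 1, 1, int n})"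

definition cartesian_product ::
  "'a pair_pre_digraph \<Rightarrow> 'b pair_pre_digraph \<Rightarrow> ('a \<times> 'b) pair_pre_digraph" where
  "cartesian_product G H =
     \<lparr>pverts = pverts G \<times> pverts H,
      parcs = {((a, x), (b, x)) | a b x. (a, b) \<in> parcs G \<and> x \<in> pverts H} \<union>
              {((a, x), (a, y)) | a x y. a \<in> pverts G \<and> (x, y) \<in> parcs H}\<rparr>"

definition sym_graph :: "'a set \<Rightarrow> 'a rel \<Rightarrow> 'a pair_pre_digraph" where
  "sym_graph V R = \<lparr>pverts = V, parcs = R \<union> R\<inverse>\<rparr>"

definition cycle_graph :: "nat \<Rightarrow> nat pair_pre_digraph" where
  "cycle_graph n = sym_graph {..<n} {(i, Suc i mod n) | i. i < n}"

definition complete_graph_2 :: "bool pair_pre_digraph" where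
  "complete_graph_2 = sym_graph UNIV {(False, True)}"

definition prism :: "nat \<Rightarrow> (nat \<times> bool) pair_pre_digraph" where
  "prism n = cartesian_product (cycle_graph n) complete_graph_2"

definition cube_graph :: "(bool \<times> bool \<times> bool) pair_pre_digraph" where
  "cube_graph =
     cartesian_product complete_graph_2 (cartesian_product complete_graph_2 complete_graph_2)"

text \<open>
  The generalized Petersen graph \<open>GP(n, k)\<close>: an outer \<open>n\<close>-cycle (flag \<open>False\<close>), inner vertices
  (flag \<open>True\<close>) joined in steps of \<open>k\<close>, and spokes. The Petersen graph is \<open>GP(5, 2)\<close> (pentagon
  and pentagram), the skeleton of the dodecahedron is \<open>GP(10, 2)\<close>.
\<close>

definition generalized_petersen :: "nat \<Rightarrow> nat \<Rightarrow> (nat \<times> bool) pair_pre_digraph" where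
  "generalized_petersen n k = sym_graph ({..<n} \<times> UNIV)
     ({((i, False), (Suc i mod n, False)) | i. i < n} \<union>
      {((i, False), (i, True)) | i. i < n} \<union>
      {((i, True), ((i + k) mod n, True)) | i. i < n})"

definition petersen_graph :: "(nat \<times> bool) pair_pre_digraph" where
  "petersen_graph = generalized_petersen 5 2"

definition dodecahedron_graph :: "(nat \<times> bool) pair_pre_digraph" where
  "dodecahedron_graph = generalized_petersen 10 2"

end

theory Submission
  imports Defs
begin

text \<open>
  Count girth cycles through paths of length two instead of through edges: if the vertex \<open>v\<close> has
  neighbours \<open>x, y, z\<close>, then the number of girth cycles through \<open>vx\<close> is \<open>n(x, y) + n(x, z)\<close>, where
  \<open>n(x, y)\<close> counts those through the path \<open>xvy\<close>. Hence girth-regularity says that the multiset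
  \<open>{n(x, y), n(x, z), n(y, z)}\<close> is the same at every vertex. For girth 3, 4, 5 each of these numbers
  is at most 1, 2, 2.

  \<^item> In signature \<open>(0, 1, 1)\<close> the girth cycles partition the vertices, and contracting them gives the
    graph of which \<open>\<Gamma>\<close> is a truncation; girth cycles have no chords, so no loops arise.
  \<^item> In girth 4 with multiset \<open>{0, 1, 1}\<close> the edges on two girth cycles form a perfect matching, which
    is a fixed-point-free involution of the 2-regular graph formed by the other edges: it swaps two
    cycles (prism) or is the half turn of a single one (Moebius ladder).
  \<^item> In girth 5 with multiset \<open>{0, a, b}\<close>, \<open>a, b > 0\<close>, the edges lying on \<open>a + b\<close> girth cycles would
    alternate along every 5-cycle.
  \<^item> In the remaining cases the local structure determines a closed finite configuration.
\<close>

section \<open>Cycles as cyclic vertex lists\<close>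

text \<open>The signature lists values of single edges, but the counts \<open>npath\<close> are what
  local adjacency determines. They can be recovered: the three counts at a vertex add up to half the
  sum of the signature, and each edge value is that total minus the count for the two other edges.
  So a configuration found at one convenient vertex constrains its neighbours.

  Few multisets remain. Besides {0, 0, 1}, which is signature (0, 1, 1), girth 3 leaves {0, 1, 1},
  which is impossible, and {1, 1, 1}; girth 4 leaves {1, 1, 1}, {0, 1, 1} and everything containing
  a 2; girth 5 leaves {0, 0, 2} and {0, a, b}, both impossible, {1, 1, 1}, and the positive triples
  with a 2, which all end in the Petersen graph.

  No bound on the number of vertices is available in advance. A copy of the target is grown inside
  the graph; once every vertex of the copy has its three neighbours there, connectedness says that
  nothing else exists. The main labour is to show that the vertices met on the way are
  distinct.\<close>

definition cycle_edges :: "'a list \<Rightarrow> 'a set set" where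
  "cycle_edges vs = (\<lambda>i. {vs ! i, vs ! (Suc i mod length vs)}) ` {..<length vs}"

lemma Suc_mod_image: "n > 0 \<Longrightarrow> (\<lambda>i. Suc i mod n) ` {..<n} = {..<n}"
proof -
  assume n: "n > 0"
  have "inj_on (\<lambda>i. Suc i mod n) {..<n}"
    by (auto simp: inj_on_def mod_Suc split: if_splits)
  moreover have "(\<lambda>i. Suc i mod n) ` {..<n} \<subseteq> {..<n}" using n by auto
  ultimately show ?thesis by (simp add: endo_inj_surj)
qed

lemma cycle_edges_rotate1: "cycle_edges (rotate1 vs) = cycle_edges vs"
proof (cases "vs = []")
  case False
  let ?n = "length vs" and ?f = "\<lambda>i. {vs ! i, vs ! (Suc i mod length vs)}"
  have "cycle_edges (rotate1 vs) = (\<lambda>i. ?f (Suc i mod ?n)) ` {..<?n}"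
    unfolding cycle_edges_def using False by (auto simp: nth_rotate1 intro!: image_cong)
  also have "\<dots> = ?f ` (\<lambda>i. Suc i mod ?n) ` {..<?n}" by (simp add: image_image)
  also have "\<dots> = cycle_edges vs" using False Suc_mod_image[of ?n] by (simp add: cycle_edges_def)
  finally show ?thesis .
qed (simp add: cycle_edges_def)

lemma cycle_edges_rotate: "cycle_edges (rotate k vs) = cycle_edges vs"
  by (induction k) (simp_all add: rotate_def cycle_edges_rotate1)

text \<open>The recursive condition that consecutive arcs fit becomes an equation between words,
  both sides spelling the vertex sequence. For a closed walk it says that the heads are the tails
  rotated by one.\<close>

lemma pcas_iff: "pcas u p v \<longleftrightarrow> map fst p @ [v] = u # map snd p"
  by (induction p arbitrary: u) auto

lemma pawalk_verts_pcas: "pcas u p v \<Longrightarrow> pawalk_verts u p = u # map snd p"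
  by (induction p arbitrary: u) auto

context pair_graph
begin

definition adj :: "'a \<Rightarrow> 'a \<Rightarrow> bool" where
  "adj u v \<longleftrightarrow> (u, v) \<in> parcs G"

lemma adj_sym: "adj u v \<longleftrightarrow> adj v u"
  unfolding adj_def using arcs_symmetric by auto

lemma adj_irrefl [simp]: "\<not> adj u u"
  unfolding adj_def using no_loops' by auto

lemma adj_verts: "adj u v \<Longrightarrow> u \<in> pverts G" "adj u v \<Longrightarrow> v \<in> pverts G"
  unfolding adj_def by (auto dest: in_arcsD1 in_arcsD2)

text \<open>Successors are taken modulo the length, so the closing edge needs no clause of its own
  and the condition is visibly invariant under rotation.\<close>

definition vcycle :: "'a list \<Rightarrow> bool" where
  "vcycle vs \<longleftrightarrow> distinct vs \<and> 3 \<le> length vs \<and>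
     (\<forall>i < length vs. adj (vs ! i) (vs ! (Suc i mod length vs)))"

lemma vcycle_rotate1:
  assumes "vcycle vs"
  shows "vcycle (rotate1 vs)"
proof -
  have "0 < length vs" using assms by (auto simp: vcycle_def)
  then have "Suc i mod length vs < length vs" for i by simp
  then show ?thesis using assms by (auto simp: vcycle_def nth_rotate1)
qed

lemma vcycle_rotate: "vcycle vs \<Longrightarrow> vcycle (rotate k vs)"
  by (induction k) (simp_all add: rotate_def vcycle_rotate1)

text \<open>The heads of a closed walk are its rotated tails, so the tails carry all information;
  conversely, zipping a vertex list with its rotation restores the arcs.\<close>

lemma ucycles_eq: "ucycles G = cycle_edges ` {vs. vcycle vs}"
proof (intro subset_antisym subsetI)
  fix C assume "C \<in> ucycles G"
  then obtain p u where p: "C = uedge ` set p" "3 \<le> length p" "set p \<subseteq> parcs G"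
      "pcas u p u" "distinct (tl (pawalk_verts u p))" "p \<noteq> []"
    by (auto simp: ucycles_def pre_digraph.cycle_def pre_digraph.awalk_def
        cas_with_proj_eq awalk_verts_with_proj_eq)
  have d: "distinct (map snd p)" using p pawalk_verts_pcas[of u p u] by simp
  have r: "rotate1 (map fst p) = map snd p"
    using p(4,6) by (cases p) (auto simp: pcas_iff)
  have s: "snd (p ! i) = fst (p ! (Suc i mod length p))" if "i < length p" for i
  proof -
    have "snd (p ! i) = rotate1 (map fst p) ! i" using that r by simp
    also have "\<dots> = fst (p ! (Suc i mod length p))"
    proof -
      have "Suc i mod length p < length p" using p(6) by simp
      then show ?thesis using that by (simp add: nth_rotate1)
    qed
    finally show ?thesis .
  qed
  have lt: "Suc i mod length p < length p" for i using p(6) by simp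
  have "distinct (map fst p)" using d r by (metis distinct1_rotate)
  moreover have "adj (fst (p ! i)) (fst (p ! (Suc i mod length p)))" if "i < length p" for i
    unfolding adj_def using s[OF that] p(3) nth_mem[OF that] by (metis prod.collapse subsetD)
  ultimately have "vcycle (map fst p)" using p(2) lt by (simp add: vcycle_def)
  moreover have "C = cycle_edges (map fst p)"
  proof -
    have "C = (\<lambda>i. uedge (p ! i)) ` {..<length p}"
      using p(1) by (force simp: set_conv_nth)
    also have "\<dots> = cycle_edges (map fst p)"
      unfolding cycle_edges_def by (rule image_cong) (use s lt in \<open>auto simp: uedge_def\<close>)
    finally show ?thesis .
  qed
  ultimately show "C \<in> cycle_edges ` {vs. vcycle vs}" by blast
next
  fix C assume "C \<in> cycle_edges ` {vs. vcycle vs}"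
  then obtain vs where vs: "vcycle vs" "C = cycle_edges vs" by blast
  let ?p = "zip vs (rotate1 vs)"
  have ne: "vs \<noteq> []" using vs by (auto simp: vcycle_def)
  then have lt: "Suc i mod length vs < length vs" for i by simp
  have len: "length ?p = length vs" by simp
  have nth: "?p ! i = (vs ! i, vs ! (Suc i mod length vs))" if "i < length vs" for i
    using that by (simp add: nth_rotate1)
  have "set ?p \<subseteq> parcs G"
    using vs nth by (auto simp: in_set_conv_nth vcycle_def adj_def nth_rotate1)
  moreover have "pcas (hd vs) ?p (hd vs)"
    using ne by (cases vs) (auto simp: pcas_iff)
  moreover have "distinct (tl (pawalk_verts (hd vs) ?p))"
    using calculation(2) vs by (simp add: pawalk_verts_pcas vcycle_def)
  moreover have "hd vs \<in> pverts G"
    using vs(1) lt[of 0] ne unfolding vcycle_def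
    by (metis adj_verts(1) hd_conv_nth length_greater_0_conv)
  moreover have "?p \<noteq> []" using ne by (cases vs) auto
  ultimately have "pre_digraph.cycle (with_proj G) ?p"
    by (auto simp: pre_digraph.cycle_def pre_digraph.awalk_def
        cas_with_proj_eq awalk_verts_with_proj_eq)
  moreover have "C = uedge ` set ?p"
  proof -
    have "uedge ` set ?p = (\<lambda>i. uedge (?p ! i)) ` {..<length vs}"
      using len by (force simp: set_conv_nth)
    also have "\<dots> = cycle_edges vs"
      unfolding cycle_edges_def by (rule image_cong) (use nth in \<open>auto simp: uedge_def\<close>)
    finally show ?thesis using vs by simp
  qed
  ultimately show "C \<in> ucycles G" using vs(1) len unfolding ucycles_def vcycle_def by auto
qed

text \<open>If two different positions gave the same edge, each would be the cyclic successor of the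
  other, and the length would divide 2.\<close>

lemma card_cycle_edges:
  assumes "vcycle vs"
  shows "card (cycle_edges vs) = length vs"
proof -
  let ?n = "length vs"
  have n: "?n \<ge> 3" and d: "distinct vs" using assms by (auto simp: vcycle_def)
  have "inj_on (\<lambda>i. {vs ! i, vs ! (Suc i mod ?n)}) {..<?n}"
  proof (rule inj_onI)
    fix i j assume ij: "i \<in> {..<?n}" "j \<in> {..<?n}"
      and eq: "{vs ! i, vs ! (Suc i mod ?n)} = {vs ! j, vs ! (Suc j mod ?n)}"
    have lt: "Suc i mod ?n < ?n" "Suc j mod ?n < ?n" using ij by (auto intro!: mod_less_divisor)
    from eq have "i = j \<or> i = Suc j mod ?n \<and> Suc i mod ?n = j"
      using d ij lt by (auto simp: doubleton_eq_iff nth_eq_iff_index_eq)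
    then show "i = j" using n ij by (auto simp: mod_Suc split: if_splits)
  qed
  then show ?thesis unfolding cycle_edges_def by (simp add: card_image)
qed

text \<open>Position 0 suffices, because rotation brings any vertex of the cycle there and keeps the
  edge set.\<close>

lemma cycle_edges_first:
  assumes "vcycle vs"
  shows "{vs ! 0, w} \<in> cycle_edges vs \<longleftrightarrow> w = vs ! 1 \<or> w = vs ! (length vs - 1)"
proof -
  let ?n = "length vs"
  have n: "?n \<ge> 3" and d: "distinct vs" using assms by (auto simp: vcycle_def)
  have *: "w = vs ! 1 \<or> w = vs ! (?n - 1)"
    if "i < ?n" "{vs ! 0, w} = {vs ! i, vs ! (Suc i mod ?n)}" for i
  proof -
    have lt: "Suc i mod ?n < ?n" using n by (intro mod_less_divisor) linarith
    from that(2) have "vs ! 0 = vs ! i \<and> w = vs ! (Suc i mod ?n) \<or> vs ! 0 = vs ! (Suc i mod ?n) \<and> w = vs ! i"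
      by (auto simp: doubleton_eq_iff)
    then have "i = 0 \<and> w = vs ! (Suc i mod ?n) \<or> Suc i mod ?n = 0 \<and> w = vs ! i"
      using d lt that(1) n by (metis length_greater_0_conv list.size(3) not_numeral_le_zero nth_eq_iff_index_eq)
    then show ?thesis using n that(1)
      by (auto simp: mod_Suc split: if_splits dest!: sym[of "Suc i"])
  qed
  have "{vs ! 0, vs ! 1} \<in> cycle_edges vs"
    unfolding cycle_edges_def using n by (intro image_eqI[of _ _ 0]) auto
  moreover have "{vs ! 0, vs ! (?n - 1)} \<in> cycle_edges vs"
  proof -
    have "Suc (?n - 1) = ?n" using n by simp
    then have "Suc (?n - 1) mod ?n = 0" by simp
    then show ?thesis unfolding cycle_edges_def using n by (intro image_eqI[of _ _ "?n - 1"]) auto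
  qed
  moreover have "w = vs ! 1 \<or> w = vs ! (?n - 1)" if w: "{vs ! 0, w} \<in> cycle_edges vs"
  proof -
    obtain i where "{vs ! 0, w} = {vs ! i, vs ! (Suc i mod ?n)}" "i \<in> {..<?n}"
      using w unfolding cycle_edges_def by (rule imageE)
    then show ?thesis using * by simp
  qed
  ultimately show ?thesis by metis
qed

lemma cycle_through_vertex:
  assumes "vcycle us" "{v, x} \<in> cycle_edges us"
  obtains vs where "vcycle vs" "cycle_edges vs = cycle_edges us" "length vs = length us" "vs ! 0 = v"
proof -
  have "0 < length us" using assms(1) by (auto simp: vcycle_def)
  then have "Suc i mod length us < length us" for i by simp
  moreover obtain i where "{v, x} = {us ! i, us ! (Suc i mod length us)}" "i \<in> {..<length us}"
    using assms(2) unfolding cycle_edges_def by (rule imageE)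
  ultimately have "v \<in> set us" by (auto simp: doubleton_eq_iff)
  then obtain k where k: "k < length us" "us ! k = v" by (auto simp: in_set_conv_nth)
  moreover from k have "us \<noteq> []" by auto
  ultimately have "rotate k us ! 0 = v" using nth_rotate[of 0 us k] by auto
  then show ?thesis using that[of "rotate k us"] assms
    by (simp add: vcycle_rotate cycle_edges_rotate)
qed

text \<open>This is what makes counting through paths possible: a cycle that uses one edge at
  \<open>v\<close> leaves \<open>v\<close> by exactly one other edge.\<close>

lemma cycle_degree_two:
  assumes "C \<in> ucycles G" "{v, x} \<in> C"
  obtains y where "y \<noteq> x" "adj v x" "adj v y" "\<And>w. {v, w} \<in> C \<longleftrightarrow> w = x \<or> w = y"
proof -
  obtain us where "vcycle us" "C = cycle_edges us" using assms by (auto simp: ucycles_eq)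
  then obtain vs where vs: "vcycle vs" "C = cycle_edges vs" "vs ! 0 = v"
    using cycle_through_vertex assms(2) by metis
  let ?n = "length vs"
  have n: "?n \<ge> 3" and d: "distinct vs" using vs by (auto simp: vcycle_def)
  have *: "{v, w} \<in> C \<longleftrightarrow> w = vs ! 1 \<or> w = vs ! (?n - 1)" for w
    using cycle_edges_first[OF vs(1)] vs by simp
  have "adj v (vs ! 1)" using vs n by (force simp: vcycle_def dest: spec[of _ 0])
  moreover have "adj v (vs ! (?n - 1))"
  proof -
    have "Suc (?n - 1) = ?n" using n by simp
    then have "Suc (?n - 1) mod ?n = 0" by simp
    moreover have "adj (vs ! (?n - 1)) (vs ! (Suc (?n - 1) mod ?n))"
      using vs(1) n unfolding vcycle_def by auto
    ultimately show ?thesis using vs(3) adj_sym by metis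
  qed
  moreover have "vs ! 1 \<noteq> vs ! (?n - 1)" using d n by (simp add: nth_eq_iff_index_eq)
  moreover have "x = vs ! 1 \<or> x = vs ! (?n - 1)" using assms(2) * by simp
  ultimately show ?thesis using that * by metis
qed

end

section \<open>Cubic graphs\<close>

locale cubic_graph = pair_graph G for G :: "'a pair_pre_digraph" +
  assumes conn: "Digraph_Component.connected (with_proj G)"
    and cubic: "regular 3 (with_proj G)"
begin

text \<open>The neighbours are named in order instead of being collected in a set. Permuting the
  names by \<open>nb_swap\<close>, \<open>nb_swap'\<close> and \<open>nb_rot\<close> then replaces
  every "without loss of generality" by a rule application.\<close>

definition nb :: "'a \<Rightarrow> 'a \<Rightarrow> 'a \<Rightarrow> 'a \<Rightarrow> bool" where
  "nb v x y z \<longleftrightarrow> v \<in> pverts G \<and> (\<forall>w. adj v w \<longleftrightarrow> w = x \<or> w = y \<or> w = z) \<and>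
     x \<noteq> y \<and> x \<noteq> z \<and> y \<noteq> z"

lemma nb_ex:
  assumes "v \<in> pverts G"
  shows "\<exists>x y z. nb v x y z"
proof -
  have "out_arcs (with_proj G) v = (\<lambda>w. (v, w)) ` {w. adj v w}"
    by (auto simp: adj_def)
  then have "out_degree (with_proj G) v = card {w. adj v w}"
    by (simp add: out_degree_def card_image inj_on_def)
  then have "card {w. adj v w} = 3" using assms cubic by (simp add: regular_def)
  then obtain x y z where "{w. adj v w} = {x, y, z}" "x \<noteq> y" "x \<noteq> z" "y \<noteq> z"
    by (auto simp: card_3_iff)
  then have "nb v x y z" using assms unfolding nb_def by blast
  then show ?thesis by blast
qed

lemma nb_adj: "nb v x y z \<Longrightarrow> adj v w \<longleftrightarrow> w = x \<or> w = y \<or> w = z"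
  by (simp add: nb_def)

lemma nb_adj': "nb v x y z \<Longrightarrow> adj w v \<longleftrightarrow> w = x \<or> w = y \<or> w = z"
  using nb_adj adj_sym by blast

lemma nbD:
  assumes "nb v x y z"
  shows "v \<in> pverts G" "adj v x" "adj v y" "adj v z" "x \<noteq> y" "x \<noteq> z" "y \<noteq> z"
  using assms by (auto simp: nb_def)

lemma adj_neq: "adj u v \<Longrightarrow> u \<noteq> v"
  by auto

lemma nb_neq:
  assumes "nb v x y z"
  shows "v \<noteq> x" "v \<noteq> y" "v \<noteq> z" "x \<noteq> v" "y \<noteq> v" "z \<noteq> v"
  using nbD(2-4)[OF assms] by (auto dest: adj_neq)

lemma nb_set: "nb v x y z \<Longrightarrow> {w. adj v w} = {x, y, z}"
  by (auto simp: nb_def)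

lemma nb_swap: "nb v x y z \<Longrightarrow> nb v y x z" and nb_swap': "nb v x y z \<Longrightarrow> nb v x z y"
  and nb_rot: "nb v x y z \<Longrightarrow> nb v y z x"
  by (auto simp: nb_def)

lemma nb_1:
  assumes "adj v x"
  shows "\<exists>y z. nb v x y z"
proof -
  obtain a b c where n: "nb v a b c" using nb_ex assms adj_verts by blast
  then have "x = a \<or> x = b \<or> x = c" using assms nb_adj by blast
  then show ?thesis using n nb_rot[OF n] nb_rot[OF nb_rot[OF n]] by blast
qed

lemma nb_2:
  assumes "adj v x" "adj v y" "x \<noteq> y"
  shows "\<exists>z. nb v x y z"
proof -
  obtain a b where n: "nb v x a b" using nb_1 assms by blast
  then have "y = a \<or> y = b" using assms nb_adj[OF n, of y] by auto
  then show ?thesis using n nb_swap'[OF n] by blast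
qed

lemma nb_3: "adj v x \<Longrightarrow> adj v y \<Longrightarrow> adj v z \<Longrightarrow> x \<noteq> y \<Longrightarrow> x \<noteq> z \<Longrightarrow> y \<noteq> z \<Longrightarrow> nb v x y z"
  using nb_2[of v x y] nb_adj by metis

lemma verts_nonempty: "pverts G \<noteq> {}"
  using conn by (auto simp: connected_def strongly_connected_def mk_symmetric_def)

text \<open>Connectedness is defined through the symmetric closure, which here is the arc relation
  itself; a set closed under adjacency therefore contains whatever is reachable from one of its
  members.\<close>

lemma closed_eq_verts:
  assumes "S \<noteq> {}" "S \<subseteq> pverts G" "\<And>u w. u \<in> S \<Longrightarrow> adj u w \<Longrightarrow> w \<in> S"
  shows "S = pverts G"
proof -
  obtain u where u: "u \<in> S" using assms by blast
  have *: "arcs_ends (with_proj (mk_symmetric (with_proj G))) = parcs G"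
    using arcs_symmetric by (auto simp: mk_symmetric_def)
  have "w \<in> S" if "w \<in> pverts G" for w
  proof -
    have "u \<rightarrow>\<^sup>*\<^bsub>with_proj (mk_symmetric (with_proj G))\<^esub> w"
      using conn that u assms(2)
      by (auto simp: connected_def strongly_connected_def mk_symmetric_def)
    then have "(u, w) \<in> (parcs G)\<^sup>*" using reachable_rtranclI * by metis
    then show "w \<in> S"
      by (induction rule: rtrancl_induct) (use u assms(3) adj_def in auto)
  qed
  then show ?thesis using assms(2) by blast
qed

text \<open>
  A locally bijective embedding of a graph into a connected graph is onto, since its image is
  closed under adjacency.
\<close>

lemma iso_of_local_bijection:
  assumes W: "pverts H \<noteq> {}" and wf: "\<And>u w. (u, w) \<in> parcs H \<Longrightarrow> u \<in> pverts H \<and> w \<in> pverts H"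
    and inj: "inj_on h (pverts H)"
    and loc: "\<And>u. u \<in> pverts H \<Longrightarrow> h u \<in> pverts G \<and> h ` {w. (u, w) \<in> parcs H} = {z. adj (h u) z}"
  shows "digraph_iso (with_proj G) (with_proj H)"
proof -
  have surj: "h ` pverts H = pverts G"
  proof (rule closed_eq_verts)
    fix u w assume "u \<in> h ` pverts H" "adj u w"
    then obtain u' where u': "u' \<in> pverts H" "u = h u'" by blast
    then have "w \<in> h ` {w. (u', w) \<in> parcs H}" using loc[of u'] \<open>adj u w\<close> by auto
    then show "w \<in> h ` pverts H" using wf by auto
  qed (use W loc in auto)
  \<comment> \<open>The isomorphism has to lead from \<open>G\<close> to \<open>H\<close>, against
    the direction of the embedding, so it is the inverse of \<open>h\<close>.\<close>
  define k where "k = the_inv_into (pverts H) h"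
  have kh: "k (h u) = u" if "u \<in> pverts H" for u
    unfolding k_def using that inj by (simp add: the_inv_into_f_f)
  have arcs: "parcs G = (\<lambda>(u, w). (h u, h w)) ` parcs H"
  proof (intro subset_antisym subsetI)
    fix a assume "a \<in> parcs G"
    then obtain u w where a: "a = (u, w)" "adj u w" by (cases a) (auto simp: adj_def)
    then obtain u' where u': "u' \<in> pverts H" "u = h u'" using surj adj_verts by blast
    then have "w \<in> h ` {w. (u', w) \<in> parcs H}" using loc[of u'] a by auto
    then show "a \<in> (\<lambda>(u, w). (h u, h w)) ` parcs H" using a u' by auto
  next
    fix a assume "a \<in> (\<lambda>(u, w). (h u, h w)) ` parcs H"
    then obtain u w where "(u, w) \<in> parcs H" "a = (h u, h w)" by auto
    then show "a \<in> parcs G" using loc[of u] wf[of u w] by (auto simp: adj_def)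
  qed
  let ?f = "\<lparr>iso_verts = k, iso_arcs = (\<lambda>(u, w). (k u, k w)), iso_head = snd, iso_tail = fst\<rparr>"
  have "inj_on k (pverts G)"
    unfolding k_def surj[symmetric] using inj by (rule inj_on_the_inv_into)
  moreover have "inj_on (\<lambda>(u, w). (k u, k w)) (parcs G)"
    using calculation in_arcsD1 in_arcsD2 by (auto simp: inj_on_def)
  ultimately have "pre_digraph.digraph_isomorphism (with_proj G) ?f"
    unfolding pre_digraph.digraph_isomorphism_def using wf_digraph by auto
  moreover have "with_proj H = app_iso ?f (with_proj G)"
  proof -
    have "pverts H = k ` pverts G" using surj kh by (force simp: image_iff)
    moreover have "parcs H = (\<lambda>(u, w). (k u, k w)) ` parcs G"
      unfolding arcs image_image using wf kh by (force simp: image_iff split: prod.splits)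
    ultimately show ?thesis unfolding app_iso_def with_proj_def by simp
  qed
  ultimately show ?thesis unfolding digraph_iso_def by blast
qed

end

text \<open>Serves the negative direction, where an isomorphism with the cube is assumed and pulled
  back to \<open>G\<close>. An arc is determined by its ends, so the vertex map alone carries the
  isomorphism.\<close>

lemma digraph_iso_pairD:
  assumes "digraph_iso (with_proj G) (with_proj H)"
  obtains f where "bij_betw f (pverts G) (pverts H)"
    "\<And>u w. u \<in> pverts G \<Longrightarrow> w \<in> pverts G \<Longrightarrow> (u, w) \<in> parcs G \<longleftrightarrow> (f u, f w) \<in> parcs H"
proof -
  obtain f where f: "pre_digraph.digraph_isomorphism (with_proj G) f"
    "with_proj H = app_iso f (with_proj G)" using assms by (auto simp: digraph_iso_def)
  have v: "pverts H = iso_verts f ` pverts G" and a: "parcs H = iso_arcs f ` parcs G"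
    and th: "iso_tail f = fst" "iso_head f = snd"
    using f(2) by (auto simp: with_proj_def app_iso_def)
  have inj: "inj_on (iso_verts f) (pverts G)"
    and wf: "wf_digraph (with_proj G)"
    and ends: "\<And>a. a \<in> parcs G \<Longrightarrow> iso_arcs f a = (iso_verts f (fst a), iso_verts f (snd a))"
    using f(1) th by (auto simp: pre_digraph.digraph_isomorphism_def prod_eq_iff)
  have "(u, w) \<in> parcs G \<longleftrightarrow> (iso_verts f u, iso_verts f w) \<in> parcs H"
    if uw: "u \<in> pverts G" "w \<in> pverts G" for u w
  proof
    show "(u, w) \<in> parcs G \<Longrightarrow> (iso_verts f u, iso_verts f w) \<in> parcs H"
      using ends[of "(u, w)"] a by force
    assume "(iso_verts f u, iso_verts f w) \<in> parcs H"
    then obtain b where b: "b \<in> parcs G" "iso_arcs f b = (iso_verts f u, iso_verts f w)"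
      using a by force
    have "fst b \<in> pverts G" "snd b \<in> pverts G"
      using wf b(1) wf_digraph.tail_in_verts[OF wf, of b] wf_digraph.head_in_verts[OF wf, of b]
      by simp_all
    then have "b = (u, w)" using ends[OF b(1)] b(2) inj uw by (auto simp: inj_on_def prod_eq_iff)
    then show "(u, w) \<in> parcs G" using b by simp
  qed
  then show ?thesis using that[of "iso_verts f"] inj v by (simp add: bij_betw_def)
qed

section \<open>Girth cycles through a path of length two\<close>

locale cubic_girth_graph = cubic_graph +
  fixes g :: nat
  assumes girth_eq: "girth G = enat g"
begin

lemma girth_le:
  assumes "vcycle vs"
  shows "g \<le> length vs"
proof -
  have "girth G \<le> enat (card (cycle_edges vs))"
    unfolding girth_def ucycles_eq using assms by (intro INF_lower) simp
  then show ?thesis using girth_eq card_cycle_edges[OF assms] by simp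
qed

lemma girth_cycles_eq: "girth_cycles G = cycle_edges ` {vs. vcycle vs \<and> length vs = g}"
  unfolding girth_cycles_def ucycles_eq girth_eq using card_cycle_edges by auto

lemma girth_cycles_ucycles: "C \<in> girth_cycles G \<Longrightarrow> C \<in> ucycles G"
  by (simp add: girth_cycles_def)

text \<open>An empty set of cycles would make the girth infinite, and a nonempty set of extended
  naturals attains its infimum.\<close>

lemma girth_cycle_exists: "\<exists>C. C \<in> girth_cycles G"
proof -
  let ?A = "(\<lambda>C. enat (card C)) ` ucycles G"
  have "?A \<noteq> {}"
  proof
    assume "?A = {}"
    then have "girth G = \<infinity>" unfolding girth_def by (simp add: top_enat_def)
    then show False using girth_eq by simp
  qed
  then have "Inf ?A \<in> ?A" unfolding Inf_enat_def by (auto intro: LeastI)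
  then show ?thesis unfolding girth_cycles_def girth_def by auto
qed

lemma girth_ge_3: "3 \<le> g"
  using girth_cycle_exists girth_cycles_eq by (auto simp: vcycle_def)

lemma finite_girth_cycles: "finite (girth_cycles G)"
proof -
  have "set vs \<subseteq> pverts G" if "vcycle vs" for vs
    using that adj_verts(1) unfolding vcycle_def by (metis in_set_conv_nth subsetI)
  then have "girth_cycles G \<subseteq> cycle_edges ` {vs. set vs \<subseteq> pverts G \<and> length vs = g}"
    unfolding girth_cycles_eq by auto
  moreover have "finite {vs. set vs \<subseteq> pverts G \<and> length vs = g}"
    by (rule finite_lists_length_eq) (rule pair_finite_verts)
  ultimately show ?thesis by (meson finite_imageI finite_subset)
qed

definition npath :: "'a \<Rightarrow> 'a \<Rightarrow> 'a \<Rightarrow> nat" where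
  "npath v x y = card {C \<in> girth_cycles G. {v, x} \<in> C \<and> {v, y} \<in> C}"

lemma npath_commute: "npath v x y = npath v y x"
  unfolding npath_def by (rule arg_cong[where f = card]) auto

lemma npath_pos_iff: "npath v x y > 0 \<longleftrightarrow> (\<exists>C \<in> girth_cycles G. {v, x} \<in> C \<and> {v, y} \<in> C)"
  unfolding npath_def using finite_girth_cycles by (auto simp: card_gt_0_iff)

lemma eps_pos_iff: "eps G e > 0 \<longleftrightarrow> (\<exists>C \<in> girth_cycles G. e \<in> C)"
  unfolding eps_def using finite_girth_cycles by (auto simp: card_gt_0_iff)

text \<open>By \<open>cycle_degree_two\<close> every girth cycle through \<open>vx\<close> continues
  along exactly one of \<open>vy\<close> and \<open>vz\<close>, so the two counted families are
  disjoint and exhaustive.\<close>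

lemma eps_eq_npath:
  assumes "nb v x y z"
  shows "eps G {v, x} = npath v x y + npath v x z"
proof -
  let ?A = "\<lambda>y. {C \<in> girth_cycles G. {v, x} \<in> C \<and> {v, y} \<in> C}"
  have *: "({v, y} \<in> C) \<noteq> ({v, z} \<in> C)" if C: "C \<in> girth_cycles G" "{v, x} \<in> C" for C
  proof -
    obtain y' where "y' \<noteq> x" "adj v x" "adj v y'" "\<And>w. {v, w} \<in> C \<longleftrightarrow> w = x \<or> w = y'"
      by (rule cycle_degree_two[OF girth_cycles_ucycles[OF C(1)] C(2)]) blast
    then show ?thesis using assms by (auto simp: nb_def)
  qed
  then have "{C \<in> girth_cycles G. {v, x} \<in> C} = ?A y \<union> ?A z" "?A y \<inter> ?A z = {}" by blast+
  then show ?thesis unfolding eps_def npath_def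
    using finite_girth_cycles by (simp add: card_Un_disjoint)
qed

lemma vertex_signature_eq:
  assumes "nb v x y z"
  shows "vertex_signature G v = sorted_list_of_multiset {#eps G {v, x}, eps G {v, y}, eps G {v, z}#}"
proof -
  have "{e \<in> uedges G. v \<in> e} = {{v, x}, {v, y}, {v, z}}"
  proof -
    have "{v, w} \<in> uedges G" if "adj v w" for w
      using that unfolding uedges_def uedge_def adj_def by force
    moreover have "\<exists>w. e = {v, w} \<and> adj v w" if e: "e \<in> uedges G" "v \<in> e" for e
    proof -
      obtain a b where "e = {a, b}" "adj a b"
        using e(1) unfolding uedges_def uedge_def adj_def by auto
      then show ?thesis using e(2) adj_sym by auto
    qed
    ultimately show ?thesis using assms by (auto simp: nb_def)
  qed
  moreover have "{v, x} \<noteq> {v, y}" "{v, x} \<noteq> {v, z}" "{v, y} \<noteq> {v, z}"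
    using assms by (auto simp: nb_def doubleton_eq_iff)
  ultimately show ?thesis unfolding vertex_signature_def by simp
qed

text \<open>Rotation moves the edge to the front of the list but cannot fix the direction of
  traversal, hence the disjunction.\<close>

lemma cycle_through_edge:
  assumes "C \<in> girth_cycles G" "{v, x} \<in> C"
  obtains vs where "vcycle vs" "length vs = g" "C = cycle_edges vs"
    "vs ! 0 = v \<and> vs ! 1 = x \<or> vs ! 0 = x \<and> vs ! 1 = v"
proof -
  obtain us where us: "vcycle us" "C = cycle_edges us" "length us = g"
    using assms by (auto simp: girth_cycles_eq)
  then obtain i where i: "i < g" "{v, x} = {us ! i, us ! (Suc i mod g)}"
    using assms(2) by (auto simp: cycle_edges_def)
  let ?vs = "rotate i us"
  have "us \<noteq> []" using us by (auto simp: vcycle_def)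
  then have "?vs ! 0 = us ! i" "?vs ! 1 = us ! (Suc i mod g)"
    using nth_rotate[of 0 us i] nth_rotate[of 1 us i] i us girth_ge_3 by auto
  then have "?vs ! 0 = v \<and> ?vs ! 1 = x \<or> ?vs ! 0 = x \<and> ?vs ! 1 = v"
    using i(2) by (auto simp: doubleton_eq_iff)
  then show ?thesis using that[of ?vs] us by (simp add: vcycle_rotate cycle_edges_rotate)
qed

end

section \<open>Girth-regularity\<close>

locale cubic_girth_regular = cubic_girth_graph +
  fixes \<sigma> :: "nat list"
  assumes sig: "has_signature G \<sigma>"
begin

lemma sig_eps: "nb v x y z \<Longrightarrow> \<sigma> = sorted_list_of_multiset {#eps G {v, x}, eps G {v, y}, eps G {v, z}#}"
  using sig vertex_signature_eq by (auto simp: has_signature_def nb_def)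

lemma sig_npath:
  assumes "nb v x y z"
  shows "\<sigma> = sorted_list_of_multiset
    {#npath v x y + npath v x z, npath v x y + npath v y z, npath v x z + npath v y z#}"
  using sig_eps[OF assms] eps_eq_npath[OF assms] eps_eq_npath[OF nb_swap[OF assms]]
    eps_eq_npath[OF nb_swap[OF nb_swap'[OF assms]]] npath_commute by (simp add: ac_simps)

text \<open>The signature sums to \<open>2 * s\<close>, where \<open>s\<close> is the sum of the
  three counts, so \<open>s\<close> is the same at both vertices. Every entry of the signature is
  \<open>s\<close> minus one count, and mapping \<open>e\<close> to \<open>s - e\<close> turns
  signatures into multisets of counts.\<close>

lemma npath_mset_eq:
  assumes "nb v x y z" "nb v' x' y' z'"
  shows "{#npath v x y, npath v x z, npath v y z#} = {#npath v' x' y', npath v' x' z', npath v' y' z'#}"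
proof -
  have *: "{#npath v x y + npath v x z, npath v x y + npath v y z, npath v x z + npath v y z#} =
    {#npath v' x' y' + npath v' x' z', npath v' x' y' + npath v' y' z', npath v' x' z' + npath v' y' z'#}"
    (is "?A = ?B")
    using sig_npath[OF assms(1)] sig_npath[OF assms(2)]
    by (metis mset_sorted_list_of_multiset)
  let ?s = "npath v x y + npath v x z + npath v y z"
  let ?s' = "npath v' x' y' + npath v' x' z' + npath v' y' z'"
  have "sum_mset ?A = sum_mset ?B" using * by simp
  then have s: "?s = ?s'" by simp
  have "image_mset (\<lambda>e. ?s - e) ?A = image_mset (\<lambda>e. ?s - e) ?B" using * by simp
  then have "image_mset (\<lambda>e. ?s - e) ?A = image_mset (\<lambda>e. ?s' - e) ?B" using s by simp
  then show ?thesis by (simp add: ac_simps add_mset_commute)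
qed

end

section \<open>Girth cycles of length 3, 4 and 5\<close>

lemma card_filter_2: "a \<noteq> b \<Longrightarrow> card {x \<in> {a, b}. P x} = of_bool (P a) + of_bool (P b)"
proof -
  assume "a \<noteq> b"
  moreover have "{x \<in> {a, b}. P x} = (if P a then {a} else {}) \<union> (if P b then {b} else {})" by auto
  ultimately show ?thesis by auto
qed

context cubic_girth_graph
begin

lemma vcycle_3: "vcycle [a, b, c] \<longleftrightarrow> adj a b \<and> adj b c \<and> adj c a"
  by (auto simp: vcycle_def All_less_Suc)

lemma vcycle_4: "vcycle [a, b, c, d] \<longleftrightarrow> adj a b \<and> adj b c \<and> adj c d \<and> adj d a \<and> a \<noteq> c \<and> b \<noteq> d"
  by (auto simp: vcycle_def All_less_Suc)

lemma vcycle_5: "vcycle [a, b, c, d, e] \<longleftrightarrow>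
    adj a b \<and> adj b c \<and> adj c d \<and> adj d e \<and> adj e a \<and> distinct [a, b, c, d, e]"
  by (auto simp: vcycle_def All_less_Suc)

lemma cycle_edges_3: "cycle_edges [a, b, c] = {{a, b}, {b, c}, {c, a}}"
  by (simp add: cycle_edges_def lessThan_Suc insert_commute)

lemma cycle_edges_4: "cycle_edges [a, b, c, d] = {{a, b}, {b, c}, {c, d}, {d, a}}"
  by (simp add: cycle_edges_def lessThan_Suc insert_commute)

lemma cycle_edges_5: "cycle_edges [a, b, c, d, e] = {{a, b}, {b, c}, {c, d}, {d, e}, {e, a}}"
  by (simp add: cycle_edges_def lessThan_Suc insert_commute)

lemma no_triangle: "g > 3 \<Longrightarrow> adj a b \<Longrightarrow> adj b c \<Longrightarrow> adj c a \<Longrightarrow> False"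
  using girth_le[of "[a, b, c]"] by (auto simp: vcycle_3)

lemma no_quad: "g > 4 \<Longrightarrow> adj a b \<Longrightarrow> adj b c \<Longrightarrow> adj c d \<Longrightarrow> adj d a \<Longrightarrow> a = c \<or> b = d"
  using girth_le[of "[a, b, c, d]"] by (auto simp: vcycle_4)

lemma girth_cycleI: "vcycle vs \<Longrightarrow> length vs = g \<Longrightarrow> cycle_edges vs \<in> girth_cycles G"
  by (simp add: girth_cycles_eq)

text \<open>Both directions of traversal have the same edge set; a list that starts with
  \<open>x\<close>, \<open>v\<close> is read backwards from \<open>v\<close>. The same applies to
  lengths 4 and 5.\<close>

lemma girth_cycle_3:
  assumes "g = 3"
  shows "C \<in> girth_cycles G \<and> {v, x} \<in> C \<longleftrightarrow>
    (\<exists>a. adj v x \<and> adj x a \<and> adj a v \<and> C = {{v, x}, {x, a}, {a, v}})" (is "?L \<longleftrightarrow> ?R")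
proof
  assume ?L
  then obtain vs where vs: "vcycle vs" "length vs = g" "C = cycle_edges vs"
    "vs ! 0 = v \<and> vs ! 1 = x \<or> vs ! 0 = x \<and> vs ! 1 = v"
    using cycle_through_edge by blast
  then obtain p q r where pqr: "vs = [p, q, r]"
    using assms by (auto simp: length_Suc_conv eval_nat_numeral)
  from vs(4) consider "p = v" "q = x" | "p = x" "q = v" using pqr by auto
  then show ?R
  proof cases
    case 1
    then show ?thesis using vs(1,3) pqr by (auto simp: vcycle_3 cycle_edges_3)
  next
    case 2
    then show ?thesis using vs(1,3) pqr adj_sym
      by (intro exI[of _ r]) (auto simp: vcycle_3 cycle_edges_3 insert_commute)
  qed
next
  assume ?R
  then obtain a where "adj v x" "adj x a" "adj a v" "C = {{v, x}, {x, a}, {a, v}}" by blast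
  then show ?L using girth_cycleI[of "[v, x, a]"] assms by (simp add: vcycle_3 cycle_edges_3)
qed

lemma girth_cycle_4:
  assumes "g = 4"
  shows "C \<in> girth_cycles G \<and> {v, x} \<in> C \<longleftrightarrow>
    (\<exists>a b. adj v x \<and> adj x a \<and> adj a b \<and> adj b v \<and> v \<noteq> a \<and> x \<noteq> b \<and>
       C = {{v, x}, {x, a}, {a, b}, {b, v}})" (is "?L \<longleftrightarrow> ?R")
proof
  assume ?L
  then obtain vs where vs: "vcycle vs" "length vs = g" "C = cycle_edges vs"
    "vs ! 0 = v \<and> vs ! 1 = x \<or> vs ! 0 = x \<and> vs ! 1 = v"
    using cycle_through_edge by blast
  then obtain p q r s where pqr: "vs = [p, q, r, s]"
    using assms by (auto simp: length_Suc_conv eval_nat_numeral)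
  from vs(4) consider "p = v" "q = x" | "p = x" "q = v" using pqr by auto
  then show ?R
  proof cases
    case 1
    then show ?thesis using vs(1,3) pqr by (auto simp: vcycle_4 cycle_edges_4)
  next
    case 2
    then show ?thesis using vs(1,3) pqr adj_sym
      by (intro exI[of _ s] exI[of _ r]) (auto simp: vcycle_4 cycle_edges_4 insert_commute)
  qed
next
  assume ?R
  then obtain a b where "adj v x" "adj x a" "adj a b" "adj b v" "v \<noteq> a" "x \<noteq> b"
    "C = {{v, x}, {x, a}, {a, b}, {b, v}}" by blast
  then show ?L using girth_cycleI[of "[v, x, a, b]"] assms by (simp add: vcycle_4 cycle_edges_4)
qed

lemma girth_cycle_5:
  assumes "g = 5"
  shows "C \<in> girth_cycles G \<and> {v, x} \<in> C \<longleftrightarrow>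
    (\<exists>a b y. adj v x \<and> adj x a \<and> adj a b \<and> adj b y \<and> adj y v \<and> distinct [v, x, a, b, y] \<and>
       C = {{v, x}, {x, a}, {a, b}, {b, y}, {y, v}})" (is "?L \<longleftrightarrow> ?R")
proof
  assume ?L
  then obtain vs where vs: "vcycle vs" "length vs = g" "C = cycle_edges vs"
    "vs ! 0 = v \<and> vs ! 1 = x \<or> vs ! 0 = x \<and> vs ! 1 = v"
    using cycle_through_edge by blast
  then obtain p q r s t where pqr: "vs = [p, q, r, s, t]"
    using assms by (auto simp: length_Suc_conv eval_nat_numeral)
  from vs(4) consider "p = v" "q = x" | "p = x" "q = v" using pqr by auto
  then show ?R
  proof cases
    case 1
    then show ?thesis using vs(1,3) pqr
      by (intro exI[of _ r] exI[of _ s] exI[of _ t]) (simp add: vcycle_5 cycle_edges_5)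
  next
    case 2
    then show ?thesis using vs(1,3) pqr adj_sym
      by (intro exI[of _ t] exI[of _ s] exI[of _ r]) (auto simp: vcycle_5 cycle_edges_5 insert_commute)
  qed
next
  assume ?R
  then obtain a b y where "adj v x" "adj x a" "adj a b" "adj b y" "adj y v" "distinct [v, x, a, b, y]"
    "C = {{v, x}, {x, a}, {a, b}, {b, y}, {y, v}}" by blast
  then show ?L using girth_cycleI[of "[v, x, a, b, y]"] assms by (simp add: vcycle_5 cycle_edges_5)
qed

lemma npath_3:
  assumes "g = 3" "adj v x" "adj v y" "x \<noteq> y"
  shows "npath v x y = of_bool (adj x y)"
proof -
  have *: "C \<in> girth_cycles G \<and> {v, x} \<in> C \<and> {v, y} \<in> C \<longleftrightarrow>
    adj x y \<and> C = {{v, x}, {x, y}, {y, v}}" for C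
  proof -
    have "C \<in> girth_cycles G \<and> {v, x} \<in> C \<and> {v, y} \<in> C \<longleftrightarrow>
        (\<exists>a. adj v x \<and> adj x a \<and> adj a v \<and> C = {{v, x}, {x, a}, {a, v}}) \<and> {v, y} \<in> C"
      unfolding girth_cycle_3[OF assms(1), symmetric] by (simp only: conj_assoc)
    also have "\<dots> \<longleftrightarrow> adj x y \<and> C = {{v, x}, {x, y}, {y, v}}"
    proof
      assume "(\<exists>a. adj v x \<and> adj x a \<and> adj a v \<and> C = {{v, x}, {x, a}, {a, v}}) \<and> {v, y} \<in> C"
      then obtain a where a: "adj x a" "adj a v" "C = {{v, x}, {x, a}, {a, v}}" "{v, y} \<in> C" by blast
      then have "v \<noteq> a" "v \<noteq> x" using assms(2) adj_neq by blast+
      then have "y = a" using a(3,4) assms(4) by (auto simp: doubleton_eq_iff)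
      then show "adj x y \<and> C = {{v, x}, {x, y}, {y, v}}" using a by simp
    next
      assume *: "adj x y \<and> C = {{v, x}, {x, y}, {y, v}}"
      then have "{v, y} \<in> C" by (simp add: insert_commute)
      then show "(\<exists>a. adj v x \<and> adj x a \<and> adj a v \<and> C = {{v, x}, {x, a}, {a, v}}) \<and> {v, y} \<in> C"
        using * assms(2,3) adj_sym by blast
    qed
    finally show ?thesis .
  qed
  show ?thesis
  proof (cases "adj x y")
    case True
    then have "{C \<in> girth_cycles G. {v, x} \<in> C \<and> {v, y} \<in> C} = {{{v, x}, {x, y}, {y, v}}}"
      by (intro Set.set_eqI) (simp only: mem_Collect_eq * singleton_iff simp_thms)
    then show ?thesis using True by (simp add: npath_def)
  next
    case False
    then have "{C \<in> girth_cycles G. {v, x} \<in> C \<and> {v, y} \<in> C} = {}"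
      by (intro Set.set_eqI) (simp only: mem_Collect_eq * simp_thms empty_iff)
    then show ?thesis using False by (simp only: npath_def card.empty of_bool_eq)
  qed
qed

text \<open>The 4-cycle is fixed by its vertex opposite to \<open>v\<close>, a common neighbour of
  \<open>x\<close> and \<open>y\<close> other than \<open>v\<close>; the only candidates are the two
  further neighbours of \<open>x\<close>.\<close>

lemma npath_4:
  assumes "g = 4" "x \<noteq> y" "adj v y" "nb x v x1 x2"
  shows "npath v x y = of_bool (adj x1 y) + of_bool (adj x2 y)"
proof -
  let ?f = "\<lambda>a. {{v, x}, {x, a}, {a, y}, {y, v}}"
  let ?S = "{a \<in> {x1, x2}. adj a y}"
  have S: "a \<in> ?S \<longleftrightarrow> adj x a \<and> adj a y \<and> a \<noteq> v" for a
    using assms(4) by (auto simp: nb_def)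
  have vx: "adj v x" "v \<noteq> x" "v \<noteq> y"
    using nbD(2)[OF assms(4)] assms(3) adj_sym adj_neq by blast+
  have "{C \<in> girth_cycles G. {v, x} \<in> C \<and> {v, y} \<in> C} = ?f ` ?S" (is "?A = ?B")
  proof (intro Set.set_eqI)
    fix C
    have "C \<in> ?A \<longleftrightarrow> (\<exists>a b. adj v x \<and> adj x a \<and> adj a b \<and> adj b v \<and> v \<noteq> a \<and> x \<noteq> b \<and>
       C = {{v, x}, {x, a}, {a, b}, {b, v}}) \<and> {v, y} \<in> C"
      using girth_cycle_4[OF assms(1), of C v x] by blast
    also have "\<dots> \<longleftrightarrow> (\<exists>a. a \<in> ?S \<and> C = ?f a)"
    proof
      assume "\<exists>a. a \<in> ?S \<and> C = ?f a"
      then show "(\<exists>a b. adj v x \<and> adj x a \<and> adj a b \<and> adj b v \<and> v \<noteq> a \<and> x \<noteq> b \<and>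
       C = {{v, x}, {x, a}, {a, b}, {b, v}}) \<and> {v, y} \<in> C"
        unfolding S using assms(2,3) adj_sym[of v] vx by (auto simp: insert_commute)
    next
      assume "(\<exists>a b. adj v x \<and> adj x a \<and> adj a b \<and> adj b v \<and> v \<noteq> a \<and> x \<noteq> b \<and>
       C = {{v, x}, {x, a}, {a, b}, {b, v}}) \<and> {v, y} \<in> C"
      then obtain a b where ab: "adj x a" "adj a b" "adj b v" "v \<noteq> a" "x \<noteq> b"
        "C = {{v, x}, {x, a}, {a, b}, {b, v}}" "{v, y} \<in> C" by blast
      then have "y = b" using assms(2) vx by (auto simp: doubleton_eq_iff)
      then show "\<exists>a. a \<in> ?S \<and> C = ?f a" unfolding S using ab by blast
    qed
    also have "\<dots> \<longleftrightarrow> C \<in> ?B" by blast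
    finally show "C \<in> ?A \<longleftrightarrow> C \<in> ?B" .
  qed
  moreover have "inj_on ?f ?S"
  proof (rule inj_onI)
    fix a b assume ab: "a \<in> ?S" "b \<in> ?S" "?f a = ?f b"
    have "{x, a} \<in> ?f a" by simp
    then have "{x, a} \<in> ?f b" unfolding ab(3) .
    moreover have "a \<noteq> v" "b \<noteq> x" using S[of a] S[of b] ab(1,2) adj_neq by blast+
    ultimately show "a = b" using vx assms(2) by (auto simp: doubleton_eq_iff)
  qed
  ultimately show ?thesis using card_filter_2[OF nbD(7)[OF assms(4)]]
    unfolding npath_def by (simp only: card_image)
qed

text \<open>The 5-cycle is fixed by its edge opposite to \<open>v\<close>, which joins a further
  neighbour of \<open>x\<close> to one of \<open>y\<close>. The absence of triangles guarantees that
  every such edge yields five distinct vertices.\<close>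

lemma npath_5:
  assumes "g = 5" "x \<noteq> y" "nb x v x1 x2" "nb y v y1 y2"
  shows "npath v x y = of_bool (adj x1 y1) + of_bool (adj x1 y2) + of_bool (adj x2 y1) + of_bool (adj x2 y2)"
proof -
  let ?f = "\<lambda>(a, b). {{v, x}, {x, a}, {a, b}, {b, y}, {y, v}}"
  let ?S = "{(a, b). (a = x1 \<or> a = x2) \<and> (b = y1 \<or> b = y2) \<and> adj a b}"
  have S: "(a, b) \<in> ?S \<longleftrightarrow> adj x a \<and> adj y b \<and> adj a b \<and> a \<noteq> v \<and> b \<noteq> v" for a b
    using assms(3,4) by (auto simp: nb_def)
  have vx: "adj v x" "adj v y" "adj y v" "v \<noteq> x" "v \<noteq> y"
    using nbD(2)[OF assms(3)] nbD(2)[OF assms(4)] adj_sym adj_neq by blast+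
  have dist: "distinct [v, x, a, b, y]" if "(a, b) \<in> ?S" for a b
  proof -
    have *: "adj x a" "adj y b" "adj a b" "a \<noteq> v" "b \<noteq> v" using that S by blast+
    have "a \<noteq> y" using no_triangle[of v x y] vx * assms(1) by auto
    moreover have "b \<noteq> x" using no_triangle[of v y x] vx * adj_sym assms(1) by auto
    ultimately show ?thesis using * vx assms(2) by auto
  qed
  have "{C \<in> girth_cycles G. {v, x} \<in> C \<and> {v, y} \<in> C} = ?f ` ?S" (is "?A = ?B")
  proof (intro Set.set_eqI iffI)
    fix C assume "C \<in> ?B"
    then obtain a b where ab: "(a, b) \<in> ?S" "C = ?f (a, b)" by blast
    then have "adj v x \<and> adj x a \<and> adj a b \<and> adj b y \<and> adj y v \<and> distinct [v, x, a, b, y] \<and>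
       C = {{v, x}, {x, a}, {a, b}, {b, y}, {y, v}}" using S[of a b] dist[OF ab(1)] vx adj_sym by auto
    then have "C \<in> girth_cycles G \<and> {v, x} \<in> C" using girth_cycle_5[OF assms(1), of C v x] by blast
    then show "C \<in> ?A" using ab(2) by (simp add: insert_commute)
  next
    fix C assume C: "C \<in> ?A"
    then obtain a b y' where ab: "adj x a" "adj a b" "adj b y'" "adj y' v" "distinct [v, x, a, b, y']"
       "C = {{v, x}, {x, a}, {a, b}, {b, y'}, {y', v}}"
      using girth_cycle_5[OF assms(1), of C v x] by blast
    have "{v, y} \<in> C" using C by blast
    then have "y' = y" using assms(2) ab(5) vx(4,5) unfolding ab(6) insert_iff doubleton_eq_iff
      by auto
    then have "adj y b" "a \<noteq> v" "b \<noteq> v" using ab(3,5) adj_sym by auto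
    then have "(a, b) \<in> ?S" unfolding S using ab(1,2) by blast
    then have "?f (a, b) \<in> ?B" by (rule imageI)
    then show "C \<in> ?B" using ab(6) \<open>y' = y\<close> by simp
  qed
  moreover have "inj_on ?f ?S"
  proof (rule inj_onI)
    fix p q assume pq: "p \<in> ?S" "q \<in> ?S" "?f p = ?f q"
    obtain a b a' b' where e: "p = (a, b)" "q = (a', b')" by (cases p, cases q)
    note ab = pq[unfolded e]
    have d: "distinct [v, x, a, b, y]" "distinct [v, x, a', b', y]" using dist[OF ab(1)] dist[OF ab(2)] .
    have "{x, a} \<in> ?f (a, b)" "{b, y} \<in> ?f (a, b)" by simp_all
    then have "{x, a} \<in> ?f (a', b')" "{b, y} \<in> ?f (a', b')" unfolding ab(3) .
    then show "p = q" using d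
      unfolding e prod.case insert_iff doubleton_eq_iff empty_iff by auto
  qed
  moreover have "card ?S = of_bool (adj x1 y1) + of_bool (adj x1 y2) + of_bool (adj x2 y1) + of_bool (adj x2 y2)"
  proof -
    have "?S = Pair x1 ` {b \<in> {y1, y2}. adj x1 b} \<union> Pair x2 ` {b \<in> {y1, y2}. adj x2 b}" by auto
    then have "card ?S = card {b \<in> {y1, y2}. adj x1 b} + card {b \<in> {y1, y2}. adj x2 b}"
      using nbD(7)[OF assms(3)] by (simp only:, subst card_Un_disjoint) (auto simp: card_image inj_on_def)
    then show ?thesis using card_filter_2[of y1 y2] nbD(7)[OF assms(4)] by simp
  qed
  ultimately show ?thesis unfolding npath_def by (simp only: card_image)
qed

text \<open>Rules out that all counts vanish, which the multiset argument alone could not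
  see.\<close>

lemma npath_pos_exists: "\<exists>v x y z. nb v x y z \<and> npath v x y > 0"
proof -
  obtain C where C: "C \<in> girth_cycles G" using girth_cycle_exists by blast
  then obtain us where us: "vcycle us" "C = cycle_edges us" "length us = g" using girth_cycles_eq by auto
  then have "{us ! 0, us ! 1} \<in> C" using cycle_edges_first[of us] by simp
  then obtain y where y: "y \<noteq> us ! 1" "adj (us ! 0) (us ! 1)" "adj (us ! 0) y"
      "\<And>w. {us ! 0, w} \<in> C \<longleftrightarrow> w = us ! 1 \<or> w = y"
    using cycle_degree_two[OF girth_cycles_ucycles[OF C]] by blast
  obtain z where "nb (us ! 0) (us ! 1) y z" using nb_2[OF y(2,3)] y(1) by blast
  moreover have "npath (us ! 0) (us ! 1) y > 0" using npath_pos_iff y(4) C by blast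
  ultimately show ?thesis by blast
qed

end

context cubic_girth_regular
begin

text \<open>Together with \<open>npath_some\<close> and \<open>npath_sum\<close> this is the form in
  which girth-regularity is used: what holds for all counts at one vertex, for some count, or for
  their total, holds at every vertex.\<close>

lemma npath_all:
  assumes "nb v x y z" "P (npath v x y)" "P (npath v x z)" "P (npath v y z)" "nb v' x' y' z'"
  shows "P (npath v' x' y')"
proof -
  have "npath v' x' y' \<in># {#npath v x y, npath v x z, npath v y z#}"
    unfolding npath_mset_eq[OF assms(1,5)] by simp
  then show ?thesis using assms(2-4) by auto
qed

lemma npath_some:
  assumes "nb v x y z" "P (npath v x y)" "nb v' x' y' z'"
  shows "P (npath v' x' y') \<or> P (npath v' x' z') \<or> P (npath v' y' z')"
proof -
  have "npath v x y \<in># {#npath v' x' y', npath v' x' z', npath v' y' z'#}"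
    unfolding npath_mset_eq[OF assms(1,3), symmetric] by simp
  then show ?thesis using assms(2) by auto
qed

lemma npath_sum:
  assumes "nb v x y z" "nb v' x' y' z'"
  shows "npath v x y + npath v x z + npath v y z = npath v' x' y' + npath v' x' z' + npath v' y' z'"
  using arg_cong[OF npath_mset_eq[OF assms], of sum_mset] by simp

section \<open>Girth 3\<close>

lemma girth_3_cases:
  assumes g: "g = 3"
  shows "\<sigma> = [0, 1, 1] \<or> complete_digraph 4 (with_proj G) \<and> \<sigma> = [2, 2, 2]"
proof -
  obtain v x y z where n: "nb v x y z" "npath v x y > 0" using npath_pos_exists by blast
  note a = nbD[OF n(1)]
  have np: "npath v x y = of_bool (adj x y)" "npath v x z = of_bool (adj x z)"
      "npath v y z = of_bool (adj y z)"
    using npath_3[OF g] a by blast+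
  have xy: "adj x y" using n(2) np by (auto split: if_splits)
  \<comment> \<open>Excludes {0, 1, 1}. The neighbourhoods of \<open>v\<close> and \<open>x\<close>
    are already full, so the third neighbour \<open>w\<close> of \<open>y\<close> is adjacent to
    neither; \<open>y\<close> then sees at most one triangle while \<open>v\<close> sees
    two.\<close>
  have one: False if "nb v x y z" "adj x y" "adj x z" "\<not> adj y z" for v x y z
  proof -
    note a = nbD[OF that(1)]
    have nx: "nb x v y z" using a that adj_sym by (intro nb_3) (auto dest: adj_neq)
    have "adj y v" "adj y x" "v \<noteq> x" using a(2,3) that(2) adj_sym adj_neq by blast+
    then obtain w where w: "nb y v x w" using nb_2 by blast
    have yw: "adj y w" using nbD(4)[OF w] .
    have "w \<noteq> z" using that(4) yw by blast
    moreover have "w \<noteq> x" "w \<noteq> v" "w \<noteq> y" using nbD[OF w] adj_neq[OF yw] by auto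
    ultimately have "\<not> adj v w" "\<not> adj x w" using nb_adj[OF that(1)] nb_adj[OF nx] by blast+
    then have "npath y v x + npath y v w + npath y x w \<le> 1"
      using npath_3[OF g] nbD[OF w] by simp
    moreover have "npath v x y + npath v x z + npath v y z = 2"
      using npath_3[OF g] a that by simp
    ultimately show False using npath_sum[OF that(1) w] by simp
  qed
  have "adj x z \<longleftrightarrow> adj y z"
    using one[OF n(1) xy] one[OF nb_swap[OF n(1)]] xy adj_sym by blast
  then consider "\<not> adj x z" "\<not> adj y z" | "adj x z" "adj y z" by blast
  then show ?thesis
  proof cases
    case 1
    then show ?thesis using sig_npath[OF n(1)] np xy by simp
  next
    case 2
    have nx: "nb x v y z" and ny: "nb y v x z" and nz: "nb z v x y"
      using a xy 2 adj_sym by (auto intro!: nb_3 dest: adj_neq)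
    \<comment> \<open>Each of the four vertices has its three neighbours among the other
      three.\<close>
    have V: "{v, x, y, z} = pverts G"
      by (rule closed_eq_verts)
         (use n(1) nx ny nz nb_adj[OF n(1)] nb_adj[OF nx] nb_adj[OF ny] nb_adj[OF nz] nbD(1) in blast)+
    have d: "distinct [v, x, y, z]" using a nb_neq[OF n(1)] by simp
    have "card (pverts G) = 4" unfolding V[symmetric] using d by simp
    moreover have "parcs G = {(u, w). (u, w) \<in> pverts G \<times> pverts G \<and> u \<noteq> w}"
    proof -
      have "adj u w \<longleftrightarrow> u \<in> {v, x, y, z} \<and> w \<in> {v, x, y, z} \<and> u \<noteq> w" for u w
      proof
        assume "adj u w"
        then show "u \<in> {v, x, y, z} \<and> w \<in> {v, x, y, z} \<and> u \<noteq> w"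
          unfolding V using adj_verts adj_neq by blast
      next
        assume "u \<in> {v, x, y, z} \<and> w \<in> {v, x, y, z} \<and> u \<noteq> w"
        then show "adj u w"
          using nb_adj[OF n(1)] nb_adj[OF nx] nb_adj[OF ny] nb_adj[OF nz] by auto
      qed
      then show ?thesis unfolding V by (auto simp: adj_def)
    qed
    ultimately have "complete_digraph 4 (with_proj G)"
      by (simp add: complete_digraph_pair_def pair_finite_verts)
    then show ?thesis using sig_npath[OF n(1)] np xy 2 by simp
  qed
qed

end

section \<open>Neighbourhoods in the particular graphs\<close>

lemma cube_nbrs:
  "{w. ((a, b, c), w) \<in> parcs cube_graph} = {(\<not> a, b, c), (a, \<not> b, c), (a, b, \<not> c)}"
  by (auto simp: cube_graph_def cartesian_product_def complete_graph_2_def sym_graph_def)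

lemma pverts_cube [simp]: "pverts cube_graph = UNIV"
  by (simp add: cube_graph_def cartesian_product_def complete_graph_2_def sym_graph_def)

lemma pverts_prism [simp]: "pverts (prism n) = {..<n} \<times> UNIV"
  by (simp add: prism_def cartesian_product_def complete_graph_2_def sym_graph_def cycle_graph_def)

text \<open>Predecessors modulo \<open>n\<close> are written \<open>i + n - k\<close>, since
  \<open>i - k\<close> would be truncated at 0; the two equations say that this inverts the shift by
  \<open>k\<close>.\<close>

lemma add_mod_inverse:
  fixes i k n :: nat
  assumes "i < n" "k \<le> n"
  shows "((i + n - k) mod n + k) mod n = i" "((i + k) mod n + n - k) mod n = i"
proof -
  have "((i + n - k) mod n + k) mod n = (i + n - k + k) mod n" by (rule mod_add_left_eq)
  also have "\<dots> = i" using assms by simp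
  finally show "((i + n - k) mod n + k) mod n = i" .
  have "((i + k) mod n + n - k) mod n = ((i + k) mod n + (n - k)) mod n" using assms by simp
  also have "\<dots> = (i + k + (n - k)) mod n" by (rule mod_add_left_eq)
  also have "\<dots> = i" using assms by simp
  finally show "((i + k) mod n + n - k) mod n = i" .
qed

lemma Suc_mod_inverse:
  assumes "i < n"
  shows "Suc ((i + n - Suc 0) mod n) mod n = i" "(Suc i mod n + n - Suc 0) mod n = i"
  using add_mod_inverse[of i n "Suc 0"] assms by auto

lemma prism_nbrs:
  assumes "i < n"
  shows "{w. ((i, b), w) \<in> parcs (prism n)} = {(Suc i mod n, b), ((i + n - 1) mod n, b), (i, \<not> b)}"
proof -
  have "Suc i mod n < n" "(i + n - 1) mod n < n" using assms by auto
  then show ?thesis using assms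
    by (auto simp: Suc_mod_inverse prism_def cartesian_product_def complete_graph_2_def sym_graph_def cycle_graph_def)
qed

lemma prism_wf: "(u, w) \<in> parcs (prism n) \<Longrightarrow> u \<in> pverts (prism n) \<and> w \<in> pverts (prism n)"
  by (cases n) (auto simp: prism_def cartesian_product_def complete_graph_2_def sym_graph_def cycle_graph_def
      simp del: mod_Suc)

lemma pverts_moebius: "n > 0 \<Longrightarrow> pverts (moebius_ladder n) = {0..<2 * int n}"
  by (simp add: moebius_ladder_def cayley_graph_def carrier_integer_mod_group)

lemma moebius_nbrs:
  assumes "n > 0" "k \<in> {0..<2 * int n}"
  shows "{w. (k, w) \<in> parcs (moebius_ladder n)} =
    {(k + 1) mod (2 * int n), (k - 1) mod (2 * int n), (k + int n) mod (2 * int n)}"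
proof -
  have "1 \<in> carrier (integer_mod_group (2 * n))" using assms(1) by simp
  then have inv: "inv\<^bsub>integer_mod_group (2 * n)\<^esub> 1 = (-1) mod (2 * int n)"
    by (subst inv_integer_mod_group) simp_all
  have "(k + (-1) mod (2 * int n)) mod (2 * int n) = (k - 1) mod (2 * int n)"
    by (simp add: mod_add_right_eq)
  then show ?thesis using assms unfolding moebius_ladder_def Let_def inv cayley_graph_def
    by (auto simp: carrier_integer_mod_group) metis
qed

lemma moebius_wf:
  assumes "n > 0" "(u, w) \<in> parcs (moebius_ladder n)"
  shows "u \<in> pverts (moebius_ladder n) \<and> w \<in> pverts (moebius_ladder n)"
  using assms by (auto simp: moebius_ladder_def cayley_graph_def carrier_integer_mod_group)

lemma pverts_gp [simp]: "pverts (generalized_petersen n k) = {..<n} \<times> UNIV"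
  by (simp add: generalized_petersen_def sym_graph_def)

lemma gp_nbrs:
  assumes "i < n" "k \<le> n"
  shows "{w. ((i, False), w) \<in> parcs (generalized_petersen n k)} =
      {(Suc i mod n, False), ((i + n - 1) mod n, False), (i, True)}"
    "{w. ((i, True), w) \<in> parcs (generalized_petersen n k)} =
      {((i + k) mod n, True), ((i + n - k) mod n, True), (i, False)}"
proof -
  have "(i + n - 1) mod n < n" "(i + n - k) mod n < n" using assms by auto
  then show "{w. ((i, False), w) \<in> parcs (generalized_petersen n k)} =
      {(Suc i mod n, False), ((i + n - 1) mod n, False), (i, True)}"
    "{w. ((i, True), w) \<in> parcs (generalized_petersen n k)} =
      {((i + k) mod n, True), ((i + n - k) mod n, True), (i, False)}"
    using assms by (auto simp: Suc_mod_inverse add_mod_inverse generalized_petersen_def sym_graph_def)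
qed

lemma gp_wf: "(u, w) \<in> parcs (generalized_petersen n k) \<Longrightarrow>
    u \<in> pverts (generalized_petersen n k) \<and> w \<in> pverts (generalized_petersen n k)"
  by (auto simp: generalized_petersen_def sym_graph_def)

section \<open>Girth 4\<close>

context cubic_girth_regular
begin

text \<open>A count of 2 gives \<open>x\<close> and \<open>y\<close> the same neighbours
  \<open>v\<close>, \<open>p\<close>, \<open>q\<close>. Since then all counts are positive, any two
  of the third neighbours \<open>z\<close>, \<open>p'\<close>, \<open>q'\<close> of these are tied
  together by 4-cycles through \<open>x\<close>, and the three conditions force all of them to
  coincide.\<close>

lemma girth_4_K33:
  assumes g: "g = 4" and n: "nb v x y z" and two: "npath v x y \<ge> 2"
  shows "complete_bipartite_digraph 3 3 (with_proj G) \<and> \<sigma> = [4, 4, 4] \<and>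
    digraph_iso (with_proj G) (with_proj (moebius_ladder 3))"
proof -
  note a = nbD[OF n]
  obtain p q where nx: "nb x v p q" using nb_1[of x v] a(2) adj_sym by blast
  have "adj p y" "adj q y"
    using two npath_4[OF g a(5) a(3) nx] by (auto split: if_splits simp: of_bool_def)
  then have ny: "nb y v p q" using a(3) nbD[OF nx] adj_sym by (intro nb_3) auto
  obtain p' where np: "nb p x y p'"
    using nb_2[of p x y] nbD[OF nx] nbD[OF ny] a(5) adj_sym by blast
  obtain q' where nq: "nb q x y q'"
    using nb_2[of q x y] nbD[OF nx] nbD[OF ny] a(5) adj_sym by blast
  \<comment> \<open>At \<open>x\<close>, any two of the neighbours \<open>v\<close>,
    \<open>p\<close>, \<open>q\<close> have \<open>y\<close> as a second common neighbour, so all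
    three counts at \<open>x\<close> are positive, and hence all counts.\<close>
  have ge1: "npath a b c \<ge> 1" if "nb a b c d" for a b c d
  proof -
    have "npath x v p = of_bool (adj y p) + of_bool (adj z p)"
      using npath_4[OF g _ _ n] nbD[OF nx] by blast
    moreover have "npath x v q = of_bool (adj y q) + of_bool (adj z q)"
      using npath_4[OF g _ _ n] nbD[OF nx] by blast
    moreover have "npath x p q = of_bool (adj y q) + of_bool (adj p' q)"
      using npath_4[OF g _ _ np] nbD[OF nx] by blast
    ultimately have "npath x v p \<ge> 1" "npath x v q \<ge> 1" "npath x p q \<ge> 1"
      using nbD[OF ny] by simp_all
    then show ?thesis using npath_all[OF nx, of "\<lambda>m. m \<ge> 1"] that by blast
  qed
  have "npath q x q' = of_bool (adj v q') + of_bool (adj p q')"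
    using npath_4[OF g _ _ nb_rot[OF nb_rot[OF nx]]] nbD[OF nq] by blast
  then have q: "adj v q' \<or> adj p q'" using ge1[OF nb_swap'[OF nq]] by (auto simp: of_bool_def split: if_splits)
  have "npath p x p' = of_bool (adj v p') + of_bool (adj q p')"
    using npath_4[OF g _ _ nb_swap[OF nx]] nbD[OF np] by blast
  then have p: "adj v p' \<or> adj q p'" using ge1[OF nb_swap'[OF np]] by (auto simp: of_bool_def split: if_splits)
  have xz: "npath v x z = of_bool (adj p z) + of_bool (adj q z)"
    using npath_4[OF g _ _ nx] nbD[OF n] by blast
  then have z: "adj p z \<or> adj q z" using ge1[OF nb_swap'[OF n]] by (auto simp: of_bool_def split: if_splits)
  have "q' = z \<or> q' = p'" using q nb_adj[OF n] nb_adj[OF np] nbD[OF nq] by auto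
  moreover have "p' = z \<or> p' = q'" using p nb_adj[OF n] nb_adj[OF nq] nbD[OF np] by auto
  moreover have "z = p' \<or> z = q'" using z nb_adj[OF np] nb_adj[OF nq] nbD[OF n] by auto
  ultimately have eq: "p' = z" "q' = z" by auto
  note np = np[unfolded eq] and nq = nq[unfolded eq]
  have nz: "nb z v p q"
    using nbD[OF n] nbD[OF np] nbD[OF nq] nbD[OF nx] adj_sym by (intro nb_3) auto
  note adjs = nb_adj[OF n] nb_adj[OF nx] nb_adj[OF ny] nb_adj[OF nz] nb_adj[OF np] nb_adj[OF nq]
  have V: "{v, p, q} \<union> {x, y, z} = pverts G"
    by (rule closed_eq_verts) (use nbD(1)[OF n] nbD(1)[OF nx] nbD(1)[OF ny] nbD(1)[OF nz]
         nbD(1)[OF np] nbD(1)[OF nq] in \<open>auto simp: adjs\<close>)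
  have d: "distinct [v, x, p, y, q, z]"
    using nbD[OF n] nbD[OF nx] nb_neq[OF n] nb_neq[OF np] nb_neq[OF nq] by auto
  then have d': "distinct [z, q, y, p, x, v]" by auto
  have "parcs G = {v, p, q} \<times> {x, y, z} \<union> {x, y, z} \<times> {v, p, q}"
  proof -
    have "\<forall>a \<in> {v, p, q} \<union> {x, y, z}. \<forall>b. adj a b \<longleftrightarrow>
        a \<in> {v, p, q} \<and> b \<in> {x, y, z} \<or> a \<in> {x, y, z} \<and> b \<in> {v, p, q}"
      using d d' by (simp add: adjs)
    then have *: "a \<in> pverts G \<Longrightarrow> adj a b \<longleftrightarrow>
        a \<in> {v, p, q} \<and> b \<in> {x, y, z} \<or> a \<in> {x, y, z} \<and> b \<in> {v, p, q}" for a b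
      unfolding V by (elim ballE allE) (assumption, erule (1) notE)
    have "adj a b \<longleftrightarrow> (a, b) \<in> {v, p, q} \<times> {x, y, z} \<union> {x, y, z} \<times> {v, p, q}" for a b
    proof (cases "a \<in> pverts G")
      case True
      show ?thesis unfolding *[OF True] Un_iff mem_Times_iff fst_conv snd_conv by (rule refl)
    next
      case False
      then have "\<not> adj a b" "a \<notin> {v, p, q}" "a \<notin> {x, y, z}" using adj_verts V by blast+
      then show ?thesis by simp
    qed
    then have "e \<in> parcs G \<longleftrightarrow> e \<in> {v, p, q} \<times> {x, y, z} \<union> {x, y, z} \<times> {v, p, q}" for e
      unfolding adj_def by (metis prod.collapse)
    then show ?thesis by (rule Set.set_eqI)
  qed
  moreover have "{v, p, q} \<inter> {x, y, z} = {}" "card {v, p, q} = 3" "card {x, y, z} = 3"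
    using d by auto
  ultimately have K: "complete_bipartite_digraph 3 3 (with_proj G)"
    unfolding complete_bipartite_digraph_pair_def using V pair_finite_verts by metis
  have "npath v x y = 2" "npath v x z = 2" "npath v y z = 2"
    using npath_4[OF g a(5) a(3) nx] xz npath_4[OF g a(7) a(4) ny] nbD[OF ny] nbD[OF nz] adj_sym
    by simp_all
  then have s: "\<sigma> = [4, 4, 4]" using sig_npath[OF n] by simp
  have "digraph_iso (with_proj G) (with_proj (moebius_ladder 3))"
  proof (rule iso_of_local_bijection)
    \<comment> \<open>A Hamiltonian 6-cycle whose opposite pairs \<open>v\<close>-\<open>y\<close>,
      \<open>x\<close>-\<open>q\<close>, \<open>p\<close>-\<open>z\<close> are adjacent, which are
      the rungs of the ladder.\<close>
    define h where "h = (\<lambda>k. [v, x, p, y, q, z] ! nat k)"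
    have P: "pverts (moebius_ladder 3) = {0, 1, 2, 3, 4, 5}"
      by (auto simp: pverts_moebius)
    have hs: "h 0 = v" "h 1 = x" "h 2 = p" "h 3 = y" "h 4 = q" "h 5 = z"
      by (simp_all add: h_def)
    show "inj_on h (pverts (moebius_ladder 3))" unfolding P using d d' by (simp add: inj_on_def hs)
    show "pverts (moebius_ladder 3) \<noteq> {}" by (simp add: P)
    show "a \<in> pverts (moebius_ladder 3) \<and> b \<in> pverts (moebius_ladder 3)"
      if "(a, b) \<in> parcs (moebius_ladder 3)" for a b using moebius_wf[OF _ that] by simp
    fix u assume u: "u \<in> pverts (moebius_ladder 3)"
    then have N: "{w. (u, w) \<in> parcs (moebius_ladder 3)} = {(u + 1) mod 6, (u - 1) mod 6, (u + 3) mod 6}"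
      using moebius_nbrs[of 3 u] by (simp add: pverts_moebius)
    show "h u \<in> pverts G \<and> h ` {w. (u, w) \<in> parcs (moebius_ladder 3)} = {z. adj (h u) z}"
      using u unfolding N P V[symmetric]
      by (auto simp: hs adjs)
  qed
  then show ?thesis using K s by simp
qed

text \<open>Every path of length two lies on exactly one 4-cycle. The three 4-cycles at
  \<open>v\<close> supply their opposite vertices \<open>p\<close>, \<open>q\<close>,
  \<open>r\<close>, and uniqueness makes the eighth vertex \<open>w\<close> the same for all
  three.\<close>

lemma girth_4_cube:
  assumes g: "g = 4" and n: "nb v x y z"
    and one: "npath v x y = 1" "npath v x z = 1" "npath v y z = 1"
  shows "digraph_iso (with_proj G) (with_proj (prism 4)) \<and>
    digraph_iso (with_proj G) (with_proj cube_graph) \<and> \<sigma> = [2, 2, 2]"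
proof -
  \<comment> \<open>Existence and uniqueness of the fourth vertex of the 4-cycle through the path
    \<open>a\<close>, \<open>b\<close>, \<open>c\<close>.\<close>
  have ex: "\<exists>p. p \<noteq> b \<and> adj a p \<and> adj p c" and un: "p \<noteq> b \<Longrightarrow> adj a p \<Longrightarrow> adj p c \<Longrightarrow> q \<noteq> b \<Longrightarrow> adj a q \<Longrightarrow> adj q c \<Longrightarrow> p = q"
    if abc: "adj b a" "adj b c" "a \<noteq> c" for a b c p q
  proof -
    obtain d where nb: "nb b a c d" using nb_2[OF abc] by blast
    obtain s t where na: "nb a b s t" using nb_1[of a b] abc(1) adj_sym by blast
    have "npath b a c = 1" using npath_all[OF n, of "\<lambda>m. m = 1"] one nb by blast
    then have "of_bool (adj s c) + of_bool (adj t c) = (1::nat)"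
      using npath_4[OF g abc(3,2) na] by simp
    then have st: "adj s c \<noteq> adj t c" by (auto simp: of_bool_def split: if_splits)
    then show "\<exists>p. p \<noteq> b \<and> adj a p \<and> adj p c" 
      using nbD(3-6)[OF na] by metis
    assume *: "p \<noteq> b" "adj a p" "adj p c" "q \<noteq> b" "adj a q" "adj q c"
    then have "p = s \<or> p = t" "q = s \<or> q = t" using nb_adj[OF na] by auto
    then show "p = q" using st * by auto
  qed
  have tri: False if "adj a b" "adj b c" "adj c a" for a b c using no_triangle that g by auto
  note a = nbD[OF n]
  obtain p where p: "p \<noteq> v" "adj x p" "adj p y" using ex[OF a(2,3,5)] by blast
  obtain q where q: "q \<noteq> v" "adj x q" "adj q z" using ex[OF a(2,4,6)] by blast
  obtain r where r: "r \<noteq> v" "adj y r" "adj r z" using ex[OF a(3,4,7)] by blast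
  \<comment> \<open>Otherwise the path \<open>v\<close>, \<open>x\<close>, \<open>p\<close> would
    lie on two 4-cycles, one through \<open>y\<close> and one through \<open>z\<close>. This keeps
    \<open>p\<close>, \<open>q\<close>, \<open>r\<close> apart.\<close>
  have triv: "\<not> adj p z" if "adj v x" "adj v y" "adj v z" "x \<noteq> y" "x \<noteq> z" "y \<noteq> z" "p \<noteq> v" "adj x p" "adj p y"
    for v x y z p
  proof
    assume "adj p z"
    moreover have "adj x v" "adj y p" "adj z p" "adj z p" using that adj_sym \<open>adj p z\<close> by blast+
    ultimately have "y = z" using un[of x v p y z] that by blast
    then show False using that by blast
  qed
  have pz: "\<not> adj p z" using triv[OF a(2,3,4) a(5,6,7) p] .
  have qy: "\<not> adj q y" using triv[OF a(2,4,3) a(6,5) a(7)[symmetric] q] .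
  have rx: "\<not> adj r x" using triv[OF a(3,4,2) a(7) a(5)[symmetric] a(6)[symmetric] r] .
  have pq: "p \<noteq> q" and pr: "p \<noteq> r" and qr: "q \<noteq> r" using pz qy rx p q r adj_sym by blast+
  have nx: "nb x v p q" using p q pq a adj_sym by (intro nb_3) auto
  have ny: "nb y v p r" using p r pr a adj_sym by (intro nb_3) auto
  have nz: "nb z v q r" using q r qr a adj_sym by (intro nb_3) auto
  obtain w where w: "w \<noteq> x" "adj p w" "adj w q" using ex[OF p(2) q(2) pq] by blast
  have wy: "w \<noteq> y" using w(3) qy adj_sym by blast
  have wz: "w \<noteq> z" using w(2) pz by blast
  have np: "nb p x y w" using p w wy a adj_sym by (intro nb_3) auto
  have nq: "nb q x z w" using q w wz a adj_sym by (intro nb_3) auto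
  \<comment> \<open>The 4-cycle through \<open>p\<close>, \<open>y\<close>, \<open>r\<close> closes
    in a neighbour of \<open>p\<close> other than \<open>y\<close>. It cannot be \<open>x\<close>,
    which is not adjacent to \<open>r\<close>, so it is \<open>w\<close> again.\<close>
  obtain w' where w': "w' \<noteq> y" "adj p w'" "adj w' r"
    using ex[of y p r] p r pr adj_sym by blast
  have "w' \<noteq> x" using w'(3) rx adj_sym by blast
  then have "w' = w" using w' nb_adj[OF np] by blast
  then have wr: "adj w r" using w' by simp
  have nr: "nb r y z w" using r wr wy wz a adj_sym by (intro nb_3) auto
  have nw: "nb w p q r" using w wr pq pr qr adj_sym by (intro nb_3) auto
  note nbs = n nx ny nz np nq nr nw
  have d: "distinct [v, x, p, y, z, q, w, r]"
  proof -
    have "p \<noteq> x" "p \<noteq> y" "p \<noteq> z" using nb_neq[OF np] p(2) tri[of v x z] a adj_sym by blast+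
    moreover have "q \<noteq> x" "q \<noteq> z" "q \<noteq> y" using nb_neq[OF nq] q(2) tri[of v x y] a adj_sym by blast+
    moreover have "r \<noteq> y" "r \<noteq> z" "r \<noteq> x" using nb_neq[OF nr] r(2) tri[of v x y] a adj_sym by blast+
    moreover have "w \<noteq> v" using nb_adj[OF n, of p] w(2) calculation adj_sym by blast
    moreover have "w \<noteq> p" "w \<noteq> q" "w \<noteq> r" using nb_neq[OF nw] by auto
    ultimately show ?thesis using nb_neq[OF n] a pq pr qr w(1) wy wz p(1) q(1) r(1) by auto
  qed
  have V: "set [v, x, p, y, z, q, w, r] \<subseteq> pverts G" using nbs by (auto simp: nb_def)
  note adjs = nb_adj[OF n] nb_adj[OF nx] nb_adj[OF ny] nb_adj[OF nz] nb_adj[OF np] nb_adj[OF nq]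
    nb_adj[OF nr] nb_adj[OF nw]
  have "digraph_iso (with_proj G) (with_proj (prism 4))"
  proof (rule iso_of_local_bijection)
    \<comment> \<open>The face \<open>v\<close>, \<open>x\<close>, \<open>p\<close>,
      \<open>y\<close> is the bottom and \<open>z\<close>, \<open>q\<close>, \<open>w\<close>,
      \<open>r\<close> lies above it in this order.\<close>
    define h where "h = (\<lambda>(i, b). (if b then [z, q, w, r] else [v, x, p, y]) ! i)"
    have P: "pverts (prism 4) = {0, 1, 2, 3} \<times> UNIV" by auto
    have hs: "h (0, False) = v" "h (Suc 0, False) = x" "h (2, False) = p" "h (3, False) = y"
      "h (0, True) = z" "h (Suc 0, True) = q" "h (2, True) = w" "h (3, True) = r"
      "h (Suc (Suc 0), False) = p" "h (Suc (Suc 0), True) = w"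
      by (simp_all add: h_def)
    show "inj_on h (pverts (prism 4))" unfolding P using d
      by (auto simp: inj_on_def hs UNIV_bool)
    show "pverts (prism 4) \<noteq> {}" unfolding P by simp
    show "a \<in> pverts (prism 4) \<and> b \<in> pverts (prism 4)"
      if "(a, b) \<in> parcs (prism 4)" for a b using prism_wf[OF that] .
    fix u assume u: "u \<in> pverts (prism 4)"
    then obtain i b where ib: "u = (i, b)" "i \<in> {0, 1, 2, 3}" unfolding P by auto
    have N: "{w. (u, w) \<in> parcs (prism 4)} = {(Suc i mod 4, b), ((i + 4 - 1) mod 4, b), (i, \<not> b)}"
      unfolding ib(1) using ib(2) by (intro prism_nbrs) auto
    show "h u \<in> pverts G \<and> h ` {w. (u, w) \<in> parcs (prism 4)} = {z. adj (h u) z}"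
      using V ib(2) unfolding N unfolding ib(1)
      by (cases b) (auto simp: hs adjs)
  qed
  moreover have "digraph_iso (with_proj G) (with_proj cube_graph)"
  proof (rule iso_of_local_bijection)
    \<comment> \<open>The coordinates record which of the directions from \<open>v\<close> to
      \<open>x\<close>, \<open>y\<close>, \<open>z\<close> are taken.\<close>
    define h where "h = (\<lambda>(a, b, c). if a then if b then if c then w else p else if c then q else x
      else if b then if c then r else y else if c then z else v)"
    show "inj_on h (pverts cube_graph)" using d
      by (auto simp: inj_on_def h_def split: if_splits)
    show "pverts cube_graph \<noteq> {}" by simp
    show "a \<in> pverts cube_graph \<and> b \<in> pverts cube_graph" for a b by simp
    fix u :: "bool \<times> bool \<times> bool"
    obtain a b c where abc: "u = (a, b, c)" by (cases u)
    show "h u \<in> pverts G \<and> h ` {w. (u, w) \<in> parcs cube_graph} = {z. adj (h u) z}"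
      unfolding abc cube_nbrs using V by (cases a; cases b; cases c) (auto simp: h_def adjs)
  qed
  moreover have "\<sigma> = [2, 2, 2]" using sig_npath[OF n] one by simp
  ultimately show ?thesis by simp
qed

end

text \<open>
  Following the edges of a finite 2-regular graph without turning back, the first vertex that is
  met twice is the starting point, since all later vertices already have both neighbours on the walk.
\<close>

lemma two_regular_cycle:
  fixes R :: "'a \<Rightarrow> 'a \<Rightarrow> bool"
  assumes fin: "finite D" and u0: "u0 \<in> D" and sym: "\<And>a b. R a b \<Longrightarrow> R b a" and irr: "\<And>a. \<not> R a a"
    and clos: "\<And>a b. R a b \<Longrightarrow> b \<in> D"
    and deg: "\<And>a. a \<in> D \<Longrightarrow> \<exists>b c. b \<noteq> c \<and> (\<forall>w. R a w \<longleftrightarrow> w = b \<or> w = c)"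
  obtains c :: "int \<Rightarrow> 'a" and m :: nat where "m \<ge> 3" "c 0 = u0"
    "\<And>i j. c i = c j \<longleftrightarrow> i mod int m = j mod int m"
    "\<And>i w. R (c i) w \<longleftrightarrow> w = c (i + 1) \<or> w = c (i - 1)" "\<And>i. c i \<in> D"
proof -
  obtain u1 where u1: "R u0 u1" using deg[OF u0] by blast
  \<comment> \<open>The state of the walk is a pair of previous and current vertex; the next vertex
    is the neighbour of the current one that is not the previous one.\<close>
  define s where "s = (\<lambda>(a, b). (b, SOME w. R b w \<and> w \<noteq> a))"
  define u where "u i = fst ((s ^^ i) (u0, u1))" for i
  have snd: "snd ((s ^^ i) (u0, u1)) = u (Suc i)" for i
    by (simp add: u_def s_def case_prod_beta)
  have next_u: "u (Suc (Suc i)) = (SOME w. R (u (Suc i)) w \<and> w \<noteq> u i)" for i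
    using snd[of i] by (simp add: u_def s_def case_prod_beta)
  have two: "b \<in> D \<Longrightarrow> \<exists>w. R b w \<and> w \<noteq> a" for a b using deg[of b] by metis
  have R: "R (u i) (u (Suc i))" for i
  proof (induction i)
    case 0
    then show ?case using u1 by (simp add: u_def s_def)
  next
    case (Suc i)
    then show ?case using someI_ex[OF two[OF clos[OF Suc]]] next_u by metis
  qed
  have D: "u i \<in> D" for i using R sym clos by blast
  have noback: "u (Suc (Suc i)) \<noteq> u i" for i
    using someI_ex[OF two[OF D]] next_u by metis
  have nbrs: "R a w \<longleftrightarrow> w = b \<or> w = d" if "R a b" "R a d" "b \<noteq> d" for a b d w
    using deg[of a] clos[OF sym[OF that(1)]] that by metis
  have "\<not> inj u" using fin D by (metis finite_subset image_subsetI infinite_UNIV_nat finite_imageD)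
  then obtain i j where "u i = u j" "i < j" by (metis injI linorder_neqE_nat)
  then have ex: "\<exists>m. \<exists>j < m. u j = u m" by blast
  define m where "m = (LEAST m. \<exists>j < m. u j = u m)"
  obtain j where j: "j < m" "u j = u m" using LeastI_ex[OF ex] m_def by blast
  have inj: "k = l" if "u k = u l" "k < m" "l < m" for k l
    using that not_less_Least[of _ "\<lambda>m. \<exists>j < m. u j = u m"] m_def by (metis linorder_neqE_nat)
  have "m \<noteq> Suc 0" using j R[of 0] irr by auto
  moreover have "m \<noteq> Suc (Suc 0)"
    using j noback[of 0] R[of "Suc 0"] irr by (auto simp: less_Suc_eq)
  ultimately have m3: "m \<ge> 3" using j(1) by linarith
  obtain m' where m': "m = Suc m'" using m3 by (cases m) auto
  have j0: "j = 0"
  proof (cases j)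
    case (Suc i)
    have "u m' = u i \<or> u m' = u (Suc j)"
    proof -
      have "R (u j) (u m')" using R[of m'] sym j(2) m' by simp
      moreover have "R (u j) (u i)" "R (u j) (u (Suc j))" using R sym Suc by auto
      moreover have "u i \<noteq> u (Suc j)" using noback[of i] Suc by auto
      ultimately show ?thesis using nbrs by blast
    qed
    then show ?thesis
    proof
      assume "u m' = u i"
      then have "m' = i" using inj j(1) m' Suc by auto
      then show ?thesis using j(1) m' Suc by simp
    next
      assume eq: "u m' = u (Suc j)"
      show ?thesis
      proof (cases "Suc j = m")
        case True
        then show ?thesis using R[of j] j(2) irr by simp
      next
        case False
        then have "m' = Suc j" using inj eq j(1) m' by auto
        then show ?thesis using noback[of j] j(2) m' by simp
      qed
    qed
  qed
  have um: "u m = u 0" using j j0 by simp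
  \<comment> \<open>Indexing by all integers modulo \<open>m\<close> makes the predecessor as
    available as the successor, and lets symmetries of the cycle be written \<open>k + i\<close> and
    \<open>k - i\<close>.\<close>
  define c where "c k = u (nat (k mod int m))" for k
  have lt: "nat (k mod int m) < m" for k using m3 by (simp add: nat_less_iff)
  have c_eq: "c i = c j \<longleftrightarrow> i mod int m = j mod int m" for i j
  proof
    assume "c i = c j"
    then have "nat (i mod int m) = nat (j mod int m)" using inj lt by (simp add: c_def)
    then show "i mod int m = j mod int m" using m3 by (simp add: nat_eq_iff)
  qed (simp add: c_def)
  have c_suc: "c (k + 1) = u (Suc (nat (k mod int m)))" for k
  proof (cases "Suc (nat (k mod int m)) = m")
    case True
    then have "k mod int m = int m - 1" using m3 by (simp add: nat_eq_iff)
    then have "(k + 1) mod int m = 0"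
      by (metis add.commute diff_add_cancel mod_add_left_eq mod_self)
    then show ?thesis using True um by (simp add: c_def)
  next
    case False
    then have "Suc (nat (k mod int m)) < m" using lt[of k] by linarith
    moreover have nonneg: "0 \<le> k mod int m" using m3 by simp
    ultimately have "k mod int m + 1 < int m" by linarith
    then have "(k + 1) mod int m = k mod int m + 1"
      using nonneg by (metis mod_add_left_eq mod_pos_pos_trivial add_nonneg_nonneg zero_le_one)
    then show ?thesis using m3 by (simp add: c_def nat_add_distrib)
  qed
  have Rc: "R (c k) (c (k + 1))" for k using R[of "nat (k mod int m)"] c_suc by (simp add: c_def)
  have "R (c i) w \<longleftrightarrow> w = c (i + 1) \<or> w = c (i - 1)" for i w
  proof (rule nbrs)
    show "R (c i) (c (i + 1))" by (rule Rc)
    show "R (c i) (c (i - 1))" using Rc[of "i - 1"] sym by simp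
    show "c (i + 1) \<noteq> c (i - 1)"
    proof
      assume "c (i + 1) = c (i - 1)"
      then have "int m dvd (i + 1) - (i - 1)" by (simp add: c_eq mod_eq_dvd_iff)
      then show False using m3 by (simp add: zdvd_not_zless)
    qed
  qed
  moreover have "c 0 = u0" by (simp add: c_def u_def)
  ultimately show ?thesis using that[of m c] m3 c_eq D by (simp add: c_def)
qed

section \<open>Girth 4: recognising the exceptional graphs by their counts, and the ladders\<close>

context cubic_girth_regular
begin

text \<open>The claimed signature is selected by a test for this graph, so the test must be shown to
  fail as soon as some count is below 2.\<close>

lemma K33_npath:
  assumes g: "g = 4" and K: "complete_bipartite_digraph 3 3 (with_proj G)" and n: "nb v x y z"
  shows "npath v x y = 2"
proof -
  obtain U W where UW: "U \<inter> W = {}" "\<And>a b. adj a b \<longleftrightarrow> a \<in> U \<and> b \<in> W \<or> a \<in> W \<and> b \<in> U"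
    using K unfolding complete_bipartite_digraph_pair_def adj_def
    by (metis (no_types, lifting) Un_iff mem_Sigma_iff)
  obtain p q where nx: "nb x v p q" using nb_1[of x v] nbD(2)[OF n] adj_sym by blast
  have "adj p y" "adj q y" using nbD(2,3)[OF n] nbD(2-4)[OF nx] UW by blast+
  then show ?thesis using npath_4[OF g nbD(5)[OF n] nbD(3)[OF n] nx] by simp
qed

text \<open>The counterpart for the cube: a count of 0 refutes the isomorphism, because in the cube
  any two neighbours of a vertex have a second common neighbour.\<close>

lemma cube_npath:
  assumes g: "g = 4" and K: "digraph_iso (with_proj G) (with_proj cube_graph)" and n: "nb v x y z"
  shows "npath v x y \<ge> 1"
proof -
  obtain f where bij: "bij_betw f (pverts G) (pverts cube_graph)" and
    f: "\<And>u w. u \<in> pverts G \<Longrightarrow> w \<in> pverts G \<Longrightarrow> adj u w \<longleftrightarrow> (f u, f w) \<in> parcs cube_graph"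
    using digraph_iso_pairD[OF K] unfolding adj_def by blast
  have cube: "\<exists>p. p \<noteq> a \<and> (b, p) \<in> parcs cube_graph \<and> (p, d) \<in> parcs cube_graph"
    if "(a, b) \<in> parcs cube_graph" "(a, d) \<in> parcs cube_graph" "b \<noteq> d" for a b d
  proof -
    have *: "((a, b, c), w) \<in> parcs cube_graph \<longleftrightarrow> w \<in> {(\<not> a, b, c), (a, \<not> b, c), (a, b, \<not> c)}" for a b c w
      using cube_nbrs by blast
    obtain a1 a2 a3 where a: "a = (a1, a2, a3)" by (cases a)
    obtain b1 b2 b3 where b: "b = (b1, b2, b3)" by (cases b)
    obtain d1 d2 d3 where d: "d = (d1, d2, d3)" by (cases d)
    show ?thesis
      \<comment> \<open>The opposite corner of the face spanned by \<open>a\<close>,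
        \<open>b\<close>, \<open>d\<close>: in the coordinate that \<open>b\<close> changes it
        agrees with \<open>b\<close>, elsewhere with \<open>d\<close>.\<close>
      by (rule exI[of _ "(if a1 = b1 then d1 else b1, if a2 = b2 then d2 else b2, if a3 = b3 then d3 else b3)"])
         (use that in \<open>auto simp: a b d *\<close>)
  qed
  have vs: "v \<in> pverts G" "x \<in> pverts G" "y \<in> pverts G" using nbD[OF n] adj_verts by blast+
  have "f x \<noteq> f y" using bij vs nbD(5)[OF n] by (auto simp: bij_betw_def inj_on_def)
  then obtain p' where p': "p' \<noteq> f v" "(f x, p') \<in> parcs cube_graph" "(p', f y) \<in> parcs cube_graph"
    using cube[of "f v" "f x" "f y"] f vs nbD(2,3)[OF n] by blast
  obtain p where p: "p \<in> pverts G" "f p = p'" 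
    using bij unfolding bij_betw_def pverts_cube by (metis UNIV_I imageE)
  have "p \<noteq> v" "adj x p" "adj p y" using p p' f vs by blast+
  obtain x1 x2 where nx: "nb x v x1 x2" using nb_1[of x v] nbD(2)[OF n] adj_sym by blast
  then have "p = x1 \<or> p = x2" using \<open>p \<noteq> v\<close> \<open>adj x p\<close> nb_adj[OF nx] by blast
  then show ?thesis using npath_4[OF g nbD(5)[OF n] nbD(3)[OF n] nx] \<open>adj p y\<close> by auto
qed

definition rung :: "'a \<Rightarrow> 'a \<Rightarrow> bool" where
  "rung a b \<longleftrightarrow> adj a b \<and> eps G {a, b} = 2"

definition rail :: "'a \<Rightarrow> 'a \<Rightarrow> bool" where
  "rail a b \<longleftrightarrow> adj a b \<and> eps G {a, b} \<noteq> 2"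

lemma rung_sym: "rung a b \<longleftrightarrow> rung b a"
  unfolding rung_def using adj_sym by (auto simp: insert_commute)

lemma rail_sym: "rail a b \<longleftrightarrow> rail b a"
  unfolding rail_def using adj_sym by (auto simp: insert_commute)

text \<open>The rails form a 2-regular graph on which the matching acts as an automorphism \<tau>.
  It neither fixes a vertex nor swaps the ends of a rail, while a reflection of a cycle does one of
  the two. If \<tau> preserves a cycle, it is therefore a rotation, and being an involution, the
  half turn.\<close>

lemma girth_4_ladder:
  assumes g: "g = 4" and n0: "nb v0 x0 y0 z0"
    and vals: "npath v0 x0 y0 = 0" "npath v0 x0 z0 = 1" "npath v0 y0 z0 = 1"
  shows "\<exists>n\<ge>3. digraph_iso (with_proj G) (with_proj (prism n)) \<or>
               digraph_iso (with_proj G) (with_proj (moebius_ladder n))"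
proof -
  have struct: "\<exists>x y z. nb v x y z \<and> npath v x y = 0 \<and> npath v x z = 1 \<and> npath v y z = 1"
    if "v \<in> pverts G" for v
  proof -
    obtain x y z where n: "nb v x y z" using nb_ex \<open>v \<in> pverts G\<close> by blast
    have le: "npath v a b \<le> 1" if "nb v a b c" for a b c
      using npath_all[OF n0, of "\<lambda>m. m \<le> 1"] vals that by simp
    have *: "npath v x y \<le> 1" "npath v x z \<le> 1" "npath v y z \<le> 1"
      using le n nb_swap'[OF n] nb_rot[OF n] by blast+
    have "npath v x y + npath v x z + npath v y z = 2" using npath_sum[OF n0 n] vals by simp
    then consider "npath v x y = 0" "npath v x z = 1" "npath v y z = 1"
      | "npath v x y = 1" "npath v x z = 0" "npath v y z = 1"
      | "npath v x y = 1" "npath v x z = 1" "npath v y z = 0" using * by linarith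
    then show ?thesis
      by cases (use n nb_swap'[OF n] nb_rot[OF n] npath_commute in metis)+
  qed
  define \<tau> where "\<tau> v = (THE z. rung v z)" for v
  have struct': "\<exists>x y. nb v x y (\<tau> v) \<and> npath v x y = 0 \<and> npath v x (\<tau> v) = 1 \<and> npath v y (\<tau> v) = 1 \<and>
      rung v (\<tau> v) \<and> rail v x \<and> rail v y" if v: "v \<in> pverts G" for v
  proof -
    obtain x y z where n: "nb v x y z" and e: "npath v x y = 0" "npath v x z = 1" "npath v y z = 1"
      using struct[OF v] by blast
    have "eps G {v, x} = 1" "eps G {v, y} = 1" "eps G {v, z} = 2"
      using eps_eq_npath[OF n] eps_eq_npath[OF nb_swap[OF n]] eps_eq_npath[OF nb_rot[OF nb_rot[OF n]]]
        e npath_commute by simp_all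
    then have r: "rung v z" "rail v x" "rail v y" "\<And>w. rung v w \<Longrightarrow> w = z"
      using nbD[OF n] nb_adj[OF n] by (auto simp: rung_def rail_def)
    then have "\<tau> v = z" unfolding \<tau>_def by blast
    then show ?thesis using n e r by blast
  qed
  have R3: "rung v (\<tau> v)" if "v \<in> pverts G" for v using struct'[OF that] by blast
  have rung_adj: "rung a b \<Longrightarrow> adj a b" and rail_adj: "rail a b \<Longrightarrow> adj a b" for a b
    by (auto simp: rung_def rail_def)
  have not_both: "\<not> (rung a b \<and> rail a b)" for a b by (auto simp: rung_def rail_def)
  have R2: "rung v z \<Longrightarrow> z = \<tau> v" for v z
  proof -
    assume r: "rung v z"
    then have "v \<in> pverts G" using rung_adj adj_verts by blast
    then obtain x y where "nb v x y (\<tau> v)" "rail v x" "rail v y" using struct' by blast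
    then show "z = \<tau> v" using r not_both rung_adj nb_adj by metis
  qed
  have \<tau>V: "\<tau> v \<in> pverts G" if "v \<in> pverts G" for v using R3[OF that] rung_adj adj_verts by blast
  have \<tau>\<tau>: "\<tau> (\<tau> v) = v" if "v \<in> pverts G" for v using R2 R3[OF that] rung_sym by metis
  have adj_iff: "adj v w \<longleftrightarrow> rail v w \<or> w = \<tau> v" if "v \<in> pverts G" for v w
  proof -
    have "adj v w \<longleftrightarrow> rail v w \<or> rung v w" by (auto simp: rung_def rail_def)
    then show ?thesis using R2[of v w] R3[OF that] by metis
  qed
  \<comment> \<open>The two rails at a vertex have count 0, so a girth cycle uses the rung at each
    of its vertices.\<close>
  have R5: "rung v a \<or> rung v b" if ab: "npath v a b > 0" "adj v a" "adj v b" "a \<noteq> b" for v a b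
  proof -
    obtain x y where n: "nb v x y (\<tau> v)" "npath v x y = 0" "rung v (\<tau> v)"
      using struct' adj_verts(1)[OF ab(2)] by blast
    then have "a = \<tau> v \<or> b = \<tau> v"
      using ab npath_commute[of v x y] nb_adj[OF n(1), of a] nb_adj[OF n(1), of b] by auto
    then show ?thesis using n(3) by auto
  qed
  \<comment> \<open>Complete \<open>x\<close>, \<open>v\<close>, \<open>\<tau> v\<close> to a
    4-cycle with fourth vertex \<open>w\<close>. At \<open>x\<close> the cycle must use the rung and
    \<open>vx\<close> is a rail, so \<open>w = \<tau> x\<close>; the rung at \<open>\<tau> v\<close>
    leads back to \<open>v\<close>, so the remaining side is a rail.\<close>
  have R4: "rail (\<tau> v) (\<tau> x)" if r: "rail v x" for v x
  proof -
    have v: "v \<in> pverts G" and vx: "adj v x" using r rail_adj adj_verts by blast+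
    have xt: "x \<noteq> \<tau> v" using R3[OF v] r not_both by blast
    obtain a b where ab: "nb v a b (\<tau> v)" "npath v a (\<tau> v) = 1" "npath v b (\<tau> v) = 1"
      using struct'[OF v] by blast
    then have "x = a \<or> x = b" using xt vx nb_adj[OF ab(1), of x] by blast
    then have n1: "npath v x (\<tau> v) = 1" using ab by blast
    obtain x1 x2 where nx: "nb x v x1 x2" using nb_1[of x v] vx adj_sym by blast
    have "adj v (\<tau> v)" using nbD(4)[OF ab(1)] .
    have "adj x1 (\<tau> v) \<or> adj x2 (\<tau> v)"
      using n1 unfolding npath_4[OF g xt \<open>adj v (\<tau> v)\<close> nx]
      by (auto simp: of_bool_def split: if_splits)
    then obtain w where w: "adj x w" "adj w (\<tau> v)" "w \<noteq> v" using nbD[OF nx] by metis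
    obtain y' where nv: "nb v x (\<tau> v) y'" using nb_2[OF vx \<open>adj v (\<tau> v)\<close> xt] by blast
    have "adj (\<tau> v) w" using w(2) adj_sym by blast
    then have "npath x v w \<ge> 1" unfolding npath_4[OF g w(3)[symmetric] w(1) nv] by simp
    then have "rung x v \<or> rung x w" using R5[of x v w] w vx adj_sym by auto
    moreover have "\<not> rung x v" using r not_both rung_sym by blast
    ultimately have wx: "w = \<tau> x" using R2 by blast
    have "\<not> rung (\<tau> v) w" using R2 \<tau>\<tau>[OF v] w(3) by metis
    then show ?thesis using w(2) wx adj_sym by (auto simp: rung_def rail_def)
  qed
  obtain v where v: "v \<in> pverts G" using verts_nonempty by blast
  obtain c :: "int \<Rightarrow> 'a" and m :: nat where m: "m \<ge> 3"
    and c_eq: "\<And>i j. c i = c j \<longleftrightarrow> i mod int m = j mod int m"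
    and c_rail: "\<And>i w. rail (c i) w \<longleftrightarrow> w = c (i + 1) \<or> w = c (i - 1)"
    and c_V: "\<And>i. c i \<in> pverts G"
  proof (rule two_regular_cycle[of "pverts G" v rail])
    show "finite (pverts G)" by (rule pair_finite_verts)
    show "\<exists>b c. b \<noteq> c \<and> (\<forall>w. rail a w \<longleftrightarrow> w = b \<or> w = c)" if a: "a \<in> pverts G" for a
    proof -
      obtain x y where xy: "nb a x y (\<tau> a)" "rung a (\<tau> a)" "rail a x" "rail a y"
        using struct'[OF a] by blast
      then have "rail a w \<longleftrightarrow> w = x \<or> w = y" for w
        using not_both rail_adj nb_adj by metis
      then show ?thesis using nbD(5)[OF xy(1)] by blast
    qed
    show "rail b a" if "rail a b" for a b using that rail_sym by blast
    show "\<not> rail a a" for a by (simp add: rail_def)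
    show "b \<in> pverts G" if "rail a b" for a b using that rail_adj adj_verts by blast
  qed (use v in blast)+
  have c_add: "c (k mod int m) = c k" for k by (simp add: c_eq)
  have \<tau>_inj: "\<tau> (c i) = \<tau> (c j) \<longleftrightarrow> c i = c j" for i j using \<tau>\<tau> c_V by metis
  have \<tau>_rail: "rail (\<tau> (c i)) w \<longleftrightarrow> w = \<tau> (c (i + 1)) \<or> w = \<tau> (c (i - 1))" for i w
  proof
    assume r: "rail (\<tau> (c i)) w"
    then have "w \<in> pverts G" using rail_adj adj_verts by blast
    then show "w = \<tau> (c (i + 1)) \<or> w = \<tau> (c (i - 1))"
      using R4[OF r] \<tau>\<tau> c_V c_rail by metis
  next
    assume "w = \<tau> (c (i + 1)) \<or> w = \<tau> (c (i - 1))"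
    then show "rail (\<tau> (c i)) w" using R4 c_rail by blast
  qed
  have nbr_c: "{w. adj (c i) w} = {c (i + 1), c (i - 1), \<tau> (c i)}" for i
    using adj_iff[OF c_V] c_rail by auto
  have nbr_\<tau>: "{w. adj (\<tau> (c i)) w} = {\<tau> (c (i + 1)), \<tau> (c (i - 1)), c i}" for i
    using adj_iff[OF \<tau>V[OF c_V]] \<tau>_rail \<tau>\<tau>[OF c_V] by auto
  have \<tau>_ne: "\<tau> (c i) \<noteq> c i" "\<tau> (c i) \<noteq> c (i + 1)" for i
    using R3[OF c_V, of i] rung_adj[of "c i" "c i"] c_rail[of i "c (i + 1)"] not_both by auto
  show ?thesis
  proof (cases "\<tau> (c 0) \<in> range c")
    case False
    \<comment> \<open>Since \<tau> preserves rails, a single meeting with the cycle would propagate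
      along it in both directions and reach \<open>\<tau> (c 0)\<close>.\<close>
    have disj: "\<tau> (c i) \<noteq> c j" for i j
    proof
      have dn: "\<tau> (c (i - 1)) \<in> range c" and up: "\<tau> (c (i + 1)) \<in> range c" if "\<tau> (c i) \<in> range c" for i
        using that \<tau>_rail[of i] c_rail by (metis rangeE rangeI)+
      assume "\<tau> (c i) = c j"
      then have "\<tau> (c i) \<in> range c" by simp
      then have "\<tau> (c 0) \<in> range c"
        by (induction i rule: int_induct[where k = 0]) (use up dn in fastforce)+
      then show False using False by simp
    qed
    have "digraph_iso (with_proj G) (with_proj (prism m))"
    proof (rule iso_of_local_bijection)
      define h where "h = (\<lambda>(i :: nat, b). if b then \<tau> (c (int i)) else c (int i))"
      have ci: "c (int i) = c (int j) \<longleftrightarrow> i = j" if "i < m" "j < m" for i j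
        using that by (simp add: c_eq)
      show "inj_on h (pverts (prism m))"
        using disj ci \<tau>_inj by (fastforce simp: inj_on_def h_def split: if_splits)
      show "pverts (prism m) \<noteq> {}" using m by (auto simp: lessThan_empty_iff)
      show "a \<in> pverts (prism m) \<and> b \<in> pverts (prism m)"
        if "(a, b) \<in> parcs (prism m)" for a b using prism_wf[OF that] .
      fix u assume u: "u \<in> pverts (prism m)"
      then obtain i b where ib: "u = (i, b)" "i < m" by auto
      have s: "c (int (Suc i mod m)) = c (int i + 1)" by (simp add: c_eq zmod_int add.commute)
      have p: "c (int ((i + m - 1) mod m)) = c (int i - 1)"
      proof -
        have "int ((i + m - 1) mod m) mod int m = (int i - 1 + int m) mod int m"
          using m by (simp add: zmod_int of_nat_diff algebra_simps)
        then show ?thesis by (simp add: c_eq)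
      qed
      show "h u \<in> pverts G \<and> h ` {w. (u, w) \<in> parcs (prism m)} = {z. adj (h u) z}"
        unfolding ib(1) prism_nbrs[OF ib(2)] using c_V \<tau>V[OF c_V] s p
        by (cases b) (simp_all add: h_def nbr_c nbr_\<tau>)
    qed
    then show ?thesis using m by blast
  next
    case True
    then obtain k0 where "\<tau> (c 0) = c k0" by blast
    define k where "k = nat (k0 mod int m)"
    have k: "\<tau> (c 0) = c (int k)" using \<open>\<tau> (c 0) = c k0\<close> m by (simp add: k_def c_add)
    have "\<tau> (c 1) = c (int k + 1) \<or> \<tau> (c 1) = c (int k - 1)"
      using \<tau>_rail[of 0 "\<tau> (c 1)"] c_rail[of "int k"] k by simp
    then show ?thesis
    proof
      assume k1: "\<tau> (c 1) = c (int k - 1)"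
      \<comment> \<open>Two consecutive values are carried along: the next one is a rail neighbour
        of the second and differs from the first. The resulting reflection fixes \<open>c j\<close>
        if \<open>k = 2 * j\<close>, and swaps \<open>c j\<close> and \<open>c (j + 1)\<close> if
        \<open>k = 2 * j + 1\<close>.\<close>
      have refl: "\<tau> (c (int i)) = c (int k - int i) \<and> \<tau> (c (int i + 1)) = c (int k - int i - 1)" for i
      proof (induction i)
        case 0
        then show ?case using k k1 by simp
      next
        case (Suc i)
        have "rail (\<tau> (c (int i + 1))) (\<tau> (c (int i + 2)))" 
          using \<tau>_rail[of "int i + 1" "\<tau> (c (int i + 2))"] by (simp add: add.commute)
        then have "\<tau> (c (int i + 2)) = c (int k - int i) \<or> \<tau> (c (int i + 2)) = c (int k - int i - 2)"
          using Suc c_rail[of "int k - int i - 1"] by simp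
        moreover have "\<tau> (c (int i + 2)) \<noteq> \<tau> (c (int i))"
        proof
          assume "\<tau> (c (int i + 2)) = \<tau> (c (int i))"
          then have "int m dvd 2" unfolding \<tau>_inj c_eq mod_eq_dvd_iff by simp
          then show False using m by (simp add: zdvd_not_zless)
        qed
        ultimately show ?case using Suc by (simp add: algebra_simps)
      qed
      show ?thesis
      proof (cases "even k")
        case True
        then obtain j where "k = 2 * j" by blast
        then show ?thesis using refl[of j] \<tau>_ne(1)[of "int j"] by simp
      next
        case False
        then obtain j where "k = 2 * j + 1" by (metis oddE)
        then show ?thesis using refl[of j] \<tau>_ne(2)[of "int j"] by (simp add: algebra_simps)
      qed
    next
      assume k1: "\<tau> (c 1) = c (int k + 1)"
      \<comment> \<open>The same induction as for the reflection, with the opposite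
        orientation.\<close>
      have rot: "\<tau> (c (int i)) = c (int k + int i) \<and> \<tau> (c (int i + 1)) = c (int k + int i + 1)" for i
      proof (induction i)
        case 0
        then show ?case using k k1 by simp
      next
        case (Suc i)
        have "rail (\<tau> (c (int i + 1))) (\<tau> (c (int i + 2)))" 
          using \<tau>_rail[of "int i + 1" "\<tau> (c (int i + 2))"] by (simp add: add.commute)
        then have "\<tau> (c (int i + 2)) = c (int k + int i) \<or> \<tau> (c (int i + 2)) = c (int k + int i + 2)"
          using Suc c_rail[of "int k + int i + 1"] by (auto simp: algebra_simps)
        moreover have "\<tau> (c (int i + 2)) \<noteq> \<tau> (c (int i))"
        proof
          assume "\<tau> (c (int i + 2)) = \<tau> (c (int i))"
          then have "int m dvd 2" unfolding \<tau>_inj c_eq mod_eq_dvd_iff by simp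
          then show False using m by (simp add: zdvd_not_zless)
        qed
        ultimately show ?case using Suc by (simp add: algebra_simps)
      qed
      have rot': "\<tau> (c i) = c (int k + i)" for i
      proof -
        have "\<tau> (c i) = \<tau> (c (int (nat (i mod int m))))" using m by (simp add: c_add)
        also have "\<dots> = c (int k + i mod int m)" using rot[of "nat (i mod int m)"] m by simp
        also have "\<dots> = c (int k + i)" by (simp add: c_eq mod_add_right_eq)
        finally show ?thesis .
      qed
      \<comment> \<open>As an involution without fixed points the rotation by \<open>k\<close>
        satisfies \<open>m dvd 2 * k\<close> but not \<open>m dvd k\<close>. So
        \<open>m = 2 * n\<close>, \<open>k\<close> is an odd multiple of \<open>n\<close>, and the
        rotation is the half turn.\<close>
      have "\<tau> (\<tau> (c 0)) = c (2 * int k)" using rot'[of 0] rot'[of "int k"] by simp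
      then have "int m dvd 2 * int k" using \<tau>\<tau>[OF c_V, of 0] by (simp add: c_eq mod_eq_0_iff_dvd)
      moreover have "\<not> int m dvd int k" using k \<tau>_ne(1)[of 0] by (auto simp: c_eq mod_eq_0_iff_dvd)
      ultimately have dvd: "m dvd 2 * k" "\<not> m dvd k" by presburger+
      have "even m"
      proof (rule ccontr)
        assume "odd m"
        then have "coprime m 2" by simp
        then show False using dvd coprime_dvd_mult_right_iff by blast
      qed
      then obtain n where n: "m = 2 * n" by blast
      then obtain q where q: "k = n * q" using dvd(1) by (auto elim: dvdE)
      have "odd q" using dvd(2) n q by (auto simp: dvd_def)
      then obtain q' where q': "q = 2 * q' + 1" by (metis oddE)
      have kn: "c (int k + i) = c (i + int n)" for i
      proof -
        have "int k + i = (i + int n) + int m * int q'" using n q q' by (simp add: algebra_simps)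
        then show ?thesis unfolding c_eq by (metis mod_mult_self2)
      qed
      \<comment> \<open>For \<open>n = 2\<close> the graph would be complete on four vertices and
        contain a triangle.\<close>
      have n3: "n \<ge> 3"
      proof (rule ccontr)
        assume "\<not> n \<ge> 3"
        then have "n = 2" using n m by simp
        then have "\<tau> (c 0) = c 2" using rot'[of 0] kn[of 0] by simp
        then have "adj (c 0) (c 2)" "adj (c 0) (c 1)" "adj (c 1) (c 2)"
          using adj_iff[OF c_V] c_rail[of 0] c_rail[of 1] by auto
        then show False using no_triangle[of "c 0" "c 1" "c 2"] g adj_sym by auto
      qed
      have "digraph_iso (with_proj G) (with_proj (moebius_ladder n))"
      proof (rule iso_of_local_bijection)
        have P: "pverts (moebius_ladder n) = {0..<int m}" using pverts_moebius n n3 by simp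
        show "inj_on c (pverts (moebius_ladder n))"
          unfolding P by (auto simp: inj_on_def c_eq)
        show "pverts (moebius_ladder n) \<noteq> {}" using P m by simp
        show "a \<in> pverts (moebius_ladder n) \<and> b \<in> pverts (moebius_ladder n)"
          if "(a, b) \<in> parcs (moebius_ladder n)" for a b using moebius_wf[OF _ that] n3 by simp
        fix u assume "u \<in> pverts (moebius_ladder n)"
        then have N: "{w. (u, w) \<in> parcs (moebius_ladder n)} =
            {(u + 1) mod int m, (u - 1) mod int m, (u + int n) mod int m}"
          using moebius_nbrs[of n u] n n3 P by simp
        show "c u \<in> pverts G \<and> c ` {w. (u, w) \<in> parcs (moebius_ladder n)} = {z. adj (c u) z}"
          unfolding N nbr_c using c_V rot'[of u] kn[of u] by (simp add: c_add)
      qed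
      then show ?thesis using n3 by blast
    qed
  qed
qed

lemma girth_4_cases:
  assumes g: "g = 4"
  shows "\<sigma> = [0, 1, 1] \<or>
    (\<exists>n\<ge>3. digraph_iso (with_proj G) (with_proj (prism n)) \<or>
            digraph_iso (with_proj G) (with_proj (moebius_ladder n))) \<and>
    \<sigma> = (if complete_bipartite_digraph 3 3 (with_proj G) then [4, 4, 4]
         else if digraph_iso (with_proj G) (with_proj cube_graph) then [2, 2, 2] else [1, 1, 2])"
proof (cases "\<exists>v x y z. nb v x y z \<and> npath v x y \<ge> 2")
  case True
  then have "complete_bipartite_digraph 3 3 (with_proj G)" "\<sigma> = [4, 4, 4]"
    "digraph_iso (with_proj G) (with_proj (moebius_ladder 3))" using girth_4_K33[OF g] by blast+
  then show ?thesis by auto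
next
  case False
  have le: "npath v x y \<le> 1" if "nb v x y z" for v x y z
  proof -
    have "\<not> npath v x y \<ge> 2" using False that by blast
    then show ?thesis by simp
  qed
  then have notK: "\<not> complete_bipartite_digraph 3 3 (with_proj G)"
    using K33_npath[OF g] npath_pos_exists by fastforce
  obtain v x y z where n: "nb v x y z" "npath v x y > 0" using npath_pos_exists by blast
  have one: "npath v x y = 1" using n le[OF n(1)] by simp
  have "npath v x z \<le> 1" "npath v y z \<le> 1" using le nb_swap'[OF n(1)] nb_rot[OF n(1)] by blast+
  then consider "npath v x z = 0" "npath v y z = 0" | "npath v x z = 1" "npath v y z = 1"
    | "npath v x z = 0" "npath v y z = 1" | "npath v x z = 1" "npath v y z = 0" by linarith
  then show ?thesis
  proof cases
    case 1
    then show ?thesis using sig_npath[OF n(1)] one by simp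
  next
    case 2
    then have "digraph_iso (with_proj G) (with_proj (prism 4))" "\<sigma> = [2, 2, 2]"
      "digraph_iso (with_proj G) (with_proj cube_graph)" using girth_4_cube[OF g n(1) one] by blast+
    \<comment> \<open>The cube appears in the list of ladders as the prism over a 4-cycle.\<close>
    then show ?thesis using notK by (auto intro!: exI[of _ 4])
  next
    case 3
    have "\<not> digraph_iso (with_proj G) (with_proj cube_graph)"
      using cube_npath[OF g _ nb_swap'[OF n(1)]] 3 by auto
    moreover have "\<sigma> = [1, 1, 2]" using sig_npath[OF n(1)] one 3 by simp
    ultimately show ?thesis
      using girth_4_ladder[OF g nb_swap'[OF n(1)]] one 3 notK npath_commute by auto
  next
    case 4
    have "\<not> digraph_iso (with_proj G) (with_proj cube_graph)"
      using cube_npath[OF g _ nb_rot[OF n(1)]] 4 by auto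
    moreover have "\<sigma> = [1, 1, 2]" using sig_npath[OF n(1)] one 4 by simp
    ultimately show ?thesis
      using girth_4_ladder[OF g nb_rot[OF n(1)]] one 4 notK npath_commute by auto
  qed
qed

end

section \<open>Girth 5\<close>

lemma period_5_mod:
  assumes "\<And>i :: nat. F (i + 5) = F i"
  shows "F (i mod 5) = F i"
proof -
  have "F (j + 5 * k) = F j" for j k
    by (induction k) (use assms in \<open>simp_all add: add.assoc[symmetric] add.commute[of 5]\<close>)
  from this[of "i mod 5" "i div 5"] show ?thesis by simp
qed

text \<open>Only five offsets need comparison. The offset from \<open>i\<close> to \<open>j\<close>
  is \<open>(j + 4 * i) mod 5\<close>, since \<open>4 * i\<close> stands for \<open>-i\<close>
  modulo 5 without any subtraction.\<close>

lemma period_5_neq: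
  assumes "\<And>i :: nat. Y (i + 5) = Y i" "\<And>i k. k < 5 \<Longrightarrow> X i \<noteq> Y (i + k)"
  shows "X i \<noteq> Y j"
proof -
  have "(i + (j + 4 * i) mod 5) mod 5 = j mod 5" by presburger
  then have "Y (i + (j + 4 * i) mod 5) = Y j" using period_5_mod[of Y, OF assms(1)] by metis
  then show ?thesis using assms(2)[of "(j + 4 * i) mod 5" i] by simp
qed

text \<open>Offsets 1 and 2 suffice: by periodicity, offsets 4 and 3 are the same comparisons made
  from the other end.\<close>

lemma period_5_inj:
  assumes per: "\<And>i :: nat. F (i + 5) = F i"
    and neq: "\<And>i. F i \<noteq> F (i + 1)" "\<And>i. F i \<noteq> F (i + 2)"
  shows "F i = F j \<longleftrightarrow> i mod 5 = j mod 5"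
proof
  assume eq: "F i = F j"
  define k where "k = (j + 4 * i) mod 5"
  have k: "k < 5" "(i + k) mod 5 = j mod 5" unfolding k_def by presburger+
  then have Fk: "F (i + k) = F i" using period_5_mod[of F, OF per] eq by metis
  have 3: "i + 3 + 2 = i + 5" and 4: "i + 4 + 1 = i + 5" by simp_all
  have "F i \<noteq> F (i + 3)" using neq(2)[of "i + 3"] per[of i] unfolding 3 by metis
  moreover have "F i \<noteq> F (i + 4)" using neq(1)[of "i + 4"] per[of i] unfolding 4 by metis
  moreover have "k = 0 \<or> k = 1 \<or> k = 2 \<or> k = 3 \<or> k = 4" using k(1) by linarith
  ultimately have "k = 0" using Fk neq[of i] by metis
  then show "i mod 5 = j mod 5" using k(2) by simp
next
  assume "i mod 5 = j mod 5"
  then show "F i = F j" using period_5_mod[of F, OF per] by metis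
qed

section \<open>Girth 5: edges between the further neighbours of two neighbours\<close>

context cubic_girth_graph
begin

lemma npath_5_pos:
  assumes "g = 5" "x \<noteq> y" "nb x v x1 x2" "nb y v y1 y2"
  shows "npath v x y \<ge> 1 \<longleftrightarrow> adj x1 y1 \<or> adj x1 y2 \<or> adj x2 y1 \<or> adj x2 y2"
  unfolding npath_5[OF assms] by auto

text \<open>If a further neighbour of \<open>x\<close> met both \<open>y1\<close> and
  \<open>y2\<close>, they would form a 4-cycle with \<open>y\<close>, and symmetrically. The edges
  between the two pairs therefore form a matching, and a count of 2 means a perfect one.\<close>

lemma npath_5_two:
  assumes g: "g = 5" and "x \<noteq> y" and nx: "nb x v x1 x2" and ny: "nb y v y1 y2"
  shows "npath v x y \<le> 2"
    and "npath v x y \<ge> 2 \<longleftrightarrow> adj x1 y1 \<and> adj x2 y2 \<or> adj x1 y2 \<and> adj x2 y1"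
proof -
  have xy: "\<not> adj x y" using no_triangle[of v x y] nbD(2)[OF nx] nbD(2)[OF ny] adj_sym g by auto
  have 1: "\<not> (adj a y1 \<and> adj a y2)" if "a = x1 \<or> a = x2" for a
  proof
    assume a: "adj a y1 \<and> adj a y2"
    have "a = y \<or> y1 = y2"
      using no_quad[of a y1 y y2] a nbD(3,4)[OF ny] adj_sym g by auto
    then show False using that xy nbD(3,4)[OF nx] nbD(7)[OF ny] by auto
  qed
  have 2: "\<not> (adj x1 b \<and> adj x2 b)" if "b = y1 \<or> b = y2" for b
  proof
    assume a: "adj x1 b \<and> adj x2 b"
    have "b = x \<or> x1 = x2"
      using no_quad[of b x1 x x2] a nbD(3,4)[OF nx] adj_sym g by auto
    then show False using that xy nbD(3,4)[OF ny] nbD(7)[OF nx] adj_sym by auto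
  qed
  show "npath v x y \<le> 2" "npath v x y \<ge> 2 \<longleftrightarrow> adj x1 y1 \<and> adj x2 y2 \<or> adj x1 y2 \<and> adj x2 y1"
    unfolding npath_5[OF assms] using 1[of x1] 1[of x2] 2[of y1] 2[of y2]
    by (auto simp: of_bool_def)
qed

end

section \<open>Girth 5: counts equal to zero\<close>

context cubic_girth_regular
begin

lemma npath_5_le_2:
  assumes "g = 5" "nb v x y z"
  shows "npath v x y \<le> 2"
proof -
  obtain x1 x2 where "nb x v x1 x2" using nb_1[of x v] nbD(2)[OF assms(2)] adj_sym by blast
  moreover obtain y1 y2 where "nb y v y1 y2" using nb_1[of y v] nbD(3)[OF assms(2)] adj_sym by blast
  ultimately show ?thesis using npath_5_two(1)[OF assms(1) nbD(5)[OF assms(2)]] by blast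
qed

text \<open>The case to exclude is {0, 0, 2}. The two 5-cycles through \<open>x\<close>,
  \<open>v\<close>, \<open>z\<close> leave \<open>x\<close> by different edges, so two counts at
  \<open>x\<close> are positive, although all of the total 2 should sit in one count.\<close>

lemma girth_5_two_zeros:
  assumes g: "g = 5" and n: "nb v x y z" and z: "npath v x y = 0" "npath v y z = 0"
  shows "\<sigma> = [0, 1, 1]"
proof -
  have pos: "npath v x z > 0"
  proof -
    obtain v' x' y' z' where "nb v' x' y' z'" "npath v' x' y' > 0" using npath_pos_exists by blast
    then show ?thesis using npath_sum[OF n] z by fastforce
  qed
  moreover have "npath v x z \<noteq> 2"
  proof
    assume two: "npath v x z = 2"
    obtain x1 x2 where nx: "nb x v x1 x2" using nb_1[of x v] nbD(2)[OF n] adj_sym by blast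
    obtain z1 z2 where nz: "nb z v z1 z2" using nb_1[of z v] nbD(4)[OF n] adj_sym by blast
    have "\<exists>w \<in> {z1, z2}. adj x1 w" "\<exists>w \<in> {z1, z2}. adj x2 w"
      using npath_5_two(2)[OF g nbD(6)[OF n] nx nz] two by auto
    then obtain w1 w2 where w: "adj x1 w1" "adj z w1" "w1 \<noteq> v" "adj x2 w2" "adj z w2" "w2 \<noteq> v"
      using nbD[OF nz] by blast
    have xz: "\<not> adj x z" using no_triangle[of v x z] nbD[OF n] adj_sym g by auto
    \<comment> \<open>The 5-cycle through \<open>a\<close> and \<open>w\<close> is seen from
      \<open>x\<close>: relative to the path \<open>v\<close>, \<open>x\<close>, \<open>a\<close>,
      its opposite edge joins \<open>z\<close> to \<open>w\<close>.\<close>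
    have side: "npath x v a \<ge> 1" if a: "adj x a" "a \<noteq> v" "adj a w" "adj z w" "w \<noteq> v" for a w
    proof -
      have "w \<noteq> x" using a xz adj_sym by blast
      then obtain t where na: "nb a x w t" using nb_2[of a x w] a adj_sym by blast
      have nv: "nb v x z y" using nb_swap'[OF n] .
      show ?thesis using npath_5_pos[OF g a(2)[symmetric] nv na] a(4) by blast
    qed
    have "npath x v x1 \<ge> 1" "npath x v x2 \<ge> 1" using side nbD[OF nx] w by blast+
    moreover have "npath x v x1 = 2 \<or> npath x v x2 = 2 \<or> npath x x1 x2 = 2"
      using npath_some[OF nb_swap'[OF n], of "\<lambda>m. m = 2"] two nx by blast
    moreover have "npath x v x1 + npath x v x2 + npath x x1 x2 = 2"
      using npath_sum[OF nx n] z two by simp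
    ultimately show False by linarith
  qed
  moreover have "npath v x z \<le> 2" using npath_5_le_2[OF g nb_swap'[OF n]] .
  ultimately have "npath v x z = 1" by linarith
  then show ?thesis using sig_npath[OF n] z by simp
qed

text \<open>The edge values at a vertex are \<open>a\<close>, \<open>b\<close> and
  \<open>a + b\<close>, so exactly one edge is heavy. A girth cycle avoids the pair with count 0,
  which consists of the two light edges, so it uses a heavy and a light edge at each of its
  vertices.\<close>

lemma girth_5_one_zero:
  assumes g: "g = 5" and n: "nb v x y z"
    and val: "npath v x y = 0" "npath v x z > 0" "npath v y z > 0"
  shows False
proof -
  let ?a = "npath v x z" and ?b = "npath v y z"
  define heavy where "heavy u w \<longleftrightarrow> eps G {u, w} = ?a + ?b" for u w
  have struct: "\<exists>p q r. nb u p q r \<and> npath u p q = 0 \<and> npath u p r > 0 \<and> npath u q r > 0 \<and>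
      npath u p r + npath u q r = ?a + ?b" if u: "u \<in> pverts G" for u
  proof -
    have *: "npath u p r > 0 \<and> npath u q r > 0 \<and> npath u p r + npath u q r = ?a + ?b"
      if "nb u p q r" "npath u p q = 0" for p q r
    proof -
      have "{#npath u p r, npath u q r#} = {#?a, ?b#}"
        using npath_mset_eq[OF that(1) n] that(2) val(1) by simp
      then have "npath u p r \<in># {#?a, ?b#}" "npath u q r \<in># {#?a, ?b#}"
        "sum_mset {#npath u p r, npath u q r#} = sum_mset {#?a, ?b#}"
        by (metis multi_member_last union_single_eq_member add_mset_commute)+
      then show ?thesis using val by auto
    qed
    obtain p q r where pqr: "nb u p q r" using nb_ex[OF u] by blast
    have "npath u p q = 0 \<or> npath u p r = 0 \<or> npath u q r = 0"
      by (rule npath_some[OF n, of "\<lambda>m. m = 0", OF val(1) pqr])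
    then show ?thesis using *[OF pqr] *[OF nb_swap'[OF pqr]] *[OF nb_rot[OF pqr]]
        pqr nb_swap'[OF pqr] nb_rot[OF pqr] by metis
  qed
  have alt: "heavy u p \<noteq> heavy u q" if up: "npath u p q > 0" "adj u p" "adj u q" "p \<noteq> q" for u p q
  proof -
    obtain a b c where abc: "nb u a b c" "npath u a b = 0" "npath u a c > 0" "npath u b c > 0"
      "npath u a c + npath u b c = ?a + ?b" using struct[OF adj_verts(1)[OF up(2)]] by blast
    have "eps G {u, a} = npath u a c" "eps G {u, b} = npath u b c"
      "eps G {u, c} = npath u a c + npath u b c"
      using eps_eq_npath[OF abc(1)] eps_eq_npath[OF nb_swap[OF abc(1)]]
        eps_eq_npath[OF nb_rot[OF nb_rot[OF abc(1)]]] abc(2) npath_commute by simp_all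
    then have "\<not> heavy u a" "\<not> heavy u b" "heavy u c" using abc(3-5) by (auto simp: heavy_def)
    moreover have "p = a \<or> p = b \<or> p = c" "q = a \<or> q = b \<or> q = c"
      using nb_adj[OF abc(1)] up by blast+
    moreover have "\<not> (p = a \<and> q = b)" "\<not> (p = b \<and> q = a)" using up(1) abc(2) npath_commute[of u a b] by auto
    ultimately show ?thesis using up(4) by auto
  qed
  obtain C where C: "C \<in> girth_cycles G" "{v, x} \<in> C" using val(2) npath_pos_iff by blast
  then obtain a b d where P: "adj v x" "adj x a" "adj a b" "adj b d" "adj d v" "distinct [v, x, a, b, d]"
      "C = {{v, x}, {x, a}, {a, b}, {b, d}, {d, v}}"
    using girth_cycle_5[OF g, of C v x] by blast
  have h: "heavy u w = heavy w u" for u w by (simp add: heavy_def insert_commute)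
  have alt': "heavy u p \<noteq> heavy u q" if "{u, p} \<in> C" "{u, q} \<in> C" "adj u p" "adj u q" "p \<noteq> q" for u p q
  proof -
    have "npath u p q > 0" using npath_pos_iff C(1) that(1,2) by blast
    then show ?thesis using alt that(3-5) by simp
  qed
  have P': "adj x v" "adj a x" "adj b a" "adj d b" "adj v d" using P adj_sym by blast+
  \<comment> \<open>Five alternations around a cycle of odd length cannot be consistent.\<close>
  have "heavy v d \<noteq> heavy v x" using P P' by (intro alt') (auto simp: insert_commute)
  moreover have "heavy x v \<noteq> heavy x a" using P P' by (intro alt') (auto simp: insert_commute)
  moreover have "heavy a x \<noteq> heavy a b" using P P' by (intro alt') (auto simp: insert_commute)
  moreover have "heavy b a \<noteq> heavy b d" using P P' by (intro alt') (auto simp: insert_commute)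
  moreover have "heavy d b \<noteq> heavy d v" using P P' by (intro alt') (auto simp: insert_commute)
  ultimately show False using h by metis
qed

section \<open>Girth 5: all counts positive and some equal to 2, the Petersen graph\<close>

lemma tree_distinct:
  assumes g: "g = 5" and n: "nb v x y z" and nx: "nb x v x1 x2" and ny: "nb y v y1 y2" and nz: "nb z v z1 z2"
  shows "distinct [v, x, y, z, x1, x2, y1, y2, z1, z2]"
proof -
  have tri: False if "adj a b" "adj b c" "adj c a" for a b c using no_triangle that g by auto
  have quad: "b = d" if "adj a b" "adj b c" "adj c d" "adj d a" "a \<noteq> c" for a b c d
    using no_quad[of a b c d] that g by auto
  \<comment> \<open>Two equal leaves below different children of \<open>v\<close> close a 4-cycle,
    and a leaf equal to a child closes a triangle. So the ball of radius two has 1 + 3 + 6 vertices,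
    the order of the Petersen graph.\<close>
  have far: "a \<noteq> b" if "adj v s" "adj v t" "s \<noteq> t" "adj s a" "adj t b" "a \<noteq> v" for s t a b
    using quad[of v s a t] that adj_sym by blast
  have near: "a \<noteq> t" if "adj v s" "adj v t" "adj s a" for s t a
    using tri[of v s a] that adj_sym by blast
  note a = nbD[OF n] nbD[OF nx] nbD[OF ny] nbD[OF nz]
  have "x1 \<noteq> v" "x2 \<noteq> v" "y1 \<noteq> v" "y2 \<noteq> v" "z1 \<noteq> v" "z2 \<noteq> v" using a by auto
  moreover have "x1 \<noteq> y1" "x1 \<noteq> y2" "x1 \<noteq> z1" "x1 \<noteq> z2" "x2 \<noteq> y1" "x2 \<noteq> y2" "x2 \<noteq> z1" "x2 \<noteq> z2"
    "y1 \<noteq> z1" "y1 \<noteq> z2" "y2 \<noteq> z1" "y2 \<noteq> z2"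
    using far a(2-7) a(9-11) a(16-18) a(23-25) calculation by metis+
  moreover have "x1 \<noteq> x" "x1 \<noteq> y" "x1 \<noteq> z" "x2 \<noteq> x" "x2 \<noteq> y" "x2 \<noteq> z"
    "y1 \<noteq> x" "y1 \<noteq> y" "y1 \<noteq> z" "y2 \<noteq> x" "y2 \<noteq> y" "y2 \<noteq> z"
    "z1 \<noteq> x" "z1 \<noteq> y" "z1 \<noteq> z" "z2 \<noteq> x" "z2 \<noteq> y" "z2 \<noteq> z"
    using near a(2-4) a(10,11) a(17,18) a(24,25) by metis+
  ultimately show ?thesis using nb_neq[OF n] a(5-7) a(14) a(21) a(28) by auto
qed

text \<open>The six leaves form the hexagon \<open>x1\<close>, \<open>y1\<close>, \<open>z2\<close>,
  \<open>x2\<close>, \<open>y2\<close>, \<open>z1\<close>, in which leaves with the same parent are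
  opposite. The lemmas before the final case supply these edges one after another.\<close>

lemma petersen_final:
  assumes g: "g = 5" and n: "nb v x y z" and nx: "nb x v x1 x2" and ny: "nb y v y1 y2" and nz: "nb z v z1 z2"
    and nx1: "nb x1 x y1 z1" and nx2: "nb x2 x y2 z2" and ny1: "nb y1 y x1 z2" and ny2: "nb y2 y x2 z1"
    and nz1: "nb z1 z x1 y2" and nz2: "nb z2 z x2 y1"
  shows "digraph_iso (with_proj G) (with_proj petersen_graph) \<and> \<sigma> = [4, 4, 4]"
proof -
  have d: "distinct [v, x, y, z, x1, x2, y1, y2, z1, z2]" using tree_distinct[OF g n nx ny nz] .
  note adjs = nb_adj[OF n] nb_adj[OF nx] nb_adj[OF ny] nb_adj[OF nz] nb_adj[OF nx1] nb_adj[OF nx2]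
    nb_adj[OF ny1] nb_adj[OF ny2] nb_adj[OF nz1] nb_adj[OF nz2]
  have V: "set [v, x, y, z, x1, x2, y1, y2, z1, z2] \<subseteq> pverts G"
    using nbD(1)[OF n] nbD(1)[OF nx] nbD(1)[OF ny] nbD(1)[OF nz] nbD(1)[OF nx1] nbD(1)[OF nx2]
      nbD(1)[OF ny1] nbD(1)[OF ny2] nbD(1)[OF nz1] nbD(1)[OF nz2] by simp
  have "npath v x y = 2" "npath v x z = 2" "npath v y z = 2"
    using npath_5_two[OF g nbD(5)[OF n] nx ny] npath_5_two[OF g nbD(6)[OF n] nx nz]
      npath_5_two[OF g nbD(7)[OF n] ny nz] by (simp_all add: adjs)
  then have s: "\<sigma> = [4, 4, 4]" using sig_npath[OF n] by simp
  have "digraph_iso (with_proj G) (with_proj petersen_graph)"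
    unfolding petersen_graph_def
  proof (rule iso_of_local_bijection)
    let ?P = "generalized_petersen 5 2"
    \<comment> \<open>The outer pentagon is \<open>v\<close>, \<open>x\<close>, \<open>x1\<close>,
      \<open>y1\<close>, \<open>y\<close>; the inner vertices are their third neighbours in the same
      order.\<close>
    define h where "h = (\<lambda>(i :: nat, b). (if b then [z, x2, z1, z2, y2] else [v, x, x1, y1, y]) ! i)"
    have 5: "i \<in> {..<5} \<longleftrightarrow> i \<in> {0, Suc 0, 2, 3, 4}" for i :: nat by auto
    have hs: "h (0, False) = v" "h (Suc 0, False) = x" "h (2, False) = x1" "h (3, False) = y1"
      "h (4, False) = y" "h (0, True) = z" "h (Suc 0, True) = x2" "h (2, True) = z1"
      "h (3, True) = z2" "h (4, True) = y2" "h (Suc (Suc 0), False) = x1" "h (Suc (Suc 0), True) = z1"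
      by (simp_all add: h_def)
    have "inj_on h ({0, Suc 0, 2, 3, 4} \<times> {False, True})"
    proof -
      have "distinct (map h (List.product [0, Suc 0, 2, 3, 4] [False, True]))"
        using d by (auto simp: hs)
      then have "inj_on h (set (List.product [0, Suc 0, 2, 3, 4] [False, True]))"
        unfolding distinct_map by blast
      moreover have "set (List.product [0, Suc 0, 2, 3, 4] [False, True]) =
          {0, Suc 0, 2, 3, 4} \<times> {False, True}" by auto
      ultimately show ?thesis by simp
    qed
    moreover have "pverts ?P = {0, Suc 0, 2, 3, 4} \<times> {False, True}" by (auto simp: 5)
    ultimately show "inj_on h (pverts ?P)" by simp
    show "pverts ?P \<noteq> {}" by (auto simp: lessThan_empty_iff)
    show "a \<in> pverts ?P \<and> b \<in> pverts ?P" if "(a, b) \<in> parcs ?P" for a b using gp_wf[OF that] .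
    fix u assume u: "u \<in> pverts ?P"
    then obtain i b where ib: "u = (i, b)" "i < 5" by auto
    then have i: "i \<in> {0, Suc 0, 2, 3, 4}" by auto
    note sets = nb_set[OF n] nb_set[OF nx] nb_set[OF ny] nb_set[OF nz] nb_set[OF nx1] nb_set[OF nx2]
      nb_set[OF ny1] nb_set[OF ny2] nb_set[OF nz1] nb_set[OF nz2]
    have le: "(2 :: nat) \<le> 5" by simp
    show "h u \<in> pverts G \<and> h ` {w. (u, w) \<in> parcs ?P} = {z. adj (h u) z}"
    proof (cases b)
      case True
      then have "b = True" by simp
      show ?thesis unfolding ib(1) \<open>b = True\<close> gp_nbrs(2)[OF ib(2) le] using i V
        by (elim insertE emptyE) (simp_all add: hs sets insert_commute)
    next
      case False
      then have "b = False" by simp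
      show ?thesis unfolding ib(1) \<open>b = False\<close> gp_nbrs(1)[OF ib(2) le] using i V
        by (elim insertE emptyE) (simp_all add: hs sets insert_commute)
    qed
  qed
  then show ?thesis using s by simp
qed

text \<open>Five sides of the hexagon are given and \<open>y1\<close>-\<open>z2\<close> is missing.
  If the third neighbour \<open>w\<close> of \<open>y1\<close> were another vertex, the 5-cycle
  through \<open>y\<close>, \<open>y1\<close>, \<open>w\<close> would need a neighbour of
  \<open>w\<close> among vertices whose neighbourhoods are already known.\<close>

lemma petersen_core_3:
  assumes g: "g = 5" and ge1: "\<forall>v x y z. nb v x y z \<longrightarrow> npath v x y \<ge> 1"
    and n: "nb v x y z" and nx: "nb x v x1 x2" and ny: "nb y v y1 y2" and nz: "nb z v z1 z2"
    and e: "adj x1 y1" "adj x2 y2" "adj z1 x1" "adj z1 y2" "adj z2 x2"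
  shows "digraph_iso (with_proj G) (with_proj petersen_graph) \<and> \<sigma> = [4, 4, 4]"
proof -
  have tri: False if "adj a b" "adj b c" "adj c a" for a b c using no_triangle that g by auto
  have d: "distinct [v, x, y, z, x1, x2, y1, y2, z1, z2]" using tree_distinct[OF g n nx ny nz] .
  have s: "adj y1 x1" "adj y2 x2" "adj x1 z1" "adj y2 z1" "adj x2 z2"
    "adj x1 x" "adj x2 x" "adj y1 y" "adj y2 y" "adj z1 z" "adj z2 z"
    using e nbD[OF nx] nbD[OF ny] nbD[OF nz] adj_sym by blast+
  have nx1: "nb x1 x y1 z1" using s e d by (intro nb_3) auto
  have ny2: "nb y2 y x2 z1" using s e d by (intro nb_3) auto
  have nz1: "nb z1 z x1 y2" using s e d by (intro nb_3) auto
  have nx2: "nb x2 x y2 z2" using s e d by (intro nb_3) auto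
  note adjs = nb_adj[OF n] nb_adj[OF nx] nb_adj[OF ny] nb_adj[OF nz] nb_adj[OF nx1] nb_adj[OF nx2]
    nb_adj[OF ny2] nb_adj[OF nz1]
  obtain w where w: "nb y1 y x1 w" using nb_2[of y1 y x1] s d by auto
  have "w = z2"
  proof (rule ccontr)
    assume wz: "w \<noteq> z2"
    have wy1: "adj w y1" using nbD(4)[OF w] adj_sym by blast
    have ne: "w \<noteq> v" "w \<noteq> x" "w \<noteq> z" "w \<noteq> x2" "w \<noteq> y2" "w \<noteq> z1"
      using wy1 adjs d by auto
    have ne': "w \<noteq> y" "w \<noteq> x1" using nbD[OF w] by auto
    obtain w1 w2 where nw: "nb w y1 w1 w2" using nb_1[OF wy1] by blast
    have ny': "nb y y1 v y2" using nb_swap[OF ny] .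
    have "npath y1 y w \<ge> 1" using ge1 nb_swap'[OF w] by blast
    then have "adj v w1 \<or> adj v w2 \<or> adj y2 w1 \<or> adj y2 w2"
      using npath_5_pos[OF g ne'(1)[symmetric] ny' nw] by blast
    then obtain t where t: "adj w t" "adj v t \<or> adj y2 t" using nbD[OF nw] by blast
    then have "t = x \<or> t = y \<or> t = z \<or> t = x2 \<or> t = z1"
      unfolding nb_adj[OF n, of t] nb_adj[OF ny2, of t] by blast
    \<comment> \<open>For \<open>y\<close> this would give a triangle with \<open>y1\<close>; the
      other four candidates have complete neighbourhoods that omit \<open>w\<close>.\<close>
    then have "adj x w \<or> adj y w \<or> adj z w \<or> adj x2 w \<or> adj z1 w" using t adj_sym by blast
    moreover have "\<not> adj x w" by (simp add: nb_adj[OF nx] ne ne')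
    moreover have "\<not> adj z w" by (simp add: nb_adj[OF nz] ne ne' wz)
    moreover have "\<not> adj x2 w" by (simp add: nb_adj[OF nx2] ne ne' wz)
    moreover have "\<not> adj z1 w" by (simp add: nb_adj[OF nz1] ne ne')
    moreover have "\<not> adj y w" using tri[of y y1 w] nbD(2,4)[OF w] adj_sym by blast
    ultimately show False by blast
  qed
  then have ny1: "nb y1 y x1 z2" using w by simp
  have nz2: "nb z2 z x2 y1" using s e d nbD(4)[OF ny1] adj_sym by (intro nb_3) auto
  show ?thesis using petersen_final[OF g n nx ny nz nx1 nx2 ny1 ny2 nz1 nz2] .
qed

text \<open>The 5-cycle through \<open>v\<close>, \<open>z\<close>, \<open>z2\<close> joins
  \<open>z2\<close> to a leaf below \<open>x\<close> or \<open>y\<close>. As \<open>x1\<close> and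
  \<open>y2\<close> are saturated, the leaf is \<open>x2\<close> or \<open>y1\<close>, and
  exchanging \<open>x\<close> with \<open>y\<close> interchanges the two cases.\<close>

lemma petersen_core_2:
  assumes g: "g = 5" and ge1: "\<forall>v x y z. nb v x y z \<longrightarrow> npath v x y \<ge> 1"
    and n: "nb v x y z" and nx: "nb x v x1 x2" and ny: "nb y v y1 y2" and nz: "nb z v z1 z2"
    and e: "adj x1 y1" "adj x2 y2" "adj z1 x1" "adj z1 y2"
  shows "digraph_iso (with_proj G) (with_proj petersen_graph) \<and> \<sigma> = [4, 4, 4]"
proof -
  have d: "distinct [v, x, y, z, x1, x2, y1, y2, z1, z2]" using tree_distinct[OF g n nx ny nz] .
  have s: "adj y1 x1" "adj y2 x2" "adj x1 z1" "adj y2 z1"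
    "adj x1 x" "adj x2 x" "adj y1 y" "adj y2 y" "adj z1 z" "adj z2 z"
    using e nbD[OF nx] nbD[OF ny] nbD[OF nz] adj_sym by blast+
  have nx1: "nb x1 x y1 z1" using s e d by (intro nb_3) auto
  have ny2: "nb y2 y x2 z1" using s e d by (intro nb_3) auto
  obtain p q where nz2: "nb z2 z p q" using nb_1[of z2 z] s by blast
  have "z2 \<noteq> v" using d by auto
  then have "npath z v z2 \<ge> 1" using ge1 nb_swap'[OF nz] by blast
  moreover have "nb v z x y" using nb_rot[OF nb_rot[OF n]] .
  ultimately have "adj x p \<or> adj x q \<or> adj y p \<or> adj y q"
    using npath_5_pos[OF g \<open>z2 \<noteq> v\<close>[symmetric] _ nz2] by blast
  then obtain t where t: "adj z2 t" "adj x t \<or> adj y t" using nbD[OF nz2] by blast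
  have "t \<noteq> v" "t \<noteq> x1" "t \<noteq> y2"
    using t(1) adj_sym[of z2] nb_adj[OF n, of z2] nb_adj[OF nx1, of z2] nb_adj[OF ny2, of z2] d by auto
  then have "t = x2 \<or> t = y1" using t(2) nb_adj[OF nx] nb_adj[OF ny] by blast
  then consider "adj z2 x2" | "adj z2 y1" using t by blast
  then show ?thesis
  proof cases
    case 1
    then show ?thesis using petersen_core_3[OF g ge1 n nx ny nz e] by blast
  next
    case 2
    then show ?thesis
      using petersen_core_3[OF g ge1 nb_swap[OF n] nb_swap'[OF ny] nb_swap'[OF nx] nz s(2,1) e(4,3)] by blast
  qed
qed

text \<open>If the graph is not the Petersen graph, a second edge from \<open>z1\<close> into the
  leaves is impossible, so the third neighbour \<open>p\<close> of \<open>z1\<close> lies outside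
  the tree. The count 2 that must occur at \<open>z\<close> is then denied to each pair in turn, or
  else forces a 4-cycle.\<close>

lemma petersen_core_1:
  assumes g: "g = 5" and ge1: "\<forall>v x y z. nb v x y z \<longrightarrow> npath v x y \<ge> 1"
    and two: "\<forall>v \<in> pverts G. \<exists>x y z. nb v x y z \<and> npath v x y \<ge> 2"
    and n: "nb v x y z" and nx: "nb x v x1 x2" and ny: "nb y v y1 y2" and nz: "nb z v z1 z2"
    and e: "adj x1 y1" "adj x2 y2" "adj x1 z1"
  shows "digraph_iso (with_proj G) (with_proj petersen_graph) \<and> \<sigma> = [4, 4, 4]"
proof (rule ccontr)
  assume contra: "\<not> ?thesis"
  have tri: False if "adj a b" "adj b c" "adj c a" for a b c using no_triangle that g by auto
  have quad: False if "adj a b" "adj b c" "adj c d" "adj d a" "a \<noteq> c" "b \<noteq> d" for a b c d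
    using no_quad[of a b c d] that g by auto
  have d: "distinct [v, x, y, z, x1, x2, y1, y2, z1, z2]" using tree_distinct[OF g n nx ny nz] .
  have s: "adj y1 x1" "adj y2 x2" "adj z1 x1" "adj x1 x" "adj x2 x" "adj y1 y" "adj y2 y" "adj z1 z" "adj z2 z"
    "adj x v" "adj y v" "adj z v"
    "adj x x1" "adj x x2" "adj y y1" "adj y y2" "adj z z1" "adj z z2"
    using e nbD[OF nx] nbD[OF ny] nbD[OF nz] nbD[OF n] adj_sym by blast+
  have nx1: "nb x1 x y1 z1" using s e d by (intro nb_3) auto
  have z1y2: "\<not> adj z1 y2" using petersen_core_2[OF g ge1 n nx ny nz e(1,2) s(3)] contra by blast
  obtain p where p: "nb z1 z x1 p" using nb_2[of z1 z x1] s d by auto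
  have p_ne: "p \<noteq> v" "p \<noteq> x" "p \<noteq> y" "p \<noteq> x2" "p \<noteq> y1" "p \<noteq> y2"
  proof -
    have zp: "adj z1 p" "adj p z1" using nbD(4)[OF p] adj_sym by blast+
    show "p \<noteq> v" "p \<noteq> x" "p \<noteq> y"
      using zp(2) nb_adj[OF n, of z1] nb_adj[OF nx, of z1] nb_adj[OF ny, of z1] d by auto
    show "p \<noteq> y2" using zp z1y2 by blast
    show "p \<noteq> y1" using tri[of x1 y1 z1] zp s e by blast
    show "p \<noteq> x2" using quad[of x x1 z1 x2] zp s e d by auto
  qed
  have z_two: "npath z v z1 \<ge> 2 \<or> npath z v z2 \<ge> 2 \<or> npath z z1 z2 \<ge> 2"
  proof -
    obtain a b c where "nb z a b c" "npath z a b \<ge> 2" using two nbD(1)[OF nz] by blast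
    then show ?thesis using npath_some[of z a b c "\<lambda>m. m \<ge> 2"] nz by blast
  qed
  have v_z1: "v \<noteq> z1" "v \<noteq> z2" "z1 \<noteq> z2" using d by auto
  have nv: "nb v z x y" using nb_rot[OF nb_rot[OF n]] .
  \<comment> \<open>A perfect matching would join \<open>y\<close> to \<open>p\<close> or to
    \<open>x1\<close>, and it is adjacent to neither.\<close>
  have not1: "\<not> npath z v z1 \<ge> 2"
  proof
    assume "npath z v z1 \<ge> 2"
    then have "adj x x1 \<and> adj y p \<or> adj x p \<and> adj y x1"
      using npath_5_two(2)[OF g v_z1(1) nv p] by blast
    then show False using p_ne d by (auto simp: nb_adj[OF nx] nb_adj[OF ny])
  qed
  have "npath v y z \<ge> 1" using ge1 nb_rot[OF n] by blast
  then have "adj y1 z1 \<or> adj y1 z2 \<or> adj y2 z1 \<or> adj y2 z2"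
    using npath_5_pos[OF g nbD(7)[OF n] ny nz] by blast
  moreover have "\<not> adj y1 z1" using tri[of x1 y1 z1] s e by blast
  moreover have "\<not> adj y2 z1" using z1y2 adj_sym by blast
  ultimately consider "adj y2 z2" | "adj y1 z2" by blast
  then show False
  proof cases
    case 1
    have ny2: "nb y2 y x2 z2" using s e d 1 by (intro nb_3) auto
    obtain q where q: "nb z2 z y2 q" using nb_2[of z2 z y2] s d 1 adj_sym[of y2 z2] by auto
    have zq: "adj z2 q" "adj q z2" using nbD(4)[OF q] adj_sym by blast+
    have q_ne: "q \<noteq> x" "q \<noteq> v" "q \<noteq> y" "q \<noteq> z1" "q \<noteq> y1" "q \<noteq> x1" "q \<noteq> x2"
    proof -
      show "q \<noteq> x" "q \<noteq> v" "q \<noteq> y"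
        using zq(2) nb_adj[OF n, of z2] nb_adj[OF nx, of z2] nb_adj[OF ny, of z2] d by auto
      show "q \<noteq> z1" using tri[of z z1 z2] zq s by blast
      show "q \<noteq> y1" using quad[of y y1 z2 y2] zq s d 1 adj_sym by auto
      show "q \<noteq> x1" using zq(2) nb_adj[OF nx1, of z2] d by auto
      show "q \<noteq> x2" using tri[of x2 y2 z2] zq e 1 by blast
    qed
    have "\<not> npath z v z2 \<ge> 2"
    proof
      assume "npath z v z2 \<ge> 2"
      then have "adj x y2 \<and> adj y q \<or> adj x q \<and> adj y y2"
        using npath_5_two(2)[OF g v_z1(2) nv q] by blast
      then show False using q_ne d by (auto simp: nb_adj[OF nx] nb_adj[OF ny])
    qed
    moreover have "\<not> npath z z1 z2 \<ge> 2"
    proof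
      assume "npath z z1 z2 \<ge> 2"
      then have "adj x1 y2 \<and> adj p q \<or> adj x1 q \<and> adj p y2"
        using npath_5_two(2)[OF g v_z1(3) p q] by blast
      then show False using q_ne d by (auto simp: nb_adj[OF nx1])
    qed
    ultimately show False using z_two not1 by blast
  next
    case 2
    have ny1: "nb y1 y x1 z2" using s e d 2 by (intro nb_3) auto
    have z2y1: "adj z2 y1" using 2 adj_sym by blast
    \<comment> \<open>The configuration of \<open>petersen_core_2\<close> again, with
      \<open>x\<close> and \<open>y\<close> exchanged and also \<open>z1\<close> and
      \<open>z2\<close>.\<close>
    have z2x2: "\<not> adj z2 x2"
      using petersen_core_2[OF g ge1 nb_swap[OF n] ny nx nb_swap'[OF nz] s(1,2) z2y1] contra by blast
    obtain q where q: "nb z2 z y1 q" using nb_2[of z2 z y1] s d z2y1 by auto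
    have zq: "adj z2 q" "adj q z2" using nbD(4)[OF q] adj_sym by blast+
    have q_ne: "q \<noteq> x" "q \<noteq> v" "q \<noteq> y" "q \<noteq> z1" "q \<noteq> x1" "q \<noteq> x2" "q \<noteq> y2"
    proof -
      show "q \<noteq> x" "q \<noteq> v" "q \<noteq> y"
        using zq(2) nb_adj[OF n, of z2] nb_adj[OF nx, of z2] nb_adj[OF ny, of z2] d by auto
      show "q \<noteq> z1" using tri[of z z1 z2] zq s by blast
      show "q \<noteq> x1" using zq(2) nb_adj[OF nx1, of z2] d by auto
      show "q \<noteq> x2" using zq z2x2 by blast
      show "q \<noteq> y2" using quad[of y y1 z2 y2] zq s d 2 by auto
    qed
    have "\<not> npath z v z2 \<ge> 2"
    proof
      assume "npath z v z2 \<ge> 2"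
      then have "adj x y1 \<and> adj y q \<or> adj x q \<and> adj y y1"
        using npath_5_two(2)[OF g v_z1(2) nv q] by blast
      then show False using q_ne d by (auto simp: nb_adj[OF nx] nb_adj[OF ny])
    qed
    \<comment> \<open>Only this pair is left for the count 2, and its matching contains the edge
      between the outside vertices \<open>p\<close> and \<open>q\<close>.\<close>
    then have "npath z z1 z2 \<ge> 2" using z_two not1 by blast
    then have "adj x1 y1 \<and> adj p q \<or> adj x1 q \<and> adj p y1"
      using npath_5_two(2)[OF g v_z1(3) p q] by blast
    then have pq: "adj p q" using q_ne d by (auto simp: nb_adj[OF nx1])
    obtain t where t: "nb x2 x y2 t" using nb_2[of x2 x y2] s e d by auto
    obtain r where r: "nb y2 y x2 r" using nb_2[of y2 y x2] s e d by auto
    have "npath x x1 x2 \<ge> 1" using ge1 nb_rot[OF nx] by blast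
    moreover have "x1 \<noteq> x2" "y1 \<noteq> y2" using d by auto
    ultimately have "adj y1 y2 \<or> adj y1 t \<or> adj z1 y2 \<or> adj z1 t"
      using npath_5_pos[OF g _ nx1 t] by blast
    moreover have x2t: "adj x2 t" "adj t x2" using nbD(4)[OF t] adj_sym by blast+
    moreover have "\<not> adj y1 y2" using d by (auto simp: nb_adj[OF ny1])
    moreover have "\<not> adj y1 t" using nb_adj[OF ny1, of t] x2t adj_sym[of x2] z2x2 nb_adj[OF ny, of x2] nb_adj[OF nx1, of x2] d by auto
    ultimately have "adj z1 t" using z1y2 by blast
    \<comment> \<open>The 5-cycle through \<open>x1\<close>, \<open>x\<close>, \<open>x2\<close>
      leaves no other possibility than that \<open>x2\<close> is adjacent to \<open>p\<close>. In
      the same way \<open>y2\<close> turns out to be adjacent to \<open>q\<close>.\<close>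
    then have tp: "t = p" using nb_adj[OF p, of t] x2t adj_sym[of x2] nb_adj[OF nz, of x2] nb_adj[OF nx1, of x2] d by auto
    have "npath y y1 y2 \<ge> 1" using ge1 nb_rot[OF ny] by blast
    then have "adj x1 x2 \<or> adj x1 r \<or> adj z2 x2 \<or> adj z2 r"
      using npath_5_pos[OF g \<open>y1 \<noteq> y2\<close> ny1 r] by blast
    moreover have y2r: "adj y2 r" "adj r y2" using nbD(4)[OF r] adj_sym by blast+
    moreover have "\<not> adj x1 x2" using d by (auto simp: nb_adj[OF nx1])
    moreover have "\<not> adj x1 r" using nb_adj[OF nx1, of r] y2r adj_sym[of y2] z1y2 nb_adj[OF nx, of y2] nb_adj[OF ny1, of y2] d by auto
    ultimately have "adj z2 r" using z2x2 by blast
    then have rq: "r = q" using nb_adj[OF q, of r] y2r adj_sym[of y2] nb_adj[OF nz, of y2] nb_adj[OF ny1, of y2] d by auto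
    \<comment> \<open>The edge \<open>x2\<close>-\<open>y2\<close> and the edge
      \<open>p\<close>-\<open>q\<close> are the opposite sides of a forbidden 4-cycle.\<close>
    show False using quad[of x2 y2 q p] e(2) y2r x2t pq tp rq adj_sym q_ne p_ne by metis
  qed
qed

text \<open>The multisets {1, 1, 2}, {1, 2, 2} and {2, 2, 2} are not separated. One count of 2 gives
  two disjoint edges between the leaves of \<open>x\<close> and \<open>y\<close>, a positive count
  gives one between the leaves of \<open>x\<close> and \<open>z\<close>, and renaming leaves reduces
  its four positions to \<open>adj x1 z1\<close>.\<close>

lemma girth_5_petersen:
  assumes g: "g = 5" and ge1: "\<forall>v x y z. nb v x y z \<longrightarrow> npath v x y \<ge> 1"
    and two: "\<forall>v \<in> pverts G. \<exists>x y z. nb v x y z \<and> npath v x y \<ge> 2"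
  shows "digraph_iso (with_proj G) (with_proj petersen_graph) \<and> \<sigma> = [4, 4, 4]"
proof -
  obtain v x y z where n: "nb v x y z" and v2: "npath v x y \<ge> 2" using verts_nonempty two by blast
  obtain x1 x2 where nx: "nb x v x1 x2" using nb_1[of x v] nbD(2)[OF n] adj_sym by blast
  obtain y1 y2 where ny: "nb y v y1 y2" using nb_1[of y v] nbD(3)[OF n] adj_sym by blast
  obtain z1 z2 where nz: "nb z v z1 z2" using nb_1[of z v] nbD(4)[OF n] adj_sym by blast
  obtain y1 y2 where ny: "nb y v y1 y2" and e: "adj x1 y1" "adj x2 y2"
    using npath_5_two(2)[OF g nbD(5)[OF n] nx ny] v2 ny nb_swap'[OF ny] by blast
  have "npath v x z \<ge> 1" using ge1 nb_swap'[OF n] by blast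
  then consider "adj x1 z1" | "adj x1 z2" | "adj x2 z1" | "adj x2 z2"
    using npath_5_pos[OF g nbD(6)[OF n] nx nz] by blast
  then show ?thesis
  proof cases
    case 1
    then show ?thesis using petersen_core_1[OF g ge1 two n nx ny nz e] by blast
  next
    case 2
    then show ?thesis using petersen_core_1[OF g ge1 two n nx ny nb_swap'[OF nz] e] by blast
  next
    case 3
    then show ?thesis
      using petersen_core_1[OF g ge1 two n nb_swap'[OF nx] nb_swap'[OF ny] nz e(2,1)] by blast
  next
    case 4
    then show ?thesis
      using petersen_core_1[OF g ge1 two n nb_swap'[OF nx] nb_swap'[OF ny] nb_swap'[OF nz] e(2,1)] by blast
  qed
qed

section \<open>Girth 5: all counts equal to 1, the dodecahedron\<close>

lemma girth_5_dodecahedron: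
  assumes g: "g = 5" and n: "nb v0 x0 y0 z0"
    and one: "npath v0 x0 y0 = 1" "npath v0 x0 z0 = 1" "npath v0 y0 z0 = 1"
  shows "digraph_iso (with_proj G) (with_proj dodecahedron_graph) \<and> \<sigma> = [2, 2, 2]"
proof -
  \<comment> \<open>Every path \<open>x\<close>, \<open>v\<close>, \<open>y\<close> lies on exactly
    one 5-cycle. Uniqueness is stated for the vertex after \<open>x\<close> only; by symmetry this
    is enough.\<close>
  have ex5: "\<exists>a b. a \<noteq> v \<and> b \<noteq> v \<and> adj x a \<and> adj a b \<and> adj b y"
    and un5: "\<And>a b a' b'. a \<noteq> v \<Longrightarrow> b \<noteq> v \<Longrightarrow> adj x a \<Longrightarrow> adj a b \<Longrightarrow> adj b y \<Longrightarrow>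
      a' \<noteq> v \<Longrightarrow> b' \<noteq> v \<Longrightarrow> adj x a' \<Longrightarrow> adj a' b' \<Longrightarrow> adj b' y \<Longrightarrow> a = a'"
    if vxy: "adj v x" "adj v y" "x \<noteq> y" for v x y
  proof -
    obtain z where nv: "nb v x y z" using nb_2[OF vxy] by blast
    obtain x1 x2 where nx: "nb x v x1 x2" using nb_1[of x v] vxy(1) adj_sym by blast
    obtain y1 y2 where ny: "nb y v y1 y2" using nb_1[of y v] vxy(2) adj_sym by blast
    have "npath v x y = 1" using npath_all[OF n, of "\<lambda>m. m = 1"] one nv by blast
    then have sum: "of_bool (adj x1 y1) + of_bool (adj x1 y2) + of_bool (adj x2 y1) + of_bool (adj x2 y2) = (1 :: nat)"
      using npath_5[OF g vxy(3) nx ny] by simp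
    then have "adj x1 y1 \<or> adj x1 y2 \<or> adj x2 y1 \<or> adj x2 y2"
      by (auto simp: of_bool_def split: if_splits)
    then show "\<exists>a b. a \<noteq> v \<and> b \<noteq> v \<and> adj x a \<and> adj a b \<and> adj b y"
      using nbD[OF nx] nbD[OF ny] adj_sym by metis
    fix a b a' b'
    assume *: "a \<noteq> v" "b \<noteq> v" "adj x a" "adj a b" "adj b y"
      "a' \<noteq> v" "b' \<noteq> v" "adj x a'" "adj a' b'" "adj b' y"
    have "a = x1 \<or> a = x2" "a' = x1 \<or> a' = x2" "b = y1 \<or> b = y2" "b' = y1 \<or> b' = y2"
      using * nb_adj[OF nx, of a] nb_adj[OF nx, of a'] nb_adj'[OF ny, of b] nb_adj'[OF ny, of b'] by auto
    then show "a = a'" using sum *(4,9) by (auto simp: of_bool_def split: if_splits)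
  qed
  have tri: False if "adj a b" "adj b c" "adj c a" for a b c using no_triangle that g by auto
  have quad: "b = d" if "adj a b" "adj b c" "adj c d" "adj d a" "a \<noteq> c" for a b c d
    using no_quad[of a b c d] that g by auto
  obtain a0 b0 where P: "a0 \<noteq> v0" "b0 \<noteq> v0" "adj x0 a0" "adj a0 b0" "adj b0 y0"
    using ex5[of v0 x0 y0] nbD[OF n] by blast

  \<comment> \<open>The dodecahedron is built in layers of five, \<open>c\<close>, \<open>d\<close>,
    \<open>e\<close>, \<open>f\<close>, around this face. Indices are natural numbers and the layers
    have period 5, so all faces of a layer are treated by one statement in \<open>i\<close>, and
    \<open>i + 4\<close> stands for the predecessor of \<open>i\<close>.\<close>
  define c where "c i = [v0, x0, a0, b0, y0] ! (i mod 5)" for i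
  have mods: "i mod 5 = 0 \<or> i mod 5 = 1 \<or> i mod 5 = 2 \<or> i mod 5 = 3 \<or> i mod 5 = 4" for i :: nat
    by presburger
  have c_per: "c (i + 5) = c i" for i by (simp add: c_def)
  have cc: "adj (c i) (c (i + 1))" for i
    using mods[of i] P nbD[OF n] adj_sym[of v0 y0] by (auto simp: c_def mod_Suc)
  have c_neq: "c i \<noteq> c (i + 2)" for i
  proof -
    have "v0 \<noteq> a0" "x0 \<noteq> b0" "a0 \<noteq> y0" "b0 \<noteq> v0" "y0 \<noteq> x0"
      using P tri[of v0 x0 y0] nbD[OF n] adj_sym by blast+
    then show ?thesis using mods[of i] by (auto simp: c_def mod_Suc)
  qed
  have per4: "i + 4 + 1 = i + 5" and per4': "i + 4 + 2 = i + 1 + 5" for i :: nat by simp_all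
  have c_inj: "c i = c j \<longleftrightarrow> i mod 5 = j mod 5" for i j
    by (rule period_5_inj[of c]) (use c_per c_neq cc adj_neq in blast)+
  have cb: "adj (c i) (c (i + 4))" for i
    using cc[of "i + 4"] c_per[of i] adj_sym unfolding per4 by metis
  have c_neq': "c (i + 4) \<noteq> c (i + 1)" for i
    using c_neq[of "i + 4"] c_per[of "i + 1"] unfolding per4' by metis

  define d where "d i = (SOME w. nb (c i) (c (i + 4)) (c (i + 1)) w)" for i
  have nc: "nb (c i) (c (i + 4)) (c (i + 1)) (d i)" for i
    unfolding d_def by (rule someI_ex, rule nb_2) (use cb cc c_neq' in auto)
  have d_per: "d (i + 5) = d i" for i
    unfolding d_def using c_per[of i] c_per[of "i + 4"] c_per[of "i + 1"] by (simp add: ac_simps)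
  have cd: "adj (c i) (d i)" for i using nbD(4)[OF nc] .
  have dc: "adj (d i) (c i)" for i using cd adj_sym by blast
  have c2: "\<not> adj (c i) (c (i + 2))" for i
    using tri[of "c i" "c (i + 1)" "c (i + 2)"] cc[of i] cc[of "i + 1"] adj_sym by (auto simp: ac_simps)
  have shift: "i + 1 + 1 = i + 2" "i + 2 + 1 = i + 3" "i + 3 + 1 = i + 4" "i + 1 + 4 = i + 5"
    "i + 2 + 4 = i + 1 + 5" "i + 3 + 2 = i + 5" "i + 1 + 2 = i + 3" for i :: nat by simp_all
  \<comment> \<open>the pentagon itself is the only one through three consecutive \<open>c\<close>s\<close>
  have c_only: "a = c (i + 4)" if "adj (c i) a" "a \<noteq> c (i + 1)" "adj a b" "adj b (c (i + 2))" "b \<noteq> c (i + 1)" for i a b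
  proof -
    have "adj (c (i + 1)) (c i)" "adj (c (i + 1)) (c (i + 2))"
      using cc[of i] cc[of "i + 1"] adj_sym unfolding shift by blast+
    moreover have "adj (c (i + 4)) (c (i + 3))" "adj (c (i + 3)) (c (i + 2))"
      using cc[of "i + 3"] cc[of "i + 2"] adj_sym unfolding shift by blast+
    moreover have "c (i + 3) \<noteq> c (i + 1)" using c_neq[of "i + 1"] unfolding shift by metis
    ultimately show ?thesis using un5[of "c (i + 1)" "c i" "c (i + 2)" a b "c (i + 4)" "c (i + 3)"]
      that c_neq cb c_neq' by metis
  qed
  have dcN: "d i \<noteq> c j" for i j
  proof (rule period_5_neq[of c d, OF c_per])
    fix i k :: nat assume "k < 5"
    then have "k = 0 \<or> k = 1 \<or> k = 2 \<or> k = 3 \<or> k = 4" by linarith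
    moreover have "d i \<noteq> c (i + 0)" using cd[of i] adj_neq by fastforce
    moreover have "d i \<noteq> c (i + 1)" "d i \<noteq> c (i + 4)" using nbD[OF nc[of i]] by auto
    moreover have "d i \<noteq> c (i + 2)" using cd[of i] c2[of i] by metis
    moreover have "d i \<noteq> c (i + 3)"
      using cd[of i] c2[of "i + 3"] c_per[of i] adj_sym unfolding shift by metis
    ultimately show "d i \<noteq> c (i + k)" by metis
  qed
  have d1: "d i \<noteq> d (i + 1)" for i
    using tri[of "c i" "c (i + 1)" "d i"] cc[of i] cd[of "i + 1"] dc[of i] by metis
  have d2: "d i \<noteq> d (i + 2)" for i
  proof
    assume "d i = d (i + 2)"
    then have "c (i + 1) = d i"
      using quad[of "c i" "c (i + 1)" "c (i + 2)" "d i"] cc[of i] cc[of "i + 1"] cd[of "i + 2"] dc[of i] c_neq[of i]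
      unfolding shift by metis
    then show False using dcN by metis
  qed
  have d_inj: "d i = d j \<longleftrightarrow> i mod 5 = j mod 5" for i j
    by (rule period_5_inj[of d]) (use d_per d1 d2 in blast)+
  have dd1: "\<not> adj (d i) (d (i + 1))" for i
    using quad[of "c i" "c (i + 1)" "d (i + 1)" "d i"] cc[of i] cd[of "i + 1"] dc[of i] adj_sym dcN by metis
  \<comment> \<open>Such an edge would close a second 5-cycle over \<open>c i\<close>,
    \<open>c (i + 1)\<close>, \<open>c (i + 2)\<close>.\<close>
  have dd2: "\<not> adj (d i) (d (i + 2))" for i
    using c_only[OF cd[of i] dcN _ dc[of "i + 2"] dcN] dcN by blast
  have dd: "\<not> adj (d i) (d j)" for i j
  proof
    assume a: "adj (d i) (d j)"
    have mod: "d (k mod 5) = d k" for k by (rule period_5_mod) (rule d_per)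
    define k where "k = (j + 4 * i) mod 5"
    have k: "k < 5" "(i + k) mod 5 = j mod 5" unfolding k_def by presburger+
    then have dk: "d (i + k) = d j" using mod by metis
    have "k = 0 \<or> k = 1 \<or> k = 2 \<or> k = 3 \<or> k = 4" using k(1) by linarith
    moreover have "\<not> adj (d i) (d (i + 3))" "\<not> adj (d i) (d (i + 4))"
      using dd2[of "i + 3"] dd1[of "i + 4"] d_per[of i] adj_sym unfolding shift per4 by metis+
    moreover have "\<not> adj (d i) (d (i + 0))" by simp
    ultimately show False using a dd1[of i] dd2[of i] dk by metis
  qed

  \<comment> \<open>The face across the edge from \<open>c i\<close> to \<open>c (i + 1)\<close>
    must leave \<open>c (i + 1)\<close> towards \<open>d (i + 1)\<close>: turning to
    \<open>c (i + 2)\<close> would give three consecutive \<open>c\<close> a second 5-cycle. Its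
    fifth vertex is the new one.\<close>
  have e_ex: "\<exists>w. w \<noteq> c i \<and> adj (d i) w \<and> adj w (d (i + 1))" for i
  proof -
    obtain a b where ab: "a \<noteq> c i" "b \<noteq> c i" "adj (d i) a" "adj a b" "adj b (c (i + 1))"
      using ex5[of "c i" "d i" "c (i + 1)"] cd cc dcN by metis
    have "adj (c (i + 1)) b" using ab(5) adj_sym by blast
    then have "b = c (i + 5) \<or> b = c (i + 2) \<or> b = d (i + 1)"
      using nb_adj[OF nc[of "i + 1"], of b] unfolding shift by blast
    moreover have "b \<noteq> c (i + 2)"
    proof
      assume "b = c (i + 2)"
      then have "adj a (c (i + 2))" using ab by simp
      then have "d i = c (i + 4)"
        using c_only[OF cd[of i] dcN ab(3), of] ab cc[of i] tri[of "c i" "d i" "c (i + 1)"] cd adj_sym by metis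
      then show False using dcN by metis
    qed
    ultimately have "b = d (i + 1)" using ab(2) c_per[of i] by metis
    then show ?thesis using ab by blast
  qed
  define e where "e i = (SOME w. w \<noteq> c i \<and> adj (d i) w \<and> adj w (d (i + 1)))" for i
  have e: "e i \<noteq> c i" "adj (d i) (e i)" "adj (e i) (d (i + 1))" for i
    unfolding e_def using someI_ex[OF e_ex[of i]] by blast+
  have e_sym: "adj (e i) (d i)" "adj (d (i + 1)) (e i)" for i using e adj_sym by blast+
  have e_per: "e (i + 5) = e i" for i
    unfolding e_def using c_per[of i] d_per[of i] d_per[of "i + 1"] by (simp add: ac_simps)
  have ecN: "e i \<noteq> c j" for i j
  proof
    assume eq: "e i = c j"
    then have "adj (c j) (d i)" using e_sym by metis
    then have "d i = d j" using nb_adj[OF nc[of j], of "d i"] dcN by blast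
    then have "c j = c i" using d_inj c_inj by metis
    then show False using eq e(1) by metis
  qed
  have edN: "e i \<noteq> d j" for i j using e(2)[of i] dd by metis
  have de4: "adj (d i) (e (i + 4))" for i
    using e_sym(2)[of "i + 4"] d_per[of i] unfolding per4 by metis
  \<comment> \<open>If neighbouring faces shared this vertex, both would be 5-cycles through the
    path \<open>c i\<close>, \<open>d i\<close>, \<open>e i\<close>.\<close>
  have e1': "e (i + 4) \<noteq> e i" for i
  proof
    assume eq: "e (i + 4) = e i"
    have "c (i + 4) = c (i + 1)"
    proof (rule un5[of "d i" "c i" "e i" "c (i + 4)" "d (i + 4)" "c (i + 1)" "d (i + 1)"])
      show "adj (d i) (c i)" "adj (d i) (e i)" "c i \<noteq> e i" using dc e ecN by metis+
      show "c (i + 4) \<noteq> d i" "c (i + 1) \<noteq> d i" using dcN by metis+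
      show "d (i + 4) \<noteq> d i" "d (i + 1) \<noteq> d i"
        using d1[of i] d1[of "i + 4"] d_per[of i] unfolding per4 by metis+
      show "adj (c i) (c (i + 4))" "adj (c (i + 4)) (d (i + 4))" "adj (c i) (c (i + 1))"
        "adj (c (i + 1)) (d (i + 1))" using cb cd cc by blast+
      show "adj (d (i + 4)) (e i)" "adj (d (i + 1)) (e i)" using e(2)[of "i + 4"] eq e_sym by metis+
    qed
    then show False using c_neq' by blast
  qed
  have nd: "nb (d i) (c i) (e (i + 4)) (e i)" for i
    by (rule nb_3) (use dc de4 e ecN e1' in metis)+
  define f where "f i = (SOME w. nb (e i) (d i) (d (i + 1)) w)" for i
  have ne: "nb (e i) (d i) (d (i + 1)) (f i)" for i
    unfolding f_def by (rule someI_ex, rule nb_2) (use e_sym e d1 in auto)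
  have f_per: "f (i + 5) = f i" for i
    unfolding f_def using e_per[of i] d_per[of i] d_per[of "i + 1"] by (simp add: ac_simps)
  have ef: "adj (e i) (f i)" for i using nbD(4)[OF ne] .
  \<comment> \<open>The face through \<open>e (i + 4)\<close>, \<open>d i\<close>,
    \<open>e i\<close>. If it turned to \<open>d (i + 4)\<close> or \<open>d (i + 1)\<close>, it
    would share a path of length two with a face already found, so its two other vertices are
    \<open>f (i + 4)\<close> and \<open>f i\<close>.\<close>
  have ff': "adj (f (i + 4)) (f i)" for i
  proof -
    obtain a b where ab: "a \<noteq> d i" "b \<noteq> d i" "adj (e (i + 4)) a" "adj a b" "adj b (e i)"
      using ex5[of "d i" "e (i + 4)" "e i"] de4 e(2) e1' by metis
    have no: "\<not> adj (e (i + 4)) (e i)" using tri[of "d i" "e (i + 4)" "e i"] de4 e_sym by blast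
    have "a = d (i + 4) \<or> a = f (i + 4)"
      using nb_adj[OF ne[of "i + 4"], of a] ab(1,3) d_per[of i] unfolding per4 by auto
    moreover have "a \<noteq> d (i + 4)"
    proof
      assume a: "a = d (i + 4)"
      have "e i = c i"
      proof (rule un5[of "e (i + 4)" "d i" "d (i + 4)" "e i" b "c i" "c (i + 4)"])
        show "adj (e (i + 4)) (d i)" "adj (e (i + 4)) (d (i + 4))" using de4 e_sym adj_sym by blast+
        show "d i \<noteq> d (i + 4)" using d1[of "i + 4"] d_per[of i] unfolding per4 by metis
        show "e i \<noteq> e (i + 4)" using e1' by metis
        show "b \<noteq> e (i + 4)" using no ab by blast
        show "c i \<noteq> e (i + 4)" "c (i + 4) \<noteq> e (i + 4)" using ecN by metis+
        show "adj (d i) (e i)" "adj (e i) b" "adj b (d (i + 4))" using e ab a adj_sym by blast+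
        show "adj (d i) (c i)" "adj (c i) (c (i + 4))" "adj (c (i + 4)) (d (i + 4))" using dc cb cd by blast+
      qed
      then show False using ecN by blast
    qed
    moreover have "b = d (i + 1) \<or> b = f i"
      using nb_adj'[OF ne[of i], of b] ab(2,5) by auto
    moreover have "b \<noteq> d (i + 1)"
    proof
      assume b: "b = d (i + 1)"
      have "e (i + 4) = c i"
      proof (rule un5[of "e i" "d i" "d (i + 1)" "e (i + 4)" a "c i" "c (i + 1)"])
        show "adj (e i) (d i)" "adj (e i) (d (i + 1))" using e_sym e by blast+
        show "d i \<noteq> d (i + 1)" by (rule d1)
        show "e (i + 4) \<noteq> e i" by (rule e1')
        show "a \<noteq> e i" using no ab by blast
        show "c i \<noteq> e i" "c (i + 1) \<noteq> e i" using ecN by metis+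
        show "adj (d i) (e (i + 4))" "adj (e (i + 4)) a" "adj a (d (i + 1))" using de4 ab b by blast+
        show "adj (d i) (c i)" "adj (c i) (c (i + 1))" "adj (c (i + 1)) (d (i + 1))" using dc cc cd by blast+
      qed
      then show False using ecN by blast
    qed
    ultimately show ?thesis using ab(4) by blast
  qed
  have ff: "adj (f i) (f (i + 1))" for i
    using ff'[of "i + 1"] f_per[of i] unfolding shift by metis
  have e1: "e i \<noteq> e (i + 1)" for i using e1'[of "i + 1"] e_per[of i] unfolding shift by metis
  \<comment> \<open>Otherwise the vertex would be adjacent to the four different vertices
    \<open>d i\<close>, \<open>d (i + 1)\<close>, \<open>d (i + 2)\<close>,
    \<open>d (i + 3)\<close>.\<close>
  have e2: "e i \<noteq> e (i + 2)" for i
  proof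
    assume eq: "e i = e (i + 2)"
    then have "adj (e i) (d (i + 2))" "adj (e i) (d (i + 3))"
      using e_sym(1)[of "i + 2"] e(3)[of "i + 2"] unfolding shift by metis+
    moreover have "d (i + 2) \<noteq> d i" "d (i + 2) \<noteq> d (i + 1)" "d (i + 3) \<noteq> d (i + 1)"
      "d (i + 3) \<noteq> d i" "d (i + 2) \<noteq> d (i + 3)"
      using d2[of i] d1[of "i + 1"] d2[of "i + 1"] d2[of "i + 3"] d1[of "i + 2"] d_per[of i]
      unfolding shift by metis+
    ultimately show False
      using nb_adj[OF ne[of i], of "d (i + 2)"] nb_adj[OF ne[of i], of "d (i + 3)"] by metis
  qed
  have e_inj: "e i = e j \<longleftrightarrow> i mod 5 = j mod 5" for i j
    by (rule period_5_inj[of e]) (use e_per e1 e2 in blast)+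
  have fcN: "f i \<noteq> c j" for i j
  proof
    assume "f i = c j"
    then have "adj (c j) (e i)" using ef adj_sym by metis
    then show False using nb_adj[OF nc[of j], of "e i"] ecN edN by blast
  qed
  have fdN: "f i \<noteq> d j" for i j
  proof
    assume eq: "f i = d j"
    then have "adj (d j) (e i)" using ef adj_sym by metis
    then have "e i = e (j + 4) \<or> e i = e j" using nb_adj[OF nd[of j], of "e i"] ecN by blast
    then have "i mod 5 = (j + 4) mod 5 \<or> i mod 5 = j mod 5" unfolding e_inj .
    then have "(i + 1) mod 5 = j mod 5 \<or> i mod 5 = j mod 5"
      by (metis mod_add_left_eq per4 mod_add_self2)
    then have "d j = d (i + 1) \<or> d j = d i" unfolding d_inj by auto
    then show False using eq nbD(6,7)[OF ne[of i]] by metis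
  qed
  have ee1: "\<not> adj (e i) (e (i + 1))" for i
    using tri[of "d (i + 1)" "e i" "e (i + 1)"] e_sym[of i] e_sym[of "i + 1"] by blast
  \<comment> \<open>Otherwise \<open>f (i + 1)\<close> is the neighbour of \<open>e (i + 2)\<close>
    outside the layer \<open>d\<close>, so it equals \<open>f (i + 2)\<close>, to which it is
    adjacent.\<close>
  have fe2: "f i \<noteq> e (i + 2)" for i
  proof
    assume eq: "f i = e (i + 2)"
    have "adj (e (i + 2)) (f (i + 1))" using ff[of i] eq by metis
    then have "f (i + 1) = f (i + 2)" using nb_adj[OF ne[of "i + 2"], of "f (i + 1)"] fdN by metis
    then show False using ff[of "i + 1"] adj_neq unfolding shift by metis
  qed
  have feN: "f i \<noteq> e j" for i j
  proof (rule period_5_neq[of e f, OF e_per])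
    fix i k :: nat assume "k < 5"
    then have "k = 0 \<or> k = 1 \<or> k = 2 \<or> k = 3 \<or> k = 4" by linarith
    moreover have "f i \<noteq> e (i + 0)" using ef[of i] adj_neq by fastforce
    moreover have "f i \<noteq> e (i + 1)" using ef[of i] ee1[of i] by metis
    moreover have "f i \<noteq> e (i + 4)"
      using ef[of i] ee1[of "i + 4"] e_per[of i] adj_sym unfolding per4 by metis
    moreover have "f i \<noteq> e (i + 3)"
    proof
      assume "f i = e (i + 3)"
      then have "adj (e (i + 3)) (e i)" using ef adj_sym by metis
      then have "e i = f (i + 3)" using nb_adj[OF ne[of "i + 3"], of "e i"] edN by metis
      then show False using fe2[of "i + 3"] e_per[of i] unfolding shift by metis
    qed
    ultimately show "f i \<noteq> e (i + k)" using fe2[of i] by metis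
  qed
  \<comment> \<open>Two neighbours of the common vertex lie in layer \<open>e\<close>, which leaves
    one place for both \<open>f (i + 3)\<close> and \<open>f (i + 4)\<close>, although these are
    adjacent.\<close>
  have f2: "f i \<noteq> f (i + 2)" for i
  proof
    assume eq: "f i = f (i + 2)"
    have fe: "adj (f i) (e i)" "adj (f i) (e (i + 2))" using ef eq adj_sym by metis+
    obtain w where w: "nb (f i) (e i) (e (i + 2)) w" using nb_2[OF fe e2] by blast
    have "adj (f i) (f (i + 3))" using ff[of "i + 2"] eq unfolding shift by metis
    moreover have "adj (f i) (f (i + 4))" using ff'[of i] adj_sym by blast
    ultimately have "f (i + 3) = w" "f (i + 4) = w" using nb_adj[OF w, of "f (i + 3)"] nb_adj[OF w, of "f (i + 4)"] feN by metis+
    then show False using ff[of "i + 3"] adj_neq unfolding shift by metis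
  qed
  have f_inj: "f i = f j \<longleftrightarrow> i mod 5 = j mod 5" for i j
    by (rule period_5_inj[of f]) (use f_per f2 ff adj_neq in blast)+
  have nf: "nb (f i) (e i) (f (i + 4)) (f (i + 1))" for i
  proof (rule nb_3)
    show "adj (f i) (e i)" "adj (f i) (f (i + 4))" "adj (f i) (f (i + 1))"
      using ef[of i] ff'[of i] ff[of i] adj_sym by blast+
    show "e i \<noteq> f (i + 4)" "e i \<noteq> f (i + 1)" using feN by metis+
    show "f (i + 4) \<noteq> f (i + 1)" using f2[of "i + 4"] f_per[of "i + 1"] unfolding per4' by metis
  qed

  have "digraph_iso (with_proj G) (with_proj dodecahedron_graph)"
    unfolding dodecahedron_graph_def
  proof (rule iso_of_local_bijection)
    let ?P = "generalized_petersen 10 2"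
    \<comment> \<open>In \<open>GP(10, 2)\<close> the outer 10-cycle alternates between the layers
      \<open>d\<close> and \<open>e\<close>, while steps of two split the inner vertices into two
      5-cycles: \<open>c\<close> at even and \<open>f\<close> at odd positions.\<close>
    define h where "h = (\<lambda>(i :: nat, b). if b then if even i then c (i div 2) else f (i div 2)
      else if even i then d (i div 2) else e (i div 2))"
    have ij: "i = j" if "(i div 2) mod 5 = (j div 2) mod 5" "even i = even j" "i < 10" "j < 10" for i j :: nat
    proof -
      have "i div 2 = j div 2" using that by simp
      moreover have "i mod 2 = j mod 2" using that(2) by (simp add: mod2_eq_if)
      ultimately show ?thesis by (metis div_mult_mod_eq)
    qed
    have neqs: "c i \<noteq> d j" "c i \<noteq> e j" "c i \<noteq> f j" "d i \<noteq> e j" "d i \<noteq> f j" "e i \<noteq> f j" for i j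
      using dcN ecN fcN edN fdN feN by metis+
    show "inj_on h (pverts ?P)"
      by (auto simp: inj_on_def h_def dcN ecN fcN edN fdN feN neqs c_inj d_inj e_inj f_inj
          split: if_splits intro: ij)
    show "pverts ?P \<noteq> {}" by (auto simp: lessThan_empty_iff)
    show "a \<in> pverts ?P \<and> b \<in> pverts ?P" if "(a, b) \<in> parcs ?P" for a b using gp_wf[OF that] .
    fix u assume u: "u \<in> pverts ?P"
    then obtain i b where ib: "u = (i, b)" "i < 10" by auto
    have V: "c k \<in> pverts G" "d k \<in> pverts G" "e k \<in> pverts G" "f k \<in> pverts G" for k
      using nbD(1) nc nd ne nf by blast+
    have le: "(2 :: nat) \<le> 10" by simp
    define k where "k = i div 2"
    then have k5: "k = 0 \<or> k = 1 \<or> k = 2 \<or> k = 3 \<or> k = 4" using ib(2) by auto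
    have wrap: "c ((k + 1) mod 5) = c (k + 1)" "c ((k + 4) mod 5) = c (k + 4)"
      "d ((k + 1) mod 5) = d (k + 1)" "e ((k + 4) mod 5) = e (k + 4)"
      "f ((k + 1) mod 5) = f (k + 1)" "f ((k + 4) mod 5) = f (k + 4)"
      using period_5_mod[of c, OF c_per] period_5_mod[of d, OF d_per]
        period_5_mod[of e, OF e_per] period_5_mod[of f, OF f_per] by blast+
    show "h u \<in> pverts G \<and> h ` {w. (u, w) \<in> parcs ?P} = {z. adj (h u) z}"
    proof (cases "even i")
      case True
      then have i: "i = 2 * k" by (simp add: k_def)
      have ar: "even ((i + 2) mod 10)" "even ((i + 10 - 2) mod 10)" "odd (Suc i mod 10)" "odd ((i + 10 - 1) mod 10)"
        "(i + 2) mod 10 div 2 = (k + 1) mod 5" "(i + 10 - 2) mod 10 div 2 = (k + 4) mod 5"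
        "Suc i mod 10 div 2 = k" "(i + 10 - 1) mod 10 div 2 = (k + 4) mod 5"
        using k5 unfolding i by (elim disjE; simp)+
      show ?thesis
      proof (cases b)
        case True
        then have "b = True" by simp
        have hu: "h u = c k" using ib i \<open>b = True\<close> by (simp add: h_def)
        show ?thesis unfolding hu nb_set[OF nc] unfolding ib(1) \<open>b = True\<close> gp_nbrs(2)[OF ib(2) le]
          using V ar wrap \<open>even i\<close> by (simp add: h_def k_def[symmetric] insert_commute)
      next
        case False
        then have "b = False" by simp
        have hu: "h u = d k" using ib i \<open>b = False\<close> by (simp add: h_def)
        show ?thesis unfolding hu nb_set[OF nd] unfolding ib(1) \<open>b = False\<close> gp_nbrs(1)[OF ib(2) le]
          using V ar wrap \<open>even i\<close> by (simp add: h_def k_def[symmetric] insert_commute)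
      qed
    next
      case False
      then have i: "i = 2 * k + 1" by (simp add: k_def)
      have ar: "odd ((i + 2) mod 10)" "odd ((i + 10 - 2) mod 10)" "even (Suc i mod 10)" "even ((i + 10 - 1) mod 10)"
        "(i + 2) mod 10 div 2 = (k + 1) mod 5" "(i + 10 - 2) mod 10 div 2 = (k + 4) mod 5"
        "Suc i mod 10 div 2 = (k + 1) mod 5" "(i + 10 - 1) mod 10 div 2 = k"
        using k5 unfolding i by (elim disjE; simp)+
      show ?thesis
      proof (cases b)
        case True
        then have "b = True" by simp
        have hu: "h u = f k" using ib i \<open>b = True\<close> by (simp add: h_def)
        show ?thesis unfolding hu nb_set[OF nf] unfolding ib(1) \<open>b = True\<close> gp_nbrs(2)[OF ib(2) le]
          using V ar wrap \<open>odd i\<close> by (simp add: h_def k_def[symmetric] insert_commute)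
      next
        case False
        then have "b = False" by simp
        have hu: "h u = e k" using ib i \<open>b = False\<close> by (simp add: h_def)
        show ?thesis unfolding hu nb_set[OF ne] unfolding ib(1) \<open>b = False\<close> gp_nbrs(1)[OF ib(2) le]
          using V ar wrap \<open>odd i\<close> by (simp add: h_def k_def[symmetric] insert_commute)
      qed
    qed
  qed
  moreover have "\<sigma> = [2, 2, 2]" using sig_npath[OF n] one by simp
  ultimately show ?thesis by simp
qed

lemma girth_5_cases:
  assumes g: "g = 5"
  shows "\<sigma> = [0, 1, 1] \<or>
    digraph_iso (with_proj G) (with_proj petersen_graph) \<and> \<sigma> = [4, 4, 4] \<or>
    digraph_iso (with_proj G) (with_proj dodecahedron_graph) \<and> \<sigma> = [2, 2, 2]"
proof (cases "\<exists>v x y z. nb v x y z \<and> npath v x y = 0")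
  case True
  then obtain v x y z where n: "nb v x y z" "npath v x y = 0" by blast
  consider "npath v y z = 0" | "npath v x z = 0" | "npath v x z > 0" "npath v y z > 0" by auto
  then show ?thesis
  proof cases
    case 1
    then show ?thesis using girth_5_two_zeros[OF g n] by simp
  next
    case 2
    then show ?thesis using girth_5_two_zeros[OF g nb_swap[OF n(1)]] n(2) npath_commute by simp
  next
    case 3
    then show ?thesis using girth_5_one_zero[OF g n] by simp
  qed
next
  case False
  then have ge1: "\<forall>v x y z. nb v x y z \<longrightarrow> npath v x y \<ge> 1" by (metis One_nat_def not_less_eq_eq le_zero_eq)
  show ?thesis
  proof (cases "\<exists>v x y z. nb v x y z \<and> npath v x y \<ge> 2")
    case True
    then obtain v x y z where n: "nb v x y z" "npath v x y \<ge> 2" by blast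
    have "\<forall>u \<in> pverts G. \<exists>x y z. nb u x y z \<and> npath u x y \<ge> 2"
    proof
      fix u assume "u \<in> pverts G"
      then obtain a b c where u: "nb u a b c" using nb_ex by blast
      then have "npath u a b \<ge> 2 \<or> npath u a c \<ge> 2 \<or> npath u b c \<ge> 2"
        using npath_some[OF n(1), of "\<lambda>m. m \<ge> 2"] n(2) by blast
      then show "\<exists>x y z. nb u x y z \<and> npath u x y \<ge> 2" using u nb_swap'[OF u] nb_rot[OF u] by blast
    qed
    then show ?thesis using girth_5_petersen[OF g ge1] by blast
  next
    case False
    then have one: "npath v x y = 1" if "nb v x y z" for v x y z
      using ge1 that by (metis One_nat_def Suc_1 le_antisym not_less_eq_eq)
    obtain v x y z where n: "nb v x y z" using npath_pos_exists by blast
    show ?thesis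
      using girth_5_dodecahedron[OF g n] one n nb_swap'[OF n] nb_rot[OF n] by blast
  qed
qed

end

section \<open>Signature (0, 1, 1): truncations\<close>

context cubic_girth_graph
begin

lemma Union_cycle_edges:
  assumes "vcycle vs"
  shows "\<Union> (cycle_edges vs) = set vs"
proof -
  have "0 < length vs" using assms by (auto simp: vcycle_def)
  then have "Suc i mod length vs < length vs" for i by simp
  then show ?thesis unfolding cycle_edges_def by (fastforce simp: in_set_conv_nth)
qed

lemma girth_cycle_edge:
  assumes "C \<in> girth_cycles G" "v \<in> \<Union> C"
  obtains w where "{v, w} \<in> C"
proof -
  obtain e where "e \<in> C" "v \<in> e" using assms by blast
  then have "\<exists>w. e = {v, w}" using assms(1) by (auto simp: girth_cycles_eq cycle_edges_def)
  then show ?thesis using \<open>e \<in> C\<close> that by blast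
qed

lemma card_girth_cycle: "C \<in> girth_cycles G \<Longrightarrow> card (\<Union> C) = g"
  using Union_cycle_edges distinct_card by (fastforce simp: girth_cycles_eq vcycle_def)

lemma girth_cycle_verts: "C \<in> girth_cycles G \<Longrightarrow> \<Union> C \<subseteq> pverts G"
proof
  fix v assume C: "C \<in> girth_cycles G" "v \<in> \<Union> C"
  then obtain w where "{v, w} \<in> C" by (rule girth_cycle_edge)
  then have "adj v w" using cycle_degree_two[OF girth_cycles_ucycles[OF C(1)]] by metis
  then show "v \<in> pverts G" by (rule adj_verts)
qed

text \<open>On a cycle of length at most 5, two vertices that are not consecutive have a common
  neighbour on the cycle, so a chord would cut off a triangle although the girth exceeds 3. This is
  where the bound on the girth enters.\<close>

lemma girth_cycle_chordless:
  assumes g: "g \<le> 5" and C: "C \<in> girth_cycles G" "u \<in> \<Union> C" "w \<in> \<Union> C" and uw: "adj u w"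
  shows "{u, w} \<in> C"
proof -
  obtain x where "{u, x} \<in> C" using C by (auto elim: girth_cycle_edge)
  moreover obtain us where "vcycle us" "C = cycle_edges us" "length us = g"
    using C by (auto simp: girth_cycles_eq)
  ultimately obtain vs where vs: "vcycle vs" "C = cycle_edges vs" "length vs = g" "vs ! 0 = u"
    using cycle_through_vertex by metis
  have g3: "3 \<le> g" by (rule girth_ge_3)
  have step: "adj (vs ! i) (vs ! Suc i)" if "Suc i < g" for i
  proof -
    have "adj (vs ! i) (vs ! (Suc i mod length vs))" 
      using vs(1,3) Suc_lessD[OF that] unfolding vcycle_def by blast
    then show ?thesis using that vs(3) by simp
  qed
  have last: "adj (vs ! (g - 1)) (vs ! 0)"
  proof -
    have "Suc (g - 1) mod g = 0" using g3 by simp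
    moreover have "g - 1 < length vs" using vs(3) g3 by simp
    then have "adj (vs ! (g - 1)) (vs ! (Suc (g - 1) mod length vs))"
      using vs(1) unfolding vcycle_def by blast
    ultimately show ?thesis using vs(3) by simp
  qed
  have "w \<in> set vs" using C(3) vs Union_cycle_edges by auto
  then obtain k where k: "k < g" "w = vs ! k" using vs(3) by (auto simp: in_set_conv_nth)
  have "k \<noteq> 0" using k uw vs(4) adj_neq by metis
  then have "k = 1 \<or> k = g - 1 \<or> g > 3 \<and> k = 2 \<or> g > 3 \<and> Suc k = g - 1" using g g3 k(1) by linarith
  moreover have "\<not> (g > 3 \<and> k = 2)"
  proof
    assume a: "g > 3 \<and> k = 2"
    then have "adj u (vs ! 1)" "adj (vs ! 1) w" using step[of 0] step[of 1] vs(4) k by (auto simp: numeral_2_eq_2)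
    then show False using no_triangle[of u "vs ! 1" w] a uw adj_sym by blast
  qed
  moreover have "\<not> (g > 3 \<and> Suc k = g - 1)"
  proof
    assume a: "g > 3 \<and> Suc k = g - 1"
    then have "adj w (vs ! (g - 1))" "adj (vs ! (g - 1)) u" using step[of k] last vs(4) k by auto
    then show False using no_triangle[of u w "vs ! (g - 1)"] a uw by blast
  qed
  ultimately show ?thesis using cycle_edges_first[OF vs(1), of w] vs k by auto
qed

end

context cubic_girth_regular
begin

lemma truncation_of_signature_011:
  assumes s: "\<sigma> = [0, 1, 1]" and g5: "g \<le> 5"
  shows "\<exists>(\<Lambda> :: (nat, nat) multigraph) R.
    multigraph \<Lambda> \<and> loopless \<Lambda> \<and> mregular g \<Lambda> \<and> dihedral_scheme \<Lambda> R \<and>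
    digraph_iso (with_proj G) (with_proj (truncation \<Lambda> R))"
proof -
  have struct: "\<exists>x y z. nb v x y z \<and> eps G {v, x} = 1 \<and> eps G {v, y} = 1 \<and> eps G {v, z} = 0"
    if v: "v \<in> pverts G" for v
  proof -
    obtain x y z where n: "nb v x y z" using nb_ex[OF v] by blast
    have m: "{#eps G {v, x}, eps G {v, y}, eps G {v, z}#} = {#0, 1, 1#}"
      using sig_eps[OF n] s by (metis mset.simps mset_sorted_list_of_multiset)
    have "eps G {v, x} \<in># {#0, 1, 1#}" "eps G {v, y} \<in># {#0, 1, 1#}" "eps G {v, z} \<in># {#0, 1, 1#}"
      unfolding m[symmetric] by simp_all
    moreover have "eps G {v, x} + eps G {v, y} + eps G {v, z} = 2"
      using arg_cong[OF m, of sum_mset] by simp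
    ultimately consider "eps G {v, x} = 0" "eps G {v, y} = 1" "eps G {v, z} = 1"
      | "eps G {v, x} = 1" "eps G {v, y} = 0" "eps G {v, z} = 1"
      | "eps G {v, x} = 1" "eps G {v, y} = 1" "eps G {v, z} = 0" by auto
    then show ?thesis by cases (use n nb_swap'[OF n] nb_rot[OF n] in blast)+
  qed
  \<comment> \<open>The two edges of value 1 at a vertex follow its girth cycle; the edge of value 0
    leads to \<open>opp v\<close> and becomes an edge of the contracted graph.\<close>
  define ring where "ring a b \<longleftrightarrow> adj a b \<and> eps G {a, b} = 1" for a b
  define opp where "opp v = (THE z. adj v z \<and> eps G {v, z} = 0)" for v
  have ring_sym: "ring a b \<Longrightarrow> ring b a" for a b
    unfolding ring_def using adj_sym by (auto simp: insert_commute)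
  have struct': "\<exists>x y. nb v x y (opp v) \<and> ring v x \<and> ring v y \<and> eps G {v, opp v} = 0"
    if v: "v \<in> pverts G" for v
  proof -
    obtain x y z where n: "nb v x y z" "eps G {v, x} = 1" "eps G {v, y} = 1" "eps G {v, z} = 0"
      using struct[OF v] by blast
    have "opp v = z" unfolding opp_def
    proof (rule the_equality)
      show "w = z" if "adj v w \<and> eps G {v, w} = 0" for w
        using that nb_adj[OF n(1), of w] n by auto
    qed (use nbD[OF n(1)] n in auto)
    then show ?thesis using n nbD[OF n(1)] by (auto simp: ring_def)
  qed
  have adj_cases: "adj v w \<longleftrightarrow> ring v w \<or> w = opp v" if v: "v \<in> pverts G" for v w
    using struct'[OF v] nb_adj by (metis ring_def)
  have opp_adj: "adj v (opp v)" and opp_eps: "eps G {v, opp v} = 0" and opp_V: "opp v \<in> pverts G"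
    and not_ring_opp: "\<not> ring v (opp v)" if v: "v \<in> pverts G" for v
  proof -
    obtain x y where xy: "nb v x y (opp v)" "eps G {v, opp v} = 0" using struct'[OF v] by blast
    show "adj v (opp v)" "opp v \<in> pverts G" using nbD(4)[OF xy(1)] adj_verts(2) by blast+
    show "eps G {v, opp v} = 0" "\<not> ring v (opp v)" using xy(2) by (simp_all add: ring_def)
  qed
  have opp_opp: "opp (opp v) = v" if v: "v \<in> pverts G" for v
  proof -
    have "adj (opp v) v" "\<not> ring (opp v) v"
      using opp_adj[OF v] not_ring_opp[OF v] ring_sym adj_sym by blast+
    then show ?thesis using adj_cases[OF opp_V[OF v], of v] by simp
  qed
  have ring_C: "ring a b" if "C \<in> girth_cycles G" "{a, b} \<in> C" for C a b
  proof -
    have ab: "adj a b" using cycle_degree_two[OF girth_cycles_ucycles[OF that(1)] that(2)] by metis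
    moreover have "eps G {a, b} > 0" using eps_pos_iff that by blast
    ultimately show ?thesis using adj_cases[OF adj_verts(1)[OF ab], of b] opp_eps[OF adj_verts(1)[OF ab]] by auto
  qed
  have ring_unique: "C = C'"
    if "ring a b" "C \<in> girth_cycles G" "{a, b} \<in> C" "C' \<in> girth_cycles G" "{a, b} \<in> C'" for a b C C'
  proof -
    have "card {C \<in> girth_cycles G. {a, b} \<in> C} = 1" using that(1) unfolding ring_def eps_def by blast
    then obtain D where D: "{C \<in> girth_cycles G. {a, b} \<in> C} = {D}" by (rule card_1_singletonE)
    have "C \<in> {C \<in> girth_cycles G. {a, b} \<in> C}" "C' \<in> {C \<in> girth_cycles G. {a, b} \<in> C}"
      using that(2-5) by simp_all
    then show ?thesis unfolding D by simp
  qed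
  \<comment> \<open>Any girth cycle at \<open>v\<close> uses two ring edges there, and only two
    exist, so all of them share an edge that lies on a single girth cycle.\<close>
  have C_unique: "C = C'"
    if C: "C \<in> girth_cycles G" "v \<in> \<Union> C" and C': "C' \<in> girth_cycles G" "v \<in> \<Union> C'" for v C C'
  proof -
    have v: "v \<in> pverts G" using girth_cycle_verts C by blast
    obtain x y where n: "nb v x y (opp v)" "ring v x" using struct'[OF v] by blast
    have "{v, x} \<in> D" if D: "D \<in> girth_cycles G" "v \<in> \<Union> D" for D
    proof -
      obtain w where w: "{v, w} \<in> D" using D by (rule girth_cycle_edge)
      obtain w' where w': "w' \<noteq> w" "{v, w'} \<in> D"
        using cycle_degree_two[OF girth_cycles_ucycles[OF D(1)] w] by metis
      have "ring v w" "ring v w'" using ring_C D w w' by blast+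
      then have "w = x \<or> w = y" "w' = x \<or> w' = y"
        using nb_adj[OF n(1)] not_ring_opp[OF v] unfolding ring_def by blast+
      then show ?thesis using w w' by auto
    qed
    then show ?thesis using ring_unique[OF n(2)] C C' by blast
  qed
  define cyc where "cyc v = (THE C. C \<in> girth_cycles G \<and> v \<in> \<Union> C)" for v
  have C_ex: "\<exists>C. C \<in> girth_cycles G \<and> v \<in> \<Union> C" if v: "v \<in> pverts G" for v
  proof -
    obtain x where "ring v x" using struct'[OF v] by blast
    then have "eps G {v, x} > 0" by (simp add: ring_def)
    then show ?thesis using eps_pos_iff by blast
  qed
  have cyc_eq: "cyc v = C" if "C \<in> girth_cycles G" "v \<in> \<Union> C" for v C
    unfolding cyc_def using that C_unique by (intro the_equality) blast+
  have cyc_in: "cyc v \<in> girth_cycles G" "v \<in> \<Union> (cyc v)" if v: "v \<in> pverts G" for v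
    using C_ex[OF v] cyc_eq by metis+
  have cyc_class: "{v \<in> pverts G. cyc v = C} = \<Union> C" if C: "C \<in> girth_cycles G" for C
    using cyc_eq[OF C] cyc_in girth_cycle_verts[OF C] by blast
  have cyc_ring: "cyc a = cyc b" if r: "ring a b" for a b
  proof -
    have "eps G {a, b} > 0" using r by (simp add: ring_def)
    then obtain C where "C \<in> girth_cycles G" "{a, b} \<in> C" using eps_pos_iff by blast
    then have "cyc a = C" "cyc b = C" using cyc_eq by blast+
    then show ?thesis by simp
  qed
  \<comment> \<open>If both ends were on one girth cycle, the edge would be a chord or a side of it;
    chords do not exist, and sides have value 1.\<close>
  have cyc_opp: "cyc (opp v) \<noteq> cyc v" if v: "v \<in> pverts G" for v
  proof
    assume eq: "cyc (opp v) = cyc v"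
    have "{v, opp v} \<in> cyc v"
      using girth_cycle_chordless[OF g5 cyc_in(1)[OF v] cyc_in(2)[OF v] _ opp_adj[OF v]]
        cyc_in(2)[OF opp_V[OF v]] eq by simp
    then show False using ring_C cyc_in(1)[OF v] not_ring_opp[OF v] by blast
  qed
  have ring_path: "(a, b) \<in> {(a, b). ring a b}\<^sup>*"
    if ab: "a \<in> pverts G" "b \<in> pverts G" "cyc a = cyc b" for a b
  proof -
    let ?R = "{(a, b). ring a b}"
    obtain vs where vs: "vcycle vs" "cyc a = cycle_edges vs"
      using cyc_in(1)[OF ab(1)] by (auto simp: girth_cycles_eq)
    have *: "(vs ! 0, vs ! i) \<in> ?R\<^sup>*" if "i < length vs" for i
      using that
    proof (induction i)
      case (Suc i)
      have "{vs ! i, vs ! Suc i} \<in> cycle_edges vs"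
        unfolding cycle_edges_def using Suc.prems by (intro image_eqI[of _ _ i]) auto
      then have "ring (vs ! i) (vs ! Suc i)" using ring_C[OF cyc_in(1)[OF ab(1)]] vs(2) by simp
      then show ?case using Suc by (auto intro: rtrancl_into_rtrancl)
    qed simp
    have "a \<in> set vs" "b \<in> set vs"
      using cyc_in(2)[OF ab(1)] cyc_in(2)[OF ab(2)] ab(3) vs Union_cycle_edges[OF vs(1)] by auto
    then have "(vs ! 0, a) \<in> ?R\<^sup>*" "(vs ! 0, b) \<in> ?R\<^sup>*" using * by (auto simp: in_set_conv_nth)
    moreover have "sym (?R\<^sup>*)" by (rule sym_rtrancl) (use ring_sym in \<open>auto simp: sym_def\<close>)
    ultimately show ?thesis by (meson rtrancl_trans symD)
  qed

  define E0 where "E0 = (\<lambda>v. {v, opp v}) ` pverts G"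
  \<comment> \<open>The multigraph has to live on natural numbers, so girth cycles and matching
    edges are numbered injectively.\<close>
  obtain \<phi> :: "'a set set \<Rightarrow> nat" where \<phi>: "inj_on \<phi> (girth_cycles G)"
    using finite_imp_inj_to_nat_seg[OF finite_girth_cycles] by blast
  have finE: "finite E0" unfolding E0_def using pair_finite_verts by blast
  obtain \<psi> :: "'a set \<Rightarrow> nat" where \<psi>: "inj_on \<psi> E0"
    using finite_imp_inj_to_nat_seg[OF finE] by blast
  \<comment> \<open>Every matching edge keeps its own number; several of them between the same two
    girth cycles therefore become parallel edges.\<close>
  define \<Lambda> :: "(nat, nat) multigraph" where
    "\<Lambda> = \<lparr>mverts = \<phi> ` girth_cycles G, medges = \<psi> ` E0,
      mends = (\<lambda>e. (\<lambda>v. \<phi> (cyc v)) ` the_inv_into E0 \<psi> e)\<rparr>"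
  \<comment> \<open>A vertex corresponds to the arc along its matching edge that starts at its girth
    cycle. The flag is \<open>False\<close> because the contracted graph has no loops.\<close>
  define \<alpha> where "\<alpha> v = (\<psi> {v, opp v}, \<phi> (cyc v), False)" for v
  define R where "R = {(\<alpha> a, \<alpha> b) | a b. ring a b}"
  have inE: "{v, opp v} \<in> E0" if "v \<in> pverts G" for v using that by (auto simp: E0_def)
  have ends: "mends \<Lambda> (\<psi> {v, opp v}) = {\<phi> (cyc v), \<phi> (cyc (opp v))}" if v: "v \<in> pverts G" for v
    using the_inv_into_f_f[OF \<psi> inE[OF v]] by (simp add: \<Lambda>_def)
  have \<phi>_eq: "\<phi> (cyc a) = \<phi> (cyc b) \<longleftrightarrow> cyc a = cyc b" if "a \<in> pverts G" "b \<in> pverts G" for a b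
    using that \<phi> cyc_in by (auto simp: inj_on_def)
  have ends_ne: "\<phi> (cyc v) \<noteq> \<phi> (cyc (opp v))" if v: "v \<in> pverts G" for v
    using \<phi>_eq[OF v opp_V[OF v]] cyc_opp[OF v] by auto
  have same_edge: "w = v \<or> w = opp v" if "\<psi> {v, opp v} = \<psi> {w, opp w}" "v \<in> pverts G" "w \<in> pverts G" for v w
  proof -
    have "{v, opp v} = {w, opp w}" using that \<psi> inE by (auto simp: inj_on_def)
    then show ?thesis by (auto simp: doubleton_eq_iff)
  qed
  have \<alpha>_inj: "inj_on \<alpha> (pverts G)"
  proof (rule inj_onI)
    fix v w assume vw: "v \<in> pverts G" "w \<in> pverts G" "\<alpha> v = \<alpha> w"
    then have "w = v \<or> w = opp v" "cyc v = cyc w" using same_edge \<phi>_eq by (auto simp: \<alpha>_def)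
    then show "v = w" using cyc_opp[OF vw(1)] by auto
  qed
  have \<alpha>_eq: "\<alpha> a = \<alpha> b \<longleftrightarrow> a = b" if "a \<in> pverts G" "b \<in> pverts G" for a b
    using that \<alpha>_inj by (auto simp: inj_on_def)
  have opp_edge: "\<alpha> (opp v) = (\<psi> {v, opp v}, \<phi> (cyc (opp v)), False)" if v: "v \<in> pverts G" for v
    using opp_opp[OF v] by (simp add: \<alpha>_def insert_commute)
  have marcs: "marcs \<Lambda> = \<alpha> ` pverts G"
  proof (intro subset_antisym subsetI)
    fix t assume "t \<in> marcs \<Lambda>"
    then obtain e u b where t: "t = (e, u, b)" "e \<in> medges \<Lambda>" "u \<in> mends \<Lambda> e" "b \<longrightarrow> mends \<Lambda> e = {u}"
      by (auto simp: marcs_def)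
    then obtain v where v: "v \<in> pverts G" "e = \<psi> {v, opp v}" by (auto simp: \<Lambda>_def E0_def)
    have "\<not> b" using t(4) ends[OF v(1)] ends_ne[OF v(1)] unfolding v(2) by auto
    moreover have "u = \<phi> (cyc v) \<or> u = \<phi> (cyc (opp v))" using t(3) ends[OF v(1)] unfolding v(2) by auto
    ultimately have "t = \<alpha> v \<or> t = \<alpha> (opp v)" using t(1) v opp_edge by (auto simp: \<alpha>_def)
    then show "t \<in> \<alpha> ` pverts G" using v opp_V by auto
  next
    fix t assume "t \<in> \<alpha> ` pverts G"
    then obtain v where v: "v \<in> pverts G" "t = \<alpha> v" by blast
    then show "t \<in> marcs \<Lambda>" using ends[OF v(1)] inE[OF v(1)]
      by (auto simp: marcs_def \<alpha>_def) (simp add: \<Lambda>_def)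
  qed
  have mg: "multigraph \<Lambda>" and ll: "loopless \<Lambda>"
  proof -
    have "mends \<Lambda> e \<subseteq> mverts \<Lambda> \<and> card (mends \<Lambda> e) = 2" if e: "e \<in> medges \<Lambda>" for e
    proof -
      obtain v where v: "v \<in> pverts G" "e = \<psi> {v, opp v}" using e by (auto simp: \<Lambda>_def E0_def)
      have "\<phi> (cyc v) \<in> mverts \<Lambda>" "\<phi> (cyc (opp v)) \<in> mverts \<Lambda>"
        using cyc_in(1)[OF v(1)] cyc_in(1)[OF opp_V[OF v(1)]] by (simp_all add: \<Lambda>_def)
      then show ?thesis unfolding v(2) ends[OF v(1)] using ends_ne[OF v(1)] by simp
    qed
    then show "multigraph \<Lambda>" "loopless \<Lambda>"
      using finE finite_girth_cycles by (auto simp: multigraph_def loopless_def \<Lambda>_def)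
  qed
  have mout: "mout \<Lambda> (\<phi> C) = \<alpha> ` {v \<in> pverts G. cyc v = C}" if C: "C \<in> girth_cycles G" for C
  proof -
    have "\<phi> (cyc v) = \<phi> C \<longleftrightarrow> cyc v = C" if "v \<in> pverts G" for v
      using \<phi> cyc_in(1)[OF that] C by (auto simp: inj_on_def)
    then show ?thesis unfolding mout_def marcs by (auto simp: \<alpha>_def)
  qed
  have mr: "mregular g \<Lambda>"
    unfolding mregular_def
  proof
    fix u assume "u \<in> mverts \<Lambda>"
    then obtain C where C: "C \<in> girth_cycles G" "u = \<phi> C" by (auto simp: \<Lambda>_def)
    have "card (\<alpha> ` {v \<in> pverts G. cyc v = C}) = card {v \<in> pverts G. cyc v = C}"
      by (rule card_image) (rule inj_on_subset[OF \<alpha>_inj], blast)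
    then show "card (mout \<Lambda> u) = g"
      using mout[OF C(1)] C(2) cyc_class[OF C(1)] card_girth_cycle[OF C(1)] by simp
  qed
  have ringV: "a \<in> pverts G" "b \<in> pverts G" if "ring a b" for a b
    using that adj_verts unfolding ring_def by blast+
  have R_iff: "(\<alpha> a, \<alpha> b) \<in> R \<longleftrightarrow> ring a b" if "a \<in> pverts G" "b \<in> pverts G" for a b
    unfolding R_def using that \<alpha>_eq ringV by blast
  have R_sub: "R \<subseteq> marcs \<Lambda> \<times> marcs \<Lambda>" unfolding R_def marcs using ringV by auto
  let ?A = "with_proj \<lparr>pverts = marcs \<Lambda>, parcs = R\<rparr>"
  have wfA: "wf_digraph ?A" using R_sub by unfold_locales auto
  \<comment> \<open>Ring edges never leave a girth cycle, and the sides of a girth cycle connect all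
    its vertices; so the components of the scheme are the sets of arcs with a common tail.\<close>
  have reach: "\<alpha> a \<rightarrow>\<^sup>*\<^bsub>?A\<^esub> \<alpha> b \<longleftrightarrow> cyc a = cyc b" if ab: "a \<in> pverts G" "b \<in> pverts G" for a b
  proof
    assume "\<alpha> a \<rightarrow>\<^sup>*\<^bsub>?A\<^esub> \<alpha> b"
    then have "\<exists>c \<in> pverts G. \<alpha> b = \<alpha> c \<and> cyc a = cyc c"
    proof (induction rule: wf_digraph.reachable_induct[OF wfA, consumes 1])
      case 1
      then show ?case using ab by blast
    next
      case (2 s t)
      then obtain c where c: "c \<in> pverts G" "s = \<alpha> c" "cyc a = cyc c" by blast
      have "(s, t) \<in> R" using 2(2) by simp
      then obtain c' d where "s = \<alpha> c'" "t = \<alpha> d" "ring c' d" by (auto simp: R_def)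
      then have "c' = c" using c \<alpha>_eq ringV by metis
      then show ?case using \<open>t = \<alpha> d\<close> \<open>ring c' d\<close> c cyc_ring ringV by metis
    qed
    then show "cyc a = cyc b" using \<alpha>_eq ab by metis
  next
    assume "cyc a = cyc b"
    then have "(a, b) \<in> {(a, b). ring a b}\<^sup>*" using ring_path ab by blast
    then show "\<alpha> a \<rightarrow>\<^sup>*\<^bsub>?A\<^esub> \<alpha> b"
    proof (induction rule: rtrancl_induct)
      case base
      then show ?case using wf_digraph.reachable_refl[OF wfA] ab by (simp add: marcs)
    next
      case (step b c)
      then have "(\<alpha> b, \<alpha> c) \<in> R" by (auto simp: R_def)
      then show ?case using wf_digraph.reachable_adj_trans[OF wfA step.IH] by simp
    qed
  qed
  have scc: "pre_digraph.sccs_verts ?A = mout \<Lambda> ` mverts \<Lambda>"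
  proof (intro subset_antisym subsetI)
    fix S assume "S \<in> pre_digraph.sccs_verts ?A"
    then have S: "S \<noteq> {}" "\<And>u v. u \<in> S \<Longrightarrow> v \<in> S \<Longrightarrow> u \<rightarrow>\<^sup>*\<^bsub>?A\<^esub> v"
      "\<And>u v. u \<in> S \<Longrightarrow> v \<notin> S \<Longrightarrow> \<not> u \<rightarrow>\<^sup>*\<^bsub>?A\<^esub> v \<or> \<not> v \<rightarrow>\<^sup>*\<^bsub>?A\<^esub> u"
      by (auto simp: pre_digraph.sccs_verts_def)
    have sub: "S \<subseteq> \<alpha> ` pverts G"
    proof
      fix t assume "t \<in> S"
      then have "t \<rightarrow>\<^sup>*\<^bsub>?A\<^esub> t" using S by blast
      then show "t \<in> \<alpha> ` pverts G" unfolding marcs[symmetric] by (auto elim: reachable_in_vertsE)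
    qed
    obtain a where a: "a \<in> pverts G" "\<alpha> a \<in> S" using S(1) sub by blast
    have "S = \<alpha> ` {v \<in> pverts G. cyc v = cyc a}"
    proof (intro subset_antisym subsetI)
      fix t assume t: "t \<in> S"
      then obtain b where "b \<in> pverts G" "t = \<alpha> b" using sub by blast
      then show "t \<in> \<alpha> ` {v \<in> pverts G. cyc v = cyc a}" using reach S(2)[OF a(2) t] a(1) by auto
    next
      fix t assume "t \<in> \<alpha> ` {v \<in> pverts G. cyc v = cyc a}"
      then obtain b where "b \<in> pverts G" "cyc b = cyc a" "t = \<alpha> b" by blast
      then show "t \<in> S" using S(3)[OF a(2), of t] reach a(1) by auto
    qed
    then have "S = mout \<Lambda> (\<phi> (cyc a))" using mout cyc_in(1)[OF a(1)] by simp
    then show "S \<in> mout \<Lambda> ` mverts \<Lambda>" using cyc_in(1)[OF a(1)] by (simp add: \<Lambda>_def)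
  next
    fix S assume "S \<in> mout \<Lambda> ` mverts \<Lambda>"
    then obtain C where C: "C \<in> girth_cycles G" "S = mout \<Lambda> (\<phi> C)" by (auto simp: \<Lambda>_def)
    then have S: "S = \<alpha> ` {v \<in> pverts G. cyc v = C}" using mout by simp
    have "card (\<Union> C) \<noteq> 0" using card_girth_cycle[OF C(1)] girth_ge_3 by simp
    then have "\<Union> C \<noteq> {}" by (metis card.empty)
    then have "S \<noteq> {}" using S cyc_class[OF C(1)] by simp
    moreover have "u \<rightarrow>\<^sup>*\<^bsub>?A\<^esub> w" if "u \<in> S" "w \<in> S" for u w using that reach unfolding S by auto
    moreover have "\<not> u \<rightarrow>\<^sup>*\<^bsub>?A\<^esub> w" if "u \<in> S" "w \<notin> S" for u w
    proof
      assume r: "u \<rightarrow>\<^sup>*\<^bsub>?A\<^esub> w"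
      then have "w \<in> marcs \<Lambda>" by (auto elim: reachable_in_vertsE)
      then obtain b where "b \<in> pverts G" "w = \<alpha> b" using marcs by blast
      then show False using r that reach unfolding S by auto
    qed
    ultimately show "S \<in> pre_digraph.sccs_verts ?A" unfolding pre_digraph.sccs_verts_def by blast
  qed
  have reg: "regular 2 ?A"
    unfolding regular_def
  proof
    fix t assume "t \<in> verts ?A"
    then obtain v where v: "v \<in> pverts G" "t = \<alpha> v" by (auto simp: marcs)
    obtain x y where xy: "nb v x y (opp v)" "ring v x" "ring v y" using struct'[OF v(1)] by blast
    have V: "x \<in> pverts G" "y \<in> pverts G" using ringV xy by blast+
    have r: "ring v w \<longleftrightarrow> w = x \<or> w = y" for w
      using xy nb_adj[OF xy(1), of w] not_ring_opp[OF v(1)] by (auto simp: ring_def)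
    have "out_arcs ?A t = {(\<alpha> v, \<alpha> x), (\<alpha> v, \<alpha> y)}"
    proof (intro subset_antisym subsetI)
      fix p assume "p \<in> out_arcs ?A t"
      then have "p \<in> R" "fst p = \<alpha> v" using v(2) by auto
      then obtain a b where "p = (\<alpha> a, \<alpha> b)" "ring a b" "\<alpha> a = \<alpha> v" by (auto simp: R_def)
      moreover from this have "a = v" using \<alpha>_eq ringV v(1) by metis
      ultimately show "p \<in> {(\<alpha> v, \<alpha> x), (\<alpha> v, \<alpha> y)}" using r by auto
    next
      fix p assume "p \<in> {(\<alpha> v, \<alpha> x), (\<alpha> v, \<alpha> y)}"
      then show "p \<in> out_arcs ?A t" using R_iff v V xy by auto
    qed
    moreover have "\<alpha> x \<noteq> \<alpha> y" using \<alpha>_eq V nbD(5)[OF xy(1)] by simp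
    ultimately show "out_degree ?A t = 2" by (simp add: out_degree_def)
  qed
  have dih: "dihedral_scheme \<Lambda> R"
    unfolding dihedral_scheme_def Let_def
  proof (intro conjI)
    show "R \<subseteq> marcs \<Lambda> \<times> marcs \<Lambda>" by (rule R_sub)
    show "irrefl R"
    proof (rule irreflI)
      fix t show "(t, t) \<notin> R"
      proof
        assume "(t, t) \<in> R"
        then obtain a b where "(t, t) = (\<alpha> a, \<alpha> b)" "ring a b" unfolding R_def by blast
        then have "\<alpha> a = \<alpha> b" by (metis prod.inject)
        then show False using \<alpha>_eq ringV[OF \<open>ring a b\<close>] \<open>ring a b\<close> by (simp add: ring_def)
      qed
    qed
    show "sym R" unfolding R_def sym_def using ring_sym by blast
    show "regular 2 ?A" by (rule reg)
    show "pre_digraph.sccs_verts ?A = mout \<Lambda> ` mverts \<Lambda>" by (rule scc)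
  qed
  have "digraph_iso (with_proj G) (with_proj (truncation \<Lambda> R))"
  proof (rule iso_of_local_bijection)
    \<comment> \<open>The embedding has to lead from the truncation into \<open>G\<close>, hence the
      inverse of \<alpha>.\<close>
    let ?h = "the_inv_into (pverts G) \<alpha>"
    have h: "?h (\<alpha> v) = v" if "v \<in> pverts G" for v using that \<alpha>_inj by (simp add: the_inv_into_f_f)
    have P: "pverts (truncation \<Lambda> R) = \<alpha> ` pverts G" by (simp add: truncation_def marcs)
    show "pverts (truncation \<Lambda> R) \<noteq> {}" using verts_nonempty P by simp
    show "a \<in> pverts (truncation \<Lambda> R) \<and> b \<in> pverts (truncation \<Lambda> R)"
      if "(a, b) \<in> parcs (truncation \<Lambda> R)" for a b
      using that R_sub by (auto simp: truncation_def inverse_arcs_def)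
    show "inj_on ?h (pverts (truncation \<Lambda> R))"
      unfolding P by (rule inj_on_the_inv_into[OF \<alpha>_inj])
    fix u assume "u \<in> pverts (truncation \<Lambda> R)"
    then obtain v where v: "v \<in> pverts G" "u = \<alpha> v" using P by auto
    have "{t. (u, t) \<in> parcs (truncation \<Lambda> R)} = \<alpha> ` {w. adj v w}"
    proof (intro subset_antisym subsetI)
      fix t assume "t \<in> {t. (u, t) \<in> parcs (truncation \<Lambda> R)}"
      then have "(u, t) \<in> R \<or> (u, t) \<in> inverse_arcs \<Lambda>" by (simp add: truncation_def)
      moreover from this have "t \<in> marcs \<Lambda>" using R_sub by (auto simp: inverse_arcs_def)
      then obtain w where w: "w \<in> pverts G" "t = \<alpha> w" using marcs by blast
      ultimately have "ring v w \<or> \<psi> {v, opp v} = \<psi> {w, opp w} \<and> w \<noteq> v"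
        using R_iff v by (auto simp: inverse_arcs_def \<alpha>_def)
      then have "ring v w \<or> w = opp v" using same_edge v(1) w(1) by blast
      then show "t \<in> \<alpha> ` {w. adj v w}" using adj_cases[OF v(1)] w(2) by blast
    next
      fix t assume "t \<in> \<alpha> ` {w. adj v w}"
      then obtain w where w: "adj v w" "t = \<alpha> w" by blast
      have wV: "w \<in> pverts G" using w adj_verts by blast
      have "(u, t) \<in> R \<or> (u, t) \<in> inverse_arcs \<Lambda>"
      proof (cases "ring v w")
        case True
        then show ?thesis using R_iff v w wV by simp
      next
        case False
        then have "w = opp v" using adj_cases[OF v(1)] w by blast
        moreover have "\<alpha> (opp v) \<noteq> \<alpha> v" using \<alpha>_eq v(1) opp_V opp_adj adj_neq by metis
        moreover have "u \<in> marcs \<Lambda>" "t \<in> marcs \<Lambda>" using marcs v w wV by simp_all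
        moreover have "fst (\<alpha> v) = fst (\<alpha> (opp v))" unfolding opp_edge[OF v(1)] by (simp add: \<alpha>_def)
        ultimately show ?thesis using v(2) w(2) by (simp add: inverse_arcs_def)
      qed
      then show "t \<in> {t. (u, t) \<in> parcs (truncation \<Lambda> R)}" by (simp add: truncation_def)
    qed
    then have "?h ` {t. (u, t) \<in> parcs (truncation \<Lambda> R)} = (\<lambda>w. ?h (\<alpha> w)) ` {w. adj v w}"
      by (simp add: image_image)
    also have "\<dots> = {w. adj v w}" using h adj_verts(2) by force
    finally show "?h u \<in> pverts G \<and> ?h ` {t. (u, t) \<in> parcs (truncation \<Lambda> R)} = {z. adj (?h u) z}"
      using h v by simp
  qed
  then show ?thesis using mg ll mr dih by blast
qed

end

theorem theorem1p5:
  fixes \<Gamma> :: "'a pair_pre_digraph" and g :: nat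
  assumes "pair_graph \<Gamma>"
    and "Digraph_Component.connected (with_proj \<Gamma>)"
    and "regular 3 (with_proj \<Gamma>)"
    and "girth_regular \<Gamma>"
    and "girth \<Gamma> = enat g"
    and "g \<le> 5"
  shows
    "has_signature \<Gamma> [0, 1, 1] \<and>
       (\<exists>(\<Lambda> :: (nat, nat) multigraph) R.
          multigraph \<Lambda> \<and> loopless \<Lambda> \<and> mregular g \<Lambda> \<and> dihedral_scheme \<Lambda> R \<and>
          digraph_iso (with_proj \<Gamma>) (with_proj (truncation \<Lambda> R)))
     \<or> g = 3 \<and> complete_digraph 4 (with_proj \<Gamma>) \<and> has_signature \<Gamma> [2, 2, 2]
     \<or> g = 4 \<and>
       (\<exists>n\<ge>3. digraph_iso (with_proj \<Gamma>) (with_proj (prism n)) \<or>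
               digraph_iso (with_proj \<Gamma>) (with_proj (moebius_ladder n))) \<and>
       has_signature \<Gamma>
         (if complete_bipartite_digraph 3 3 (with_proj \<Gamma>) then [4, 4, 4]
          else if digraph_iso (with_proj \<Gamma>) (with_proj cube_graph) then [2, 2, 2]
          else [1, 1, 2])
     \<or> g = 5 \<and>
       (digraph_iso (with_proj \<Gamma>) (with_proj petersen_graph) \<and> has_signature \<Gamma> [4, 4, 4] \<or>
        digraph_iso (with_proj \<Gamma>) (with_proj dodecahedron_graph) \<and> has_signature \<Gamma> [2, 2, 2])"
proof -
  obtain \<sigma> where \<sigma>: "has_signature \<Gamma> \<sigma>" using assms(4) by (auto simp: girth_regular_def)
  interpret G: cubic_girth_regular \<Gamma> g \<sigma>
    by (intro cubic_girth_regular.intro cubic_girth_graph.intro cubic_graph.intro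
        cubic_graph_axioms.intro cubic_girth_graph_axioms.intro cubic_girth_regular_axioms.intro
        assms \<sigma>)
  consider "g = 3" | "g = 4" | "g = 5" using G.girth_ge_3 assms(6) by linarith
  then have "\<sigma> = [0, 1, 1] \<or> g = 3 \<and> complete_digraph 4 (with_proj \<Gamma>) \<and> \<sigma> = [2, 2, 2]
     \<or> g = 4 \<and>
       (\<exists>n\<ge>3. digraph_iso (with_proj \<Gamma>) (with_proj (prism n)) \<or>
               digraph_iso (with_proj \<Gamma>) (with_proj (moebius_ladder n))) \<and>
       \<sigma> = (if complete_bipartite_digraph 3 3 (with_proj \<Gamma>) then [4, 4, 4]
          else if digraph_iso (with_proj \<Gamma>) (with_proj cube_graph) then [2, 2, 2]
          else [1, 1, 2])
     \<or> g = 5 \<and>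
       (digraph_iso (with_proj \<Gamma>) (with_proj petersen_graph) \<and> \<sigma> = [4, 4, 4] \<or>
        digraph_iso (with_proj \<Gamma>) (with_proj dodecahedron_graph) \<and> \<sigma> = [2, 2, 2])"
    by cases (use G.girth_3_cases G.girth_4_cases G.girth_5_cases in blast)+
  \<comment> \<open>The truncation is supplied for all three girths at once, since its construction
    depends on the girth only through \<open>g \<le> 5\<close>.\<close>
  then show ?thesis using G.truncation_of_signature_011 assms(6) \<sigma> by blast
qed

end
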